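(* Let $\Omega$ be a compact, smoothly bounded subdomain of $\mathbb R^3$, $S^3$ or $H^3$, and let $R=R(\Omega)$ be the radius of a ball in that space having the same volume as $\Omega$. Let $V$ be a smooth vector field defined on $\Omega$. Then $$|BS(V)|\le N(R)\,|V|,$$ where - in $\mathbb R^3$, $N(R)=R$; - in $S^3$, $N(R)=\frac1\pi\big(2(1-\cos R)+(\pi-R)\sin R\big)$; - in $H^3$, $N(R)=\sinh R$. Consequently the helicity $H(V)=\langle BS(V),V\rangle$ satisfies $$|H(V)|\le N(R)\,|V|^2.$$
   Context: $S^3$ is the unit 3-sphere and $H^3$ is simply connected hyperbolic 3-space of curvature $-1$; all spaces are oriented. On smooth vector fields on $\Omega$ use the $L^2$ inner product $\langle V,W\rangle=\int_\Omega V\cdot W\,d(\mathrm{vol})$ and norm $|V|=\langle V,V\rangle^{1/2}$. The field $BS(V)$ is defined by $$BS(V)(y)=\int_\Omega P_{yx}V(x)\times\nabla_y\varphi(x,y)\,dx,$$ and is restricted to $y\in\Omega$ (so $|BS(V)|$ is its $L^2$ norm over $\Omega$). Here $\varphi(x,y)=\varphi(\alpha(x,y))$ with $\alpha$ the distance in the ambient space, $\nabla_y$ is the gradient in $y$, $dx$ is the volume element, and $P_{yx}$ is parallel transport from $x$ to $y$ along the minimizing geodesic segment (the identity in $\mathbb R^3$; on $S^3$ ambiguous only when $y=-x$, where $\nabla_y\varphi=0$). The kernels are: $\varphi(\alpha)=-\frac1{4\pi\alpha}$ in $\mathbb R^3$; $\varphi(\alpha)=-\frac1{4\pi^2}(\pi-\alpha)\csc\alpha$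 in $S^3$; $\varphi(\alpha)=-\frac1{4\pi}\operatorname{csch}\alpha$ in $H^3$. *)

theory Defs
  imports "HOL-Analysis.Analysis"
begin

section \<open>Oriented Riemannian 3-spaces inside a Euclidean space\<close>

text \<open>
  All tangent vectors are vectors of the ambient Euclidean space \<^typ>\<open>'a\<close>.  The field
  \<open>transport x y\<close> is the map $P_{yx}$ from the tangent space at \<open>x\<close> to the one at \<open>y\<close>, and
  \<open>kernel\<close> is the function $\varphi(\alpha)$ of the distance.
\<close>

record 'a space3 =
  points :: "'a set"
  tangent :: "'a \<Rightarrow> 'a set"
  metric :: "'a \<Rightarrow> 'a \<Rightarrow> real"
  distance :: "'a \<Rightarrow> 'a \<Rightarrow> real"
  volume :: "'a measure"
  cross :: "'a \<Rightarrow> 'a \<Rightarrow> 'a \<Rightarrow> 'a"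
  gradient :: "('a \<Rightarrow> real) \<Rightarrow> 'a \<Rightarrow> 'a"
  transport :: "'a \<Rightarrow> 'a \<Rightarrow> 'a \<Rightarrow> 'a"
  kernel :: "real \<Rightarrow> real"

section \<open>Domains and vector fields\<close>

primrec Ck_on ::
  "nat \<Rightarrow> 'a::euclidean_space set \<Rightarrow> ('a \<Rightarrow> 'b::real_normed_vector) \<Rightarrow> bool" where
  "Ck_on 0 U f \<longleftrightarrow> continuous_on U f"
| "Ck_on (Suc k) U f \<longleftrightarrow>
     (\<exists>f'. (\<forall>x\<in>U. (f has_derivative f' x) (at x)) \<and> (\<forall>v. Ck_on k U (\<lambda>x. f' x v)))"

definition smooth_on :: "'a::euclidean_space set \<Rightarrow> ('a \<Rightarrow> 'b::real_normed_vector) \<Rightarrow> bool" where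
  "smooth_on U f \<longleftrightarrow> open U \<and> (\<forall>k. Ck_on k U f)"

text \<open>
  Compact, with smooth boundary: near each of its points \<open>p\<close> the domain is a sublevel set of a
  smooth function that either is negative at \<open>p\<close> (an interior point) or has a nonzero
  differential along the space at \<open>p\<close>.  Connectedness is not required.
\<close>

definition smooth_domain :: "'a::euclidean_space space3 \<Rightarrow> 'a set \<Rightarrow> bool" where
  "smooth_domain M \<Omega> \<longleftrightarrow>
     \<Omega> \<noteq> {} \<and> compact \<Omega> \<and> \<Omega> \<subseteq> points M \<and>
     (\<forall>p\<in>\<Omega>. \<exists>U f :: 'a \<Rightarrow> real. p \<in> U \<and> smooth_on U f \<and>
        \<Omega> \<inter> U = {x \<in> points M \<inter> U. f x \<le> 0} \<and>
        (f p = 0 \<longrightarrow> (\<exists>v\<in>tangent M p. frechet_derivative f (at p) v \<noteq> 0)))"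

definition smooth_vector_field :: "'a::euclidean_space space3 \<Rightarrow> 'a set \<Rightarrow> ('a \<Rightarrow> 'a) \<Rightarrow> bool" where
  "smooth_vector_field M \<Omega> V \<longleftrightarrow>
     (\<forall>x\<in>\<Omega>. V x \<in> tangent M x) \<and>
     (\<exists>U W. \<Omega> \<subseteq> U \<and> smooth_on U W \<and> (\<forall>x\<in>\<Omega>. W x = V x))"

definition L2_inner :: "'a::euclidean_space space3 \<Rightarrow> 'a set \<Rightarrow> ('a \<Rightarrow> 'a) \<Rightarrow> ('a \<Rightarrow> 'a) \<Rightarrow> real" where
  "L2_inner M \<Omega> V W = (LINT x:\<Omega>|volume M. metric M (V x) (W x))"

definition L2_norm :: "'a::euclidean_space space3 \<Rightarrow> 'a set \<Rightarrow> ('a \<Rightarrow> 'a) \<Rightarrow> real" where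
  "L2_norm M \<Omega> V = sqrt (L2_inner M \<Omega> V V)"

definition BS :: "'a::euclidean_space space3 \<Rightarrow> 'a set \<Rightarrow> ('a \<Rightarrow> 'a) \<Rightarrow> 'a \<Rightarrow> 'a" where
  "BS M \<Omega> V y =
     (LINT x:\<Omega>|volume M.
        cross M y (transport M x y (V x)) (gradient M (\<lambda>z. kernel M (distance M x z)) y))"

definition helicity :: "'a::euclidean_space space3 \<Rightarrow> 'a set \<Rightarrow> ('a \<Rightarrow> 'a) \<Rightarrow> real" where
  "helicity M \<Omega> V = L2_inner M \<Omega> (BS M \<Omega> V) V"

text \<open>
  The least such radius is taken because on the sphere every \<open>R \<ge> \<pi>\<close> gives the whole space;
  otherwise the radius is unique.
\<close>

definition volume_radius :: "'a::euclidean_space space3 \<Rightarrow> 'a set \<Rightarrow> real" where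
  "volume_radius M \<Omega> =
     (LEAST R. 0 \<le> R \<and>
        (\<exists>p\<in>points M. emeasure (volume M) {x \<in> points M. distance M p x \<le> R}
                       = emeasure (volume M) \<Omega>))"

section \<open>Euclidean space\<close>

definition E3 :: "(real^3) space3" where
  "E3 = \<lparr> points = UNIV,
          tangent = (\<lambda>_. UNIV),
          metric = (\<bullet>),
          distance = dist,
          volume = lborel,
          cross = (\<lambda>_. cross3),
          gradient = (\<lambda>f y. THE D. GDERIV f y :> D),
          transport = (\<lambda>_ _ v. v),
          kernel = (\<lambda>\<alpha>. - 1 / (4 * pi * \<alpha>)) \<rparr>"

section \<open>Unit quadrics in four dimensions\<close>

text \<open>
  Let \<open>B\<close> be the Euclidean or the Lorentzian form on four-space and \<open>M\<close> the unit sphere, or a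
  sheet of the unit hyperboloid.  The tangent space at \<open>x\<close> is the \<open>B\<close>-orthogonal complement of
  \<open>x\<close>, and \<open>B\<close> restricts to the Riemannian metric.
\<close>

definition quadric_tangent :: "(real^4 \<Rightarrow> real^4 \<Rightarrow> real) \<Rightarrow> real^4 \<Rightarrow> (real^4) set" where
  "quadric_tangent B x = {v. B x v = 0}"

text \<open>
  Orientation: a frame \<open>u, v, w\<close> at \<open>y\<close> is positive if \<open>det [y, u, v, w] > 0\<close>.  That
  determinant is the Riemannian volume form on the tangent space.
\<close>

definition quadric_cross ::
  "(real^4 \<Rightarrow> real^4 \<Rightarrow> real) \<Rightarrow> real^4 \<Rightarrow> real^4 \<Rightarrow> real^4 \<Rightarrow> real^4" where
  "quadric_cross B y u v =
     (THE w. w \<in> quadric_tangent B y \<and>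
        (\<forall>z\<in>quadric_tangent B y. B w z = det (vector [y, u, v, z] :: real^4^4)))"

definition quadric_gradient ::
  "(real^4) set \<Rightarrow> (real^4 \<Rightarrow> real^4 \<Rightarrow> real) \<Rightarrow> (real^4 \<Rightarrow> real) \<Rightarrow> real^4 \<Rightarrow> real^4" where
  "quadric_gradient M B f y =
     (THE w. w \<in> quadric_tangent B y \<and>
        (\<forall>c v. range c \<subseteq> M \<and> c 0 = y \<and> (c has_vector_derivative v) (at 0) \<longrightarrow>
           ((\<lambda>t::real. f (c t)) has_real_derivative B w v) (at 0)))"

text \<open>
  The Levi-Civita derivative along a curve is the tangential part of the ambient derivative; a
  field is parallel if it vanishes.
\<close>

definition parallel_along ::
  "(real^4 \<Rightarrow> real^4 \<Rightarrow> real) \<Rightarrow> (real \<Rightarrow> real^4) \<Rightarrow> (real \<Rightarrow> real^4) \<Rightarrow> bool" where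
  "parallel_along B \<gamma> W \<longleftrightarrow>
     (\<forall>t\<in>{0..1}. W t \<in> quadric_tangent B (\<gamma> t) \<and>
        (\<exists>W'. (W has_vector_derivative W') (at t within {0..1}) \<and>
              (\<forall>z\<in>quadric_tangent B (\<gamma> t). B W' z = 0)))"

definition minimizing_geodesic ::
  "(real^4) set \<Rightarrow> (real^4 \<Rightarrow> real^4 \<Rightarrow> real) \<Rightarrow> (real^4 \<Rightarrow> real^4 \<Rightarrow> real) \<Rightarrow>
   real^4 \<Rightarrow> real^4 \<Rightarrow> (real \<Rightarrow> real^4) \<Rightarrow> bool" where
  "minimizing_geodesic M B d x y \<gamma> \<longleftrightarrow>
     \<gamma> ` {0..1} \<subseteq> M \<and> \<gamma> 0 = x \<and> \<gamma> 1 = y \<and>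
     (\<exists>\<gamma>'. (\<forall>t\<in>{0..1}. (\<gamma> has_vector_derivative \<gamma>' t) (at t within {0..1})) \<and>
           parallel_along B \<gamma> \<gamma>' \<and>
           integral {0..1} (\<lambda>t. sqrt (B (\<gamma>' t) (\<gamma>' t))) = d x y)"

text \<open>
  For antipodal points of the sphere the transported vector is not determined.
\<close>

definition quadric_transport ::
  "(real^4) set \<Rightarrow> (real^4 \<Rightarrow> real^4 \<Rightarrow> real) \<Rightarrow> (real^4 \<Rightarrow> real^4 \<Rightarrow> real) \<Rightarrow>
   real^4 \<Rightarrow> real^4 \<Rightarrow> real^4 \<Rightarrow> real^4" where
  "quadric_transport M B d x y v =
     (THE w. \<exists>\<gamma> W. minimizing_geodesic M B d x y \<gamma> \<and> parallel_along B \<gamma> W \<and> W 0 = v \<and> W 1 = w)"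

text \<open>
  Riemannian volume in a coordinate system \<open>\<psi>\<close>: the image of $\sqrt{\det (g_{ij})}\,du$, where
  $g_{ij}$ are the inner products of the coordinate vector fields.  The parametrization has to
  be injective and to cover the space up to a null set.
\<close>

definition gram :: "(real^4 \<Rightarrow> real^4 \<Rightarrow> real) \<Rightarrow> (real^3 \<Rightarrow> real^4) \<Rightarrow> real^3 \<Rightarrow> real^3^3" where
  "gram B \<psi> u =
     (\<chi> i j. B (frechet_derivative \<psi> (at u) (axis i 1)) (frechet_derivative \<psi> (at u) (axis j 1)))"

definition riemannian_volume ::
  "(real^4 \<Rightarrow> real^4 \<Rightarrow> real) \<Rightarrow> (real^3 \<Rightarrow> real^4) \<Rightarrow> (real^4) measure" where
  "riemannian_volume B \<psi> =
     distr (density lborel (\<lambda>u. ennreal (sqrt (det (gram B \<psi> u))))) borel \<psi>"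

section \<open>The 3-sphere\<close>

text \<open>Inverse stereographic projection; it misses only the point $(-1,0,0,0)$.\<close>

definition S3_chart :: "real^3 \<Rightarrow> real^4" where
  "S3_chart u = (1 / (1 + u \<bullet> u)) *\<^sub>R vector [1 - u \<bullet> u, 2 * u$1, 2 * u$2, 2 * u$3]"

definition S3_distance :: "real^4 \<Rightarrow> real^4 \<Rightarrow> real" where
  "S3_distance x y = arccos (x \<bullet> y)"

text \<open>
  The value at \<open>\<alpha> = \<pi>\<close> is the limit of \<open>(\<pi> - \<alpha>) csc \<alpha>\<close>; with it the kernel is smooth at the
  antipode, and its gradient vanishes there.
\<close>

definition S3_kernel :: "real \<Rightarrow> real" where
  "S3_kernel \<alpha> = - 1 / (4 * pi\<^sup>2) * (if \<alpha> = pi then 1 else (pi - \<alpha>) / sin \<alpha>)"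

definition S3 :: "(real^4) space3" where
  "S3 = \<lparr> points = sphere 0 1,
          tangent = quadric_tangent (\<bullet>),
          metric = (\<bullet>),
          distance = S3_distance,
          volume = riemannian_volume (\<bullet>) S3_chart,
          cross = quadric_cross (\<bullet>),
          gradient = quadric_gradient (sphere 0 1) (\<bullet>),
          transport = quadric_transport (sphere 0 1) (\<bullet>) S3_distance,
          kernel = S3_kernel \<rparr>"

section \<open>Hyperbolic 3-space\<close>

definition lorentz :: "real^4 \<Rightarrow> real^4 \<Rightarrow> real" where
  "lorentz x y = - (x$1 * y$1) + x$2 * y$2 + x$3 * y$3 + x$4 * y$4"

definition hyperboloid :: "(real^4) set" where
  "hyperboloid = {x. lorentz x x = - 1 \<and> 0 < x$1}"

definition H3_chart :: "real^3 \<Rightarrow> real^4" where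
  "H3_chart u = vector [sqrt (1 + u \<bullet> u), u$1, u$2, u$3]"

definition H3_distance :: "real^4 \<Rightarrow> real^4 \<Rightarrow> real" where
  "H3_distance x y = arcosh (- lorentz x y)"

definition H3 :: "(real^4) space3" where
  "H3 = \<lparr> points = hyperboloid,
          tangent = quadric_tangent lorentz,
          metric = lorentz,
          distance = H3_distance,
          volume = riemannian_volume lorentz H3_chart,
          cross = quadric_cross lorentz,
          gradient = quadric_gradient hyperboloid lorentz,
          transport = quadric_transport hyperboloid lorentz H3_distance,
          kernel = (\<lambda>\<alpha>. - 1 / (4 * pi * sinh \<alpha>)) \<rparr>"

definition N_E3 :: "real \<Rightarrow> real" where
  "N_E3 R = R"

definition N_S3 :: "real \<Rightarrow> real" where
  "N_S3 R = 1 / pi * (2 * (1 - cos R) + (pi - R) * sin R)"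

definition N_H3 :: "real \<Rightarrow> real" where
  "N_H3 R = sinh R"

end

theory Submission
  imports Defs
begin

text \<open>
  Let $s = \varphi'$ be the slope of the kernel as a function of the distance $\alpha$.  Parallel
  transport is an isometry, the gradient of $\varphi(\alpha(x, \cdot))$ at $y$ has length
  $s(\alpha(x,y))$, and $|u \times v| \le |u||v|$.  Hence
  $|BS(V)(y)| \le \int_\Omega s(\alpha(x,y))\,|V(x)|\,dx$, so that $BS$ is dominated by an integral
  operator with a symmetric nonnegative kernel.  The Schur test (\<open>schur_test\<close>) bounds the norm of
  that operator on $L^2(\Omega)$ by the supremum over $y$ of $\int_\Omega s(\alpha(x,y))\,dx$.  Since
  $s$ is decreasing, this integral is largest, among all sets with the volume of $\Omega$, for the ball
  of radius $R$ around $y$ (\<open>bathtub\<close>).  The spaces are homogeneous, so the value for the ball does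
  not depend on $y$; in polar coordinates it is $\int_0^R s(\alpha) A(\alpha)\,d\alpha = N(R)$, where
  $A(\alpha)$ is the area of the sphere of radius $\alpha$.  The bound for the helicity follows by the
  Cauchy-Schwarz inequality.  The locale \<open>biot_savart_space\<close> collects what this argument uses, and
  \<open>BS_bounds\<close> carries it out.

  The estimates are made with nonnegative integrals of the dominating operator, which is measurable
  by Tonelli's theorem; where the vector integral that defines $BS(V)(y)$ diverges, its value is zero
  by convention and the bound is trivial.

  The sphere and hyperbolic space are treated together, as unit quadrics of the form
  $B(x,y) = \sigma x_1y_1 + x_2y_2 + x_3y_3 + x_4y_4$ with $\sigma = \pm 1$ (\<open>unit_quadric\<close>).  A
  geodesic of speed $c$ satisfies $\gamma'' = -\sigma c^2\gamma$, which determines the minimizing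
  geodesic between $x$ and $y$ unless $y = \pm x$ (\<open>minimizing_geodesic_eq_arc\<close>); a parallel field
  along it is determined by its initial value and has constant length (\<open>transport_isometry\<close>).  The
  $B$-reflections act transitively.  In the chart $\psi$ a reflection becomes an involution $T$, and the
  chain rule for the Gram determinant, $\det g(u) = (\det DT(u))^2 \det g(Tu)$, is exactly what the
  change of variables formula needs for the volume to be invariant (\<open>riemannian_volume_invariant\<close>).
  This reduces every integral over a ball to a ball around the base point of the chart, where the
  density is radial and the fundamental theorem of calculus applies (\<open>radial_ball_integral\<close>).
\<close>

section \<open>The bathtub principle and the Schur test\<close>

text \<open>
  If \<open>f\<close> is not integrable, its integral is zero by convention.
\<close>

lemma ennreal_abs_integral_le:
  fixes f :: "'a \<Rightarrow> real"
  shows "ennreal \<bar>integral\<^sup>L M f\<bar> \<le> (\<integral>\<^sup>+x. ennreal \<bar>f x\<bar> \<partial>M)"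
proof (cases "integrable M f")
  case True
  then show ?thesis using integral_norm_bound_ennreal[of M f] by simp
qed (simp add: not_integrable_integral_eq)

text \<open>
  The sets \<open>A - B\<close> and \<open>B - A\<close> have the same measure, and \<open>f\<close> is at most \<open>c\<close> on the first and at
  least \<open>c\<close> on the second.
\<close>

lemma bathtub:
  fixes f :: "'a \<Rightarrow> ennreal"
  assumes [measurable]: "A \<in> sets M" "B \<in> sets M" "f \<in> borel_measurable M"
    and eq: "emeasure M A = emeasure M B" and fin: "emeasure M B < \<infinity>"
    and inside: "\<And>x. x \<in> B \<Longrightarrow> c \<le> f x"
    and outside: "\<And>x. x \<in> A - B \<Longrightarrow> f x \<le> c"
  shows "(\<integral>\<^sup>+x\<in>A. f x \<partial>M) \<le> (\<integral>\<^sup>+x\<in>B. f x \<partial>M)"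
proof -
  have eq': "emeasure M (A - B) = emeasure M (B - A)"
  proof -
    have parts: "A \<inter> B \<union> (A - B) = A" "A \<inter> B \<union> (B - A) = B" "A \<inter> B \<inter> (A - B) = {}" "A \<inter> B \<inter> (B - A) = {}"
      by auto
    have "emeasure M (A \<inter> B) + emeasure M (A - B) = emeasure M (A \<inter> B) + emeasure M (B - A)"
      using eq plus_emeasure[of "A \<inter> B" M "A - B"] plus_emeasure[of "A \<inter> B" M "B - A"] parts
      by (simp add: Int_Diff_disjoint)
    moreover have "emeasure M (A \<inter> B) < \<infinity>"
      using emeasure_mono[of "A \<inter> B" B M] fin by (auto simp: order.strict_trans1)
    ultimately show ?thesis by (auto simp: ennreal_add_left_cancel)
  qed
  have "(\<integral>\<^sup>+x\<in>A. f x \<partial>M) \<le> (\<integral>\<^sup>+x. f x * indicator (A \<inter> B) x + c * indicator (A - B) x \<partial>M)"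
    using outside by (intro nn_integral_mono) (auto split: split_indicator)
  also have "\<dots> = (\<integral>\<^sup>+x. f x * indicator (A \<inter> B) x \<partial>M) + c * emeasure M (A - B)"
    by (subst nn_integral_add) (auto simp: nn_integral_cmult_indicator)
  also have "\<dots> = (\<integral>\<^sup>+x. f x * indicator (A \<inter> B) x + c * indicator (B - A) x \<partial>M)"
    unfolding eq' by (subst nn_integral_add) (auto simp: nn_integral_cmult_indicator)
  also have "\<dots> \<le> (\<integral>\<^sup>+x\<in>B. f x \<partial>M)"
    using inside by (intro nn_integral_mono) (auto split: split_indicator)
  finally show ?thesis .
qed

text \<open>
  Splitting the kernel as $\sqrt k \cdot \sqrt k\,u$, the Cauchy-Schwarz inequality gives
  $(\int k u)^2 \le N \int k u^2$ at every point.  Integrating this and exchanging the integrals produces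
  the second factor \<open>N\<close>, because \<open>k\<close> is symmetric.
\<close>

lemma schur_test:
  fixes k :: "'a \<Rightarrow> 'a \<Rightarrow> real" and u :: "'a \<Rightarrow> ennreal"
  assumes "sigma_finite_measure M"
    and k[measurable]: "(\<lambda>(x, y). k x y) \<in> borel_measurable (M \<Otimes>\<^sub>M M)"
    and u[measurable]: "u \<in> borel_measurable M"
    and nonneg: "\<And>x y. 0 \<le> k x y" and sym: "\<And>x y. k x y = k y x"
    and bound: "AE y in M. (\<integral>\<^sup>+x. k x y \<partial>M) \<le> N"
  shows "(\<integral>\<^sup>+y. (\<integral>\<^sup>+x. k x y * u x \<partial>M)\<^sup>2 \<partial>M) \<le> N\<^sup>2 * (\<integral>\<^sup>+x. (u x)\<^sup>2 \<partial>M)"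
proof -
  interpret sigma_finite_measure M by fact
  interpret pair_sigma_finite M M ..
  have k1[measurable]: "(\<lambda>x. k x y) \<in> borel_measurable M" if "y \<in> space M" for y
    using measurable_compose[OF measurable_Pair2'[OF that] k] by simp
  have "(\<integral>\<^sup>+y. (\<integral>\<^sup>+x. k x y * u x \<partial>M)\<^sup>2 \<partial>M) \<le> (\<integral>\<^sup>+y. N * (\<integral>\<^sup>+x. k x y * (u x)\<^sup>2 \<partial>M) \<partial>M)"
  proof (intro nn_integral_mono_AE, use bound AE_space in eventually_elim, goal_cases)
    case (1 y)
    note k1[OF 1(2), measurable]
    have sq: "ennreal (sqrt (k x y)) * ennreal (sqrt (k x y)) = k x y" for x
      by (simp add: nonneg flip: ennreal_mult)
    have "(\<integral>\<^sup>+x. k x y * u x \<partial>M)\<^sup>2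
        = (\<integral>\<^sup>+x. ennreal (sqrt (k x y)) * (ennreal (sqrt (k x y)) * u x) \<partial>M)\<^sup>2"
      by (simp add: sq flip: mult.assoc)
    also have "\<dots> \<le> (\<integral>\<^sup>+x. (ennreal (sqrt (k x y)))\<^sup>2 \<partial>M) * (\<integral>\<^sup>+x. (ennreal (sqrt (k x y)) * u x)\<^sup>2 \<partial>M)"
      by (intro Cauchy_Schwarz_nn_integral) measurable
    also have "\<dots> = (\<integral>\<^sup>+x. k x y \<partial>M) * (\<integral>\<^sup>+x. k x y * (u x)\<^sup>2 \<partial>M)"
      by (simp add: power_mult_distrib power2_eq_square[of "ennreal _"] sq)
    also have "\<dots> \<le> N * (\<integral>\<^sup>+x. k x y * (u x)\<^sup>2 \<partial>M)"
      using 1(1) by (intro mult_right_mono) auto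
    finally show ?case .
  qed
  also have "\<dots> = N * (\<integral>\<^sup>+y. (\<integral>\<^sup>+x. k x y * (u x)\<^sup>2 \<partial>M) \<partial>M)"
    by (intro nn_integral_cmult) measurable
  also have "(\<integral>\<^sup>+y. (\<integral>\<^sup>+x. k x y * (u x)\<^sup>2 \<partial>M) \<partial>M) = (\<integral>\<^sup>+x. (\<integral>\<^sup>+y. k x y * (u x)\<^sup>2 \<partial>M) \<partial>M)"
    by (intro Fubini') measurable
  also have "\<dots> = (\<integral>\<^sup>+x. (\<integral>\<^sup>+y. k y x \<partial>M) * (u x)\<^sup>2 \<partial>M)"
    by (intro nn_integral_cong, subst sym, intro nn_integral_multc) measurable
  also have "\<dots> \<le> (\<integral>\<^sup>+x. N * (u x)\<^sup>2 \<partial>M)"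
    by (intro nn_integral_mono_AE, use bound in eventually_elim) (auto intro: mult_right_mono)
  also have "\<dots> = N * (\<integral>\<^sup>+x. (u x)\<^sup>2 \<partial>M)"
    by (intro nn_integral_cmult) measurable
  finally show ?thesis
    by (simp add: power2_eq_square mult.assoc mult_left_mono)
qed

section \<open>Norm of the Biot-Savart operator\<close>

text \<open>
  Here \<open>\<psi>\<close> is the slope of the kernel, \<open>F\<close> the volume of a ball as a function of its radius, \<open>N\<close> the
  integral of the slope over a ball, and \<open>D\<close> the set of all distances between points.  The function
  \<open>\<delta>\<close> is the distance, changed off the space so that it is measurable on the ambient space.  The last
  assumption is the pointwise bound of the integrand of the Biot-Savart field; it may fail for a null
  set of \<open>x\<close>, such as $\{y, -y\}$ on the sphere.
\<close>

locale biot_savart_space =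
  fixes M :: "'a::euclidean_space space3"
    and D :: "real set" and F N \<psi> :: "real \<Rightarrow> real" and \<delta> :: "'a \<Rightarrow> 'a \<Rightarrow> real"
  assumes sets_volume: "sets (volume M) = sets borel"
    and points_borel: "points M \<in> sets borel"
    and metric_bilinear: "bounded_bilinear (metric M)"
    and metric_sym: "metric M v w = metric M w v"
    and tangent_hyperplane:
      "x \<in> points M \<Longrightarrow> \<exists>l::'a \<Rightarrow> real. bounded_linear l \<and> tangent M x = {v. l v = 0}"
    and metric_nonneg: "x \<in> points M \<Longrightarrow> v \<in> tangent M x \<Longrightarrow> 0 \<le> metric M v v"
    and \<delta>_measurable: "(\<lambda>(x, y). \<delta> x y) \<in> borel_measurable (borel \<Otimes>\<^sub>M borel)"
    and distance_eq: "x \<in> points M \<Longrightarrow> y \<in> points M \<Longrightarrow> distance M x y = \<delta> x y"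
    and \<delta>_sym: "\<delta> x y = \<delta> y x"
    and \<delta>_in: "x \<in> points M \<Longrightarrow> y \<in> points M \<Longrightarrow> \<delta> x y \<in> D"
    and D_nonneg: "R \<in> D \<Longrightarrow> 0 \<le> R"
    and D_down: "R \<in> D \<Longrightarrow> 0 \<le> r \<Longrightarrow> r \<le> R \<Longrightarrow> r \<in> D"
    and bounded_radius: "compact \<Omega> \<Longrightarrow> \<Omega> \<subseteq> points M \<Longrightarrow> \<Omega> \<noteq> {} \<Longrightarrow>
      \<exists>p\<in>points M. \<exists>R\<in>D. \<forall>x\<in>\<Omega>. \<delta> p x \<le> R"
    and ball_volume: "p \<in> points M \<Longrightarrow> R \<in> D \<Longrightarrow>
      emeasure (volume M) {x \<in> points M. \<delta> p x \<le> R} = ennreal (F R)"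
    and F_continuous: "continuous_on D F"
    and F_strict_mono: "strict_mono_on D F"
    and F_zero: "F 0 = 0"
    and ball_kernel: "p \<in> points M \<Longrightarrow> R \<in> D \<Longrightarrow>
      (\<integral>\<^sup>+x\<in>{x \<in> points M. \<delta> p x \<le> R}. ennreal (\<psi> (\<delta> p x)) \<partial>volume M) = ennreal (N R)"
    and N_nonneg: "R \<in> D \<Longrightarrow> 0 \<le> N R"
    and \<psi>_measurable: "\<psi> \<in> borel_measurable borel"
    and \<psi>_nonneg: "r \<in> D \<Longrightarrow> 0 \<le> \<psi> r"
    and \<psi>_antimono: "R \<in> D \<Longrightarrow> 0 < r \<Longrightarrow> r \<le> R \<Longrightarrow> \<psi> R \<le> \<psi> r"
    and integrand: "y \<in> points M \<Longrightarrow> AE x in volume M. x \<in> points M \<longrightarrow> (\<forall>v\<in>tangent M x.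
      let w = cross M y (transport M x y v) (gradient M (\<lambda>z. kernel M (distance M x z)) y)
      in w \<in> tangent M y \<and> metric M w w \<le> (\<psi> (\<delta> x y))\<^sup>2 * metric M v v)"
begin

text \<open>
  The form is semidefinite on the tangent space, although it may be indefinite on the ambient space, as
  the Lorentzian form is.
\<close>

lemma metric_Cauchy_Schwarz:
  assumes x: "x \<in> points M" and v: "v \<in> tangent M x" and w: "w \<in> tangent M x"
  shows "\<bar>metric M v w\<bar> \<le> sqrt (metric M v v) * sqrt (metric M w w)"
proof -
  interpret m: bounded_bilinear "metric M" by (rule metric_bilinear)
  obtain l :: "'a \<Rightarrow> real" where l: "bounded_linear l" and T: "tangent M x = {v. l v = 0}"
    using tangent_hyperplane[OF x] by auto
  interpret l: bounded_linear l by fact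
  define a b c where "a = metric M v v" and "b = metric M v w" and "c = metric M w w"
  have q: "0 \<le> s\<^sup>2 * a + 2 * s * t * b + t\<^sup>2 * c" for s t
  proof -
    have "0 \<le> metric M (s *\<^sub>R v + t *\<^sub>R w) (s *\<^sub>R v + t *\<^sub>R w)"
      using v w by (intro metric_nonneg[OF x]) (auto simp: T l.add l.scaleR)
    also have "\<dots> = s\<^sup>2 * a + 2 * s * t * b + t\<^sup>2 * c"
      by (simp add: m.add_left m.add_right m.scaleR_left m.scaleR_right a_def b_def c_def
          metric_sym[of w v] power2_eq_square algebra_simps)
    finally show ?thesis .
  qed
  have a: "0 \<le> a" and c: "0 \<le> c" using q[of 1 0] q[of 0 1] by auto
  have "b\<^sup>2 \<le> a * c"
  proof (cases "a = 0")
    case True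
    have "b = 0"
    proof (rule ccontr)
      assume "b \<noteq> 0"
      then show False using q[of "- (c + 1) / (2 * b)" 1] True by (simp add: field_simps)
    qed
    then show ?thesis using True by simp
  next
    case False
    have "0 \<le> a * (a * c - b\<^sup>2)" using q[of b "-a"] by (simp add: power2_eq_square algebra_simps)
    then show ?thesis using a False by (simp add: zero_le_mult_iff)
  qed
  then have "\<bar>b\<bar> \<le> sqrt (a * c)" using real_sqrt_le_mono by fastforce
  then show ?thesis by (simp add: a_def b_def c_def real_sqrt_mult)
qed

lemma ball_measurable [measurable]: "{x \<in> points M. \<delta> p x \<le> R} \<in> sets (volume M)"
proof -
  have 1: "(\<lambda>x. \<delta> p x) \<in> borel_measurable borel"
    using measurable_compose[OF measurable_Pair1' \<delta>_measurable, of p] by simp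
  have "points M \<inter> ((\<lambda>x. \<delta> p x) -` {..R} \<inter> space borel) \<in> sets borel"
    using points_borel measurable_sets[OF 1] by (intro sets.Int) auto
  moreover have "points M \<inter> ((\<lambda>x. \<delta> p x) -` {..R} \<inter> space borel) = {x \<in> points M. \<delta> p x \<le> R}"
    by auto
  ultimately show ?thesis by (simp add: sets_volume)
qed

text \<open>
  A radius exists by the intermediate value theorem, because \<open>\<Omega>\<close> lies in some ball.  Since \<open>F\<close> is
  strictly increasing, no smaller radius gives the same volume, so that it is the least one.
\<close>

lemma volume_radius_props:
  assumes \<Omega>: "compact \<Omega>" "\<Omega> \<subseteq> points M" "\<Omega> \<noteq> {}"
  defines "R \<equiv> volume_radius M \<Omega>"
  shows "R \<in> D" "emeasure (volume M) \<Omega> = ennreal (F R)"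
proof -
  obtain p Q where p: "p \<in> points M" and Q: "Q \<in> D" and sub: "\<And>x. x \<in> \<Omega> \<Longrightarrow> \<delta> p x \<le> Q"
    using bounded_radius[OF \<Omega>] by auto
  have "emeasure (volume M) \<Omega> \<le> ennreal (F Q)"
    using emeasure_mono[of \<Omega> "{x \<in> points M. \<delta> p x \<le> Q}" "volume M"] ball_measurable[of p Q] sub \<Omega>
    by (auto simp: ball_volume[OF p Q])
  moreover have FQ: "0 \<le> F Q"
    using strict_mono_on_leD[OF F_strict_mono D_down[OF Q order_refl] Q] D_nonneg[OF Q] by (simp add: F_zero)
  ultimately obtain m where m: "emeasure (volume M) \<Omega> = ennreal m" "0 \<le> m" "m \<le> F Q"
    by (cases "emeasure (volume M) \<Omega>") (auto simp: top_unique)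
  have "continuous_on {0..Q} F"
    using F_continuous by (rule continuous_on_subset) (auto intro: D_down[OF Q])
  then obtain r where r: "0 \<le> r" "r \<le> Q" "F r = m"
    using IVT'[of F 0 m Q] m D_nonneg[OF Q] by (auto simp: F_zero)
  have rD: "r \<in> D" using D_down Q r by auto
  have ball: "emeasure (volume M) {x \<in> points M. distance M q x \<le> s} = ennreal (F s)"
    if "q \<in> points M" "s \<in> D" for q s
  proof -
    have "{x \<in> points M. distance M q x \<le> s} = {x \<in> points M. \<delta> q x \<le> s}"
      using that by (auto simp: distance_eq)
    then show ?thesis using ball_volume[OF that] by simp
  qed
  have "R = r"
    unfolding R_def volume_radius_def
  proof (rule Least_equality)
    show "0 \<le> r \<and> (\<exists>p\<in>points M. emeasure (volume M) {x \<in> points M. distance M p x \<le> r} = emeasure (volume M) \<Omega>)"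
      using r p m ball[OF p rD] by auto
  next
    fix s assume s: "0 \<le> s \<and> (\<exists>p\<in>points M. emeasure (volume M) {x \<in> points M. distance M p x \<le> s} = emeasure (volume M) \<Omega>)"
    show "r \<le> s"
    proof (rule ccontr)
      assume "\<not> r \<le> s"
      then have sD: "s \<in> D" and less: "s < r" using D_down[OF rD, of s] s by auto
      have "ennreal (F s) = ennreal m" using s ball[OF _ sD] m by auto
      moreover have "0 \<le> F s"
        using strict_mono_on_leD[OF F_strict_mono D_down[OF sD order_refl] sD] s by (auto simp: F_zero)
      ultimately have "F s = F r" using m r by simp
      then show False using strict_mono_onD[OF F_strict_mono sD rD less] by simp
    qed
  qed
  then show "R \<in> D" "emeasure (volume M) \<Omega> = ennreal (F R)"
    using rD m r by auto
qed

text \<open>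
  The bathtub principle for the superlevel sets of the slope, which are balls around \<open>y\<close>.
\<close>

lemma kernel_integral_bound:
  assumes \<Omega>: "compact \<Omega>" "\<Omega> \<subseteq> points M" "\<Omega> \<noteq> {}" and y: "y \<in> points M"
  shows "(\<integral>\<^sup>+x\<in>\<Omega>. ennreal (\<psi> (\<delta> y x)) \<partial>volume M) \<le> ennreal (N (volume_radius M \<Omega>))"
proof -
  define R where "R = volume_radius M \<Omega>"
  have R: "R \<in> D" "emeasure (volume M) \<Omega> = ennreal (F R)"
    using volume_radius_props[OF \<Omega>] by (auto simp: R_def)
  have [measurable]: "\<psi> \<in> borel_measurable borel" "(\<lambda>x. \<delta> y x) \<in> borel_measurable (volume M)"
    using \<psi>_measurable measurable_compose[OF measurable_Pair1' \<delta>_measurable, of y]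
    by (simp_all add: measurable_cong_sets[OF sets_volume])
  have \<Omega>_sets: "\<Omega> \<in> sets (volume M)" using \<Omega>(1) by (simp add: sets_volume borel_compact)
  define B where "B = {x \<in> points M. \<delta> y x \<le> R}"
  have B[measurable]: "B \<in> sets (volume M)" unfolding B_def by measurable
  show ?thesis
  proof (cases "R = 0")
    case True
    then have "\<Omega> \<in> null_sets (volume M)" using R \<Omega>_sets by (auto simp: F_zero)
    then have "(\<integral>\<^sup>+x\<in>\<Omega>. ennreal (\<psi> (\<delta> y x)) \<partial>volume M) = 0"
      by (auto simp: nn_integral_0_iff_AE \<Omega>_sets intro!: nn_integral_null_set)
    then show ?thesis by simp
  next
    case False
    then have Rpos: "0 < R" using D_nonneg[OF R(1)] by simp
    \<comment> \<open>At the centre the slope has a default value, although it grows without bound nearby. The value there is replaced by infinity, which affects a null set only, so that the function is at least \<open>\<psi> R\<close> on the whole ball.\<close>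
    define f where "f x = (if x \<in> points M \<and> \<delta> y x = 0 then top else ennreal (\<psi> (\<delta> y x)))" for x
    have [measurable]: "points M \<in> sets (volume M)" by (simp add: sets_volume points_borel)
    have [measurable]: "f \<in> borel_measurable (volume M)" unfolding f_def by measurable
    have null: "AE x in volume M. f x = ennreal (\<psi> (\<delta> y x))"
    proof -
      have "{x \<in> points M. \<delta> y x \<le> 0} \<in> null_sets (volume M)"
        using ball_volume[OF y D_down[OF R(1) order_refl D_nonneg[OF R(1)]]] ball_measurable[of y 0]
        by (auto simp: F_zero)
      then show ?thesis by (rule AE_I') (auto simp: f_def split: if_splits)
    qed
    have "(\<integral>\<^sup>+x\<in>\<Omega>. ennreal (\<psi> (\<delta> y x)) \<partial>volume M) = (\<integral>\<^sup>+x\<in>\<Omega>. f x \<partial>volume M)"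
      using null by (intro nn_integral_cong_AE) auto
    also have "\<dots> \<le> (\<integral>\<^sup>+x\<in>B. f x \<partial>volume M)"
    proof (rule bathtub)
      show "emeasure (volume M) \<Omega> = emeasure (volume M) B"
        using R ball_volume[OF y R(1)] by (simp add: B_def)
      show "emeasure (volume M) B < \<infinity>" using ball_volume[OF y R(1)] by (simp add: B_def)
      show "ennreal (\<psi> R) \<le> f x" if "x \<in> B" for x
      proof (cases "\<delta> y x = 0")
        case True then show ?thesis using that by (auto simp: f_def B_def)
      next
        case False
        have "x \<in> points M" "\<delta> y x \<le> R" using that by (auto simp: B_def)
        moreover have "0 < \<delta> y x" using D_nonneg[OF \<delta>_in[OF y]] False \<open>x \<in> points M\<close> by fastforce
        ultimately show ?thesis using False \<psi>_antimono[OF R(1)] by (auto simp: f_def intro!: ennreal_leI)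
      qed
      show "f x \<le> ennreal (\<psi> R)" if "x \<in> \<Omega> - B" for x
      proof -
        have "x \<in> points M" "R \<le> \<delta> y x" using that \<Omega> by (auto simp: B_def)
        then show ?thesis using Rpos \<psi>_antimono[OF \<delta>_in[OF y]] by (auto simp: f_def intro!: ennreal_leI)
      qed
    qed (use \<Omega>_sets in measurable)
    also have "\<dots> = (\<integral>\<^sup>+x\<in>B. ennreal (\<psi> (\<delta> y x)) \<partial>volume M)"
      using null by (intro nn_integral_cong_AE) auto
    also have "\<dots> = ennreal (N R)" unfolding B_def by (rule ball_kernel[OF y R(1)])
    finally show ?thesis by (simp add: R_def)
  qed
qed

theorem BS_bounds:
  assumes \<Omega>: "smooth_domain M \<Omega>" and V: "smooth_vector_field M \<Omega> V"
  defines "R \<equiv> volume_radius M \<Omega>"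
  shows "L2_norm M \<Omega> (BS M \<Omega> V) \<le> N R * L2_norm M \<Omega> V"
    and "\<bar>helicity M \<Omega> V\<bar> \<le> N R * (L2_norm M \<Omega> V)\<^sup>2"
proof -
  interpret m: bounded_bilinear "metric M" by (rule metric_bilinear)
  have dom: "compact \<Omega>" "\<Omega> \<subseteq> points M" "\<Omega> \<noteq> {}"
    using \<Omega> by (auto simp: smooth_domain_def)
  have R: "R \<in> D" "emeasure (volume M) \<Omega> = ennreal (F R)"
    using volume_radius_props[OF dom] by (auto simp: R_def)
  have NR: "0 \<le> N R" using N_nonneg R by auto
  have \<Omega>_borel: "\<Omega> \<in> sets borel" using dom(1) by (rule borel_compact)
  have \<Omega>_sets[measurable]: "\<Omega> \<in> sets (volume M)" using \<Omega>_borel by (simp add: sets_volume)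
  have VT: "V x \<in> tangent M x" if "x \<in> \<Omega>" for x
    using V that by (auto simp: smooth_vector_field_def)
  define nV where "nV x = indicator \<Omega> x * metric M (V x) (V x)" for x
  have V_cont: "continuous_on \<Omega> V"
  proof -
    obtain U W where UW: "\<Omega> \<subseteq> U" "smooth_on U W" "\<forall>x\<in>\<Omega>. W x = V x"
      using V by (auto simp: smooth_vector_field_def)
    have "continuous_on U W" using UW(2) by (auto simp: smooth_on_def dest: spec[of _ 0])
    then have "continuous_on \<Omega> W" using UW(1) by (rule continuous_on_subset)
    then show ?thesis using UW(3) by (simp cong: continuous_on_cong)
  qed
  have cont: "continuous_on \<Omega> (\<lambda>x. metric M (V x) (V x))"
    by (intro m.continuous_on V_cont)
  have nV_meas: "nV \<in> borel_measurable borel"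
    using borel_measurable_continuous_on_indicator[OF \<Omega>_borel cont] by (simp add: nV_def[abs_def])
  have nV_nonneg: "0 \<le> nV x" for x
    using metric_nonneg VT dom(2) by (auto simp: nV_def split: split_indicator)

  \<comment> \<open>Restricting the volume to \<open>\<Omega>\<close> gives a finite measure, for which Tonelli's theorem is available.\<close>
  define \<mu> where "\<mu> = density (volume M) (indicator \<Omega>)"
  have \<mu>_sets[measurable_cong, simp]: "sets \<mu> = sets borel" by (simp add: \<mu>_def sets_volume)
  have \<mu>_space[simp]: "space \<mu> = UNIV" using sets_eq_imp_space_eq[OF \<mu>_sets] by simp
  have "emeasure \<mu> (space \<mu>) = emeasure (volume M) \<Omega>"
    using emeasure_restricted[OF \<Omega>_sets, of UNIV] by (simp add: \<mu>_def[symmetric] sets_volume)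
  then interpret \<mu>: finite_measure \<mu> using R(2) by (intro finite_measureI) simp
  have nn_\<mu>: "(\<integral>\<^sup>+x. f x \<partial>\<mu>) = (\<integral>\<^sup>+x\<in>\<Omega>. f x \<partial>volume M)" if "f \<in> borel_measurable borel" for f
    unfolding \<mu>_def using that
    by (subst nn_integral_density) (auto simp: measurable_cong_sets[OF sets_volume] mult.commute intro!: borel_measurable_indicator \<Omega>_borel)

  \<comment> \<open>The absolute value makes the kernel nonnegative on the ambient space too; on points of the space it changes nothing.\<close>
  define k where "k x y = \<bar>\<psi> (\<delta> x y)\<bar>" for x y
  define u where "u x = ennreal (sqrt (nV x))" for x
  have k_meas: "(\<lambda>(x, y). k x y) \<in> borel_measurable (borel \<Otimes>\<^sub>M borel)"
    using measurable_compose[OF \<delta>_measurable \<psi>_measurable] by (simp add: k_def case_prod_beta)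
  have k_meas': "(\<lambda>(x, y). k x y) \<in> borel_measurable (\<mu> \<Otimes>\<^sub>M \<mu>)"
    using k_meas by (simp add: measurable_cong_sets[OF sets_pair_measure_cong[OF \<mu>_sets \<mu>_sets] refl])
  have k1: "(\<lambda>x. k x y) \<in> borel_measurable borel" for y
    using measurable_compose[OF measurable_Pair2' k_meas, of y] by simp
  have k2: "k x y = \<psi> (\<delta> x y)" if "x \<in> points M" "y \<in> points M" for x y
    using \<psi>_nonneg[OF \<delta>_in[OF that]] by (simp add: k_def)
  have u_meas: "u \<in> borel_measurable borel" unfolding u_def using nV_meas by measurable
  define T where "T y = (\<integral>\<^sup>+x. k x y * u x \<partial>\<mu>)" for y
  have T_meas: "T \<in> borel_measurable borel"
  proof -
    have "(\<lambda>(y, x). ennreal (k x y) * u x) \<in> borel_measurable (\<mu> \<Otimes>\<^sub>M \<mu>)"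
      using measurable_compose[OF measurable_pair_swap'[of \<mu> \<mu>] k_meas'] u_meas
      by (auto simp: case_prod_beta intro!: borel_measurable_times_ennreal measurable_compose[OF measurable_snd])
    from \<mu>.borel_measurable_nn_integral_fst[OF this] show ?thesis
      by (simp add: T_def[abs_def] measurable_cong_sets[OF \<mu>_sets refl])
  qed
  have norm_V: "(\<integral>\<^sup>+x. (u x)\<^sup>2 \<partial>\<mu>) = ennreal ((L2_norm M \<Omega> V)\<^sup>2)"
    and LV: "(L2_norm M \<Omega> V)\<^sup>2 = L2_inner M \<Omega> V V"
  proof -
    have "bounded ((\<lambda>x. metric M (V x) (V x)) ` \<Omega>)"
      using dom(1) cont by (intro compact_imp_bounded compact_continuous_image)
    then obtain C where C: "\<And>x. x \<in> \<Omega> \<Longrightarrow> norm (metric M (V x) (V x)) \<le> C"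
      by (auto simp: bounded_iff)
    have int: "integrable (volume M) nV"
    proof (rule integrableI_bounded_set[where A=\<Omega> and B=C])
      show "nV \<in> borel_measurable (volume M)" using nV_meas by (simp add: measurable_cong_sets[OF sets_volume])
    qed (use C R(2) in \<open>auto simp: nV_def\<close>)
    have nonneg: "0 \<le> L2_inner M \<Omega> V V"
      using nV_nonneg by (auto simp: L2_inner_def set_lebesgue_integral_def nV_def intro!: Bochner_Integration.integral_nonneg)
    then show LV: "(L2_norm M \<Omega> V)\<^sup>2 = L2_inner M \<Omega> V V" by (simp add: L2_norm_def)
    have "(\<integral>\<^sup>+x. (u x)\<^sup>2 \<partial>\<mu>) = (\<integral>\<^sup>+x. ennreal (nV x) \<partial>volume M)"
      unfolding nn_\<mu>[OF borel_measurable_power_ennreal[OF u_meas]] using nV_nonneg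
      by (intro nn_integral_cong) (auto simp: u_def ennreal_power nV_def split: split_indicator)
    also have "\<dots> = ennreal (integral\<^sup>L (volume M) nV)"
      using int nV_nonneg by (intro nn_integral_eq_integral) auto
    also have "\<dots> = ennreal (L2_inner M \<Omega> V V)"
      by (simp add: L2_inner_def set_lebesgue_integral_def nV_def[abs_def])
    finally show "(\<integral>\<^sup>+x. (u x)\<^sup>2 \<partial>\<mu>) = ennreal ((L2_norm M \<Omega> V)\<^sup>2)" by (simp add: LV)
  qed
  have schur: "(\<integral>\<^sup>+y. (T y)\<^sup>2 \<partial>\<mu>) \<le> ennreal ((N R * L2_norm M \<Omega> V)\<^sup>2)"
  proof -
    have "AE y in \<mu>. (\<integral>\<^sup>+x. k x y \<partial>\<mu>) \<le> N R"
    proof -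
      have bnd: "(\<integral>\<^sup>+x. k x y \<partial>\<mu>) \<le> N R" if y: "y \<in> \<Omega>" for y
      proof -
        have "(\<integral>\<^sup>+x. k x y \<partial>\<mu>) = (\<integral>\<^sup>+x\<in>\<Omega>. ennreal (\<psi> (\<delta> y x)) \<partial>volume M)"
          using y dom(2) k1 by (subst nn_\<mu>)
            (auto simp: k2 \<delta>_sym[of _ y] subset_iff split: split_indicator intro!: nn_integral_cong)
        also have "\<dots> \<le> N R" unfolding R_def using y dom by (intro kernel_integral_bound) auto
        finally show ?thesis .
      qed
      have "AE y in \<mu>. y \<in> \<Omega>" unfolding \<mu>_def by (subst AE_density) (auto simp: indicator_def)
      then show ?thesis by eventually_elim (rule bnd)
    qed
    then have "(\<integral>\<^sup>+y. (T y)\<^sup>2 \<partial>\<mu>) \<le> (ennreal (N R))\<^sup>2 * (\<integral>\<^sup>+x. (u x)\<^sup>2 \<partial>\<mu>)"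
      unfolding T_def using k_meas' u_meas \<delta>_sym
      by (intro schur_test) (auto simp: k_def intro: \<mu>.sigma_finite_measure_axioms)
    also have "\<dots> = ennreal ((N R * L2_norm M \<Omega> V)\<^sup>2)"
      using NR by (simp add: norm_V ennreal_power power_mult_distrib ennreal_mult)
    finally show ?thesis .
  qed

  define f where "f y x = cross M y (transport M x y (V x)) (gradient M (\<lambda>z. kernel M (distance M x z)) y)" for y x
  have pointwise: "BS M \<Omega> V y \<in> tangent M y \<and>
      ennreal (sqrt (metric M (BS M \<Omega> V y) (BS M \<Omega> V y))) \<le> T y" if y: "y \<in> \<Omega>" for y
  proof (cases "integrable (volume M) (\<lambda>x. indicator \<Omega> x *\<^sub>R f y x)")
    case False
    then have "BS M \<Omega> V y = 0"
      by (simp add: BS_def f_def[symmetric] set_lebesgue_integral_def not_integrable_integral_eq)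
    moreover obtain l :: "'a \<Rightarrow> real" where "bounded_linear l" "tangent M y = {v. l v = 0}"
      using tangent_hyperplane y dom(2) by blast
    ultimately show ?thesis by (simp add: m.zero_left linear_simps)
  next
    case int: True
    define g where "g = BS M \<Omega> V y"
    have g: "g = (\<integral>x. indicator \<Omega> x *\<^sub>R f y x \<partial>volume M)"
      by (simp add: g_def BS_def f_def[symmetric] set_lebesgue_integral_def)
    have yP: "y \<in> points M" using y dom(2) by auto
    have fT: "AE x in volume M. x \<in> \<Omega> \<longrightarrow> f y x \<in> tangent M y \<and>
        metric M (f y x) (f y x) \<le> (\<psi> (\<delta> x y))\<^sup>2 * metric M (V x) (V x)"
      using integrand[OF yP] by eventually_elim (use dom(2) VT in \<open>auto simp: f_def Let_def\<close>)
    obtain l :: "'a \<Rightarrow> real" where l: "bounded_linear l" and Ty: "tangent M y = {v. l v = 0}"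
      using tangent_hyperplane yP by blast
    have "l g = (\<integral>x. l (indicator \<Omega> x *\<^sub>R f y x) \<partial>volume M)"
      unfolding g using integral_bounded_linear[OF l int] by simp
    also have "\<dots> = 0"
    proof (rule integral_eq_zero_AE, use fT in eventually_elim)
      fix x assume "x \<in> \<Omega> \<longrightarrow> f y x \<in> tangent M y \<and>
        metric M (f y x) (f y x) \<le> (\<psi> (\<delta> x y))\<^sup>2 * metric M (V x) (V x)"
      then show "l (indicator \<Omega> x *\<^sub>R f y x) = 0"
        using l by (auto simp: Ty linear_simps split: split_indicator)
    qed
    finally have gT: "g \<in> tangent M y" by (simp add: Ty)
    define s where "s = sqrt (metric M g g)"
    have s: "0 \<le> s" "metric M g g = s\<^sup>2" using metric_nonneg[OF yP gT] by (auto simp: s_def)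
    \<comment> \<open>The metric may be indefinite on the ambient space, so the norm of the vector integral \<open>g\<close> is estimated by pairing \<open>g\<close> with itself.\<close>
    have "ennreal (s\<^sup>2) = ennreal \<bar>\<integral>x. metric M g (indicator \<Omega> x *\<^sub>R f y x) \<partial>volume M\<bar>"
      using integral_bounded_linear[OF m.bounded_linear_right[of g] int] s by (simp add: g[symmetric])
    also have "\<dots> \<le> (\<integral>\<^sup>+x. ennreal \<bar>metric M g (indicator \<Omega> x *\<^sub>R f y x)\<bar> \<partial>volume M)"
      by (rule ennreal_abs_integral_le)
    also have "\<dots> \<le> (\<integral>\<^sup>+x. ennreal s * ((k x y * u x) * indicator \<Omega> x) \<partial>volume M)"
      using fT
    proof (intro nn_integral_mono_AE, eventually_elim, goal_cases)
      case (1 x)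
      show ?case
      proof (cases "x \<in> \<Omega>")
        case x: True
        have nn: "0 \<le> metric M (V x) (V x)" using nV_nonneg[of x] x by (simp add: nV_def)
        have "\<bar>metric M g (f y x)\<bar> \<le> s * sqrt (metric M (f y x) (f y x))"
          unfolding s_def using 1 x by (intro metric_Cauchy_Schwarz[OF yP gT]) auto
        also have "\<dots> \<le> s * sqrt ((\<psi> (\<delta> x y))\<^sup>2 * metric M (V x) (V x))"
          using 1 x s by (intro mult_left_mono real_sqrt_le_mono) auto
        also have "\<dots> = s * (k x y * sqrt (nV x))" using x by (simp add: real_sqrt_mult k_def nV_def)
        finally show ?thesis using x s nn
          by (auto simp: u_def k_def nV_def ennreal_mult[symmetric] intro!: ennreal_leI)
      qed (simp add: m.zero_right)
    qed
    also have "\<dots> = ennreal s * T y"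
    proof -
      have meas: "(\<lambda>x. ennreal (k x y) * u x) \<in> borel_measurable borel"
        using k1[of y] u_meas by measurable
      then have "(\<lambda>x. ennreal (k x y) * u x) \<in> borel_measurable (volume M)"
        by (simp add: measurable_cong_sets[OF sets_volume refl])
      then have "(\<lambda>x. ennreal (k x y) * u x * indicator \<Omega> x) \<in> borel_measurable (volume M)"
        by measurable
      then show ?thesis by (simp add: nn_integral_cmult T_def nn_\<mu>[OF meas])
    qed
    finally have le: "ennreal s * ennreal s \<le> ennreal s * T y"
      using s by (simp add: ennreal_mult[symmetric] power2_eq_square)
    have "ennreal s \<le> T y"
    proof (cases "s = 0")
      case False
      then have "0 < s" using s by simp
      then show ?thesis using le by (subst (asm) ennreal_mult_le_mult_iff) auto
    qed simp
    then show ?thesis using gT by (simp add: g_def s_def)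
  qed
  define nB where "nB y = sqrt (metric M (BS M \<Omega> V y) (BS M \<Omega> V y))" for y
  show "L2_norm M \<Omega> (BS M \<Omega> V) \<le> N R * L2_norm M \<Omega> V"
  proof -
    have "ennreal (L2_inner M \<Omega> (BS M \<Omega> V) (BS M \<Omega> V)) \<le>
        (\<integral>\<^sup>+y. ennreal \<bar>indicator \<Omega> y *\<^sub>R metric M (BS M \<Omega> V y) (BS M \<Omega> V y)\<bar> \<partial>volume M)"
      unfolding L2_inner_def set_lebesgue_integral_def
      by (rule order_trans[OF ennreal_leI[OF abs_ge_self] ennreal_abs_integral_le])
    also have "\<dots> \<le> (\<integral>\<^sup>+y\<in>\<Omega>. (T y)\<^sup>2 \<partial>volume M)"
    proof (intro nn_integral_mono)
      fix y
      show "ennreal \<bar>indicator \<Omega> y *\<^sub>R metric M (BS M \<Omega> V y) (BS M \<Omega> V y)\<bar> \<le> (T y)\<^sup>2 * indicator \<Omega> y"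
      proof (cases "y \<in> \<Omega>")
        case True
        then have "0 \<le> metric M (BS M \<Omega> V y) (BS M \<Omega> V y)"
          using metric_nonneg pointwise dom(2) by blast
        then have "ennreal \<bar>metric M (BS M \<Omega> V y) (BS M \<Omega> V y)\<bar> = (ennreal (nB y))\<^sup>2"
          by (simp add: nB_def ennreal_power)
        also have "\<dots> \<le> (T y)\<^sup>2" using pointwise[OF True] by (intro power_mono) (auto simp: nB_def)
        finally show ?thesis using True by simp
      qed simp
    qed
    also have "\<dots> = (\<integral>\<^sup>+y. (T y)\<^sup>2 \<partial>\<mu>)" using T_meas by (subst nn_\<mu>) auto
    also note schur
    finally have "L2_inner M \<Omega> (BS M \<Omega> V) (BS M \<Omega> V) \<le> (N R * L2_norm M \<Omega> V)\<^sup>2"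
      by simp
    then have "L2_norm M \<Omega> (BS M \<Omega> V) \<le> sqrt ((N R * L2_norm M \<Omega> V)\<^sup>2)"
      unfolding L2_norm_def[of M \<Omega> "BS M \<Omega> V"] by (rule real_sqrt_le_mono)
    also have "\<dots> = N R * L2_norm M \<Omega> V"
      using NR LV by (simp add: L2_norm_def real_sqrt_mult)
    finally show ?thesis .
  qed
  show "\<bar>helicity M \<Omega> V\<bar> \<le> N R * (L2_norm M \<Omega> V)\<^sup>2"
  proof -
    have "ennreal \<bar>helicity M \<Omega> V\<bar> \<le>
        (\<integral>\<^sup>+y. ennreal \<bar>indicator \<Omega> y *\<^sub>R metric M (BS M \<Omega> V y) (V y)\<bar> \<partial>volume M)"
      unfolding helicity_def L2_inner_def set_lebesgue_integral_def
      by (rule ennreal_abs_integral_le)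
    also have "\<dots> \<le> (\<integral>\<^sup>+y\<in>\<Omega>. (T y * u y) \<partial>volume M)"
    proof (intro nn_integral_mono)
      fix y
      show "ennreal \<bar>indicator \<Omega> y *\<^sub>R metric M (BS M \<Omega> V y) (V y)\<bar> \<le> (T y * u y) * indicator \<Omega> y"
      proof (cases "y \<in> \<Omega>")
        case True
        have "\<bar>metric M (BS M \<Omega> V y) (V y)\<bar> \<le> nB y * sqrt (metric M (V y) (V y))"
          unfolding nB_def using True dom(2) pointwise VT by (intro metric_Cauchy_Schwarz[of y]) auto
        also have "\<dots> = nB y * sqrt (nV y)" using True by (simp add: nV_def)
        finally have "ennreal \<bar>metric M (BS M \<Omega> V y) (V y)\<bar> \<le> ennreal (nB y * sqrt (nV y))"
          by (rule ennreal_leI)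
        also have "\<dots> = ennreal (nB y) * u y"
          using nV_nonneg by (simp add: u_def ennreal_mult'')
        also have "\<dots> \<le> T y * u y" using pointwise[OF True] by (intro mult_right_mono) (auto simp: nB_def)
        finally show ?thesis using True by simp
      qed simp
    qed
    also have "\<dots> = (\<integral>\<^sup>+y. T y * u y \<partial>\<mu>)" using T_meas u_meas by (subst nn_\<mu>) auto
    finally have "(ennreal \<bar>helicity M \<Omega> V\<bar>)\<^sup>2 \<le> (\<integral>\<^sup>+y. T y * u y \<partial>\<mu>)\<^sup>2" by (intro power_mono) auto
    also have "\<dots> \<le> (\<integral>\<^sup>+y. (T y)\<^sup>2 \<partial>\<mu>) * (\<integral>\<^sup>+y. (u y)\<^sup>2 \<partial>\<mu>)"
      using T_meas u_meas by (intro Cauchy_Schwarz_nn_integral) (auto simp: measurable_cong_sets[OF \<mu>_sets refl])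
    also have "\<dots> \<le> ennreal ((N R * L2_norm M \<Omega> V)\<^sup>2) * ennreal ((L2_norm M \<Omega> V)\<^sup>2)"
      using schur by (simp add: norm_V mult_right_mono)
    also have "\<dots> = ennreal ((N R * (L2_norm M \<Omega> V)\<^sup>2)\<^sup>2)"
    proof -
      have eq: "(N R * (L2_norm M \<Omega> V)\<^sup>2)\<^sup>2 = (N R * L2_norm M \<Omega> V)\<^sup>2 * (L2_norm M \<Omega> V)\<^sup>2"
        by (simp add: power2_eq_square mult_ac)
      show ?thesis unfolding eq by (rule ennreal_mult[symmetric]) simp_all
    qed
    finally have "(helicity M \<Omega> V)\<^sup>2 \<le> (N R * (L2_norm M \<Omega> V)\<^sup>2)\<^sup>2"
      by (simp add: ennreal_power ennreal_le_iff)
    then show ?thesis using NR by (simp add: abs_le_square_iff[symmetric] abs_mult)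
  qed
qed
end

section \<open>Radial integrals and isometry invariance of Riemannian volume\<close>

text \<open>
  The image of Lebesgue measure under the norm is $4\pi r^2\,dr$: both measures give the volume
  $\frac43\pi a^3$ to $\{r \le a\}$, and these sets generate the Borel sets.
\<close>

lemma nn_integral_radial:
  fixes h :: "real \<Rightarrow> ennreal"
  assumes [measurable]: "h \<in> borel_measurable borel"
  shows "(\<integral>\<^sup>+u. h (norm (u :: real^3)) \<partial>lborel) = (\<integral>\<^sup>+r\<in>{0..}. ennreal (4 * pi * r\<^sup>2) * h r \<partial>lborel)"
proof -
  define \<nu> where "\<nu> = density lborel (\<lambda>r. ennreal (4 * pi * r\<^sup>2) * indicator {0..} r)"
  have \<nu>: "emeasure \<nu> {..a} = ennreal (4 / 3 * pi * a ^ 3)" if "0 \<le> a" for a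
  proof -
    have "emeasure \<nu> {..a} = (\<integral>\<^sup>+r. ennreal (4 * pi * r\<^sup>2) * indicator {0..a} r \<partial>lborel)"
      unfolding \<nu>_def by (subst emeasure_density) (auto intro!: nn_integral_cong split: split_indicator)
    also have "\<dots> = ennreal (4 / 3 * pi * a ^ 3 - 4 / 3 * pi * 0 ^ 3)"
      using that by (intro nn_integral_FTC_Icc)
        (auto intro!: derivative_eq_intros simp: power2_eq_square simp flip: has_real_derivative_iff_has_vector_derivative)
    finally show ?thesis by simp
  qed
  have ball: "emeasure lborel {u :: real^3. norm u \<le> a} = ennreal (4 / 3 * pi * a ^ 3)" if "0 \<le> a" for a
  proof -
    have "{u :: real^3. norm u \<le> a} = cball 0 a" by auto
    then show ?thesis using emeasure_cball[OF that, of "0 :: real^3"] by (simp add: unit_ball_vol_3)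
  qed
  have "distr lborel borel (norm :: real^3 \<Rightarrow> real) = \<nu>"
  proof (rule measure_eqI_generator_eq[where E = "range atMost" and \<Omega> = UNIV and A = "\<lambda>n. {.. real n}"])
    show "Int_stable (range atMost :: real set set)"
    proof (rule Int_stableI, clarify)
      fix a b :: real
      have "{..a} \<inter> {..b} = {..min a b}" by auto
      then show "{..a} \<inter> {..b} \<in> range atMost" by simp
    qed
    show "sets (distr lborel borel (norm :: real^3 \<Rightarrow> real)) = sigma_sets UNIV (range atMost)" "sets \<nu> = sigma_sets UNIV (range atMost)"
      by (simp_all add: \<nu>_def borel_eq_atMost)
    show "(\<Union>i. {..real i}) = UNIV" using real_arch_simple by auto
    show "emeasure (distr lborel borel (norm :: real^3 \<Rightarrow> real)) {..real i} \<noteq> \<infinity>" for i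
      using ball[of "real i"] by (simp add: emeasure_distr vimage_def)
    fix X :: "real set" assume "X \<in> range atMost"
    then obtain a where X: "X = {..a}" by auto
    show "emeasure (distr lborel borel (norm :: real^3 \<Rightarrow> real)) X = emeasure \<nu> X"
    proof (cases "0 \<le> a")
      case True
      then show ?thesis using ball[OF True] \<nu>[OF True] by (simp add: X emeasure_distr vimage_def)
    next
      case False
      then have "\<not> norm u \<le> a" for u :: "real^3" using norm_ge_zero[of u] by linarith
      moreover have "emeasure \<nu> {..a} \<le> emeasure \<nu> {..0}"
        using False by (intro emeasure_mono) (auto simp: \<nu>_def)
      ultimately show ?thesis using \<nu>[of 0] by (simp add: X emeasure_distr vimage_def)
    qed
  qed auto
  then have "(\<integral>\<^sup>+u. h (norm (u :: real^3)) \<partial>lborel) = (\<integral>\<^sup>+r. h r \<partial>\<nu>)"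
    by (subst nn_integral_distr[symmetric]) auto
  also have "\<dots> = (\<integral>\<^sup>+r\<in>{0..}. ennreal (4 * pi * r\<^sup>2) * h r \<partial>lborel)"
    unfolding \<nu>_def by (subst nn_integral_density) (auto simp: mult_ac)
  finally show ?thesis .
qed

text \<open>
  Change of variables for nonnegative functions.  By the change of variables for measures, the image of
  the measure with density $|\det DT|$ on \<open>S\<close> agrees with Lebesgue measure on boxes, hence everywhere.
  As \<open>T\<close> is an involution, it is injective and the image of the preimage of a box is the box, up to
  the null set outside \<open>S\<close>.
\<close>

lemma nn_integral_involution:
  fixes T :: "real^'n::{finite,wellorder} \<Rightarrow> real^'n::_" and w :: "real^'n::_ \<Rightarrow> real"
  assumes S: "open S" "- S \<in> null_sets lborel"
    and T: "\<And>u. u \<in> S \<Longrightarrow> (T has_derivative T' u) (at u)" "\<And>u. u \<in> S \<Longrightarrow> T u \<in> S" "\<And>u. u \<in> S \<Longrightarrow> T (T u) = u"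
    and w: "w \<in> borel_measurable borel" "\<And>u. u \<in> S \<Longrightarrow> w u = \<bar>det (matrix (T' u))\<bar>"
    and h: "h \<in> borel_measurable borel"
  shows "(\<integral>\<^sup>+u\<in>S. ennreal (w u) * h (T u) \<partial>lborel) = (\<integral>\<^sup>+u. h u \<partial>lborel)"
proof -
  note [measurable] = w(1) h
  have [measurable]: "S \<in> sets borel" using S(1) by simp
  define G where "G u = indicator S u *\<^sub>R T u" for u
  have G: "G u = T u" if "u \<in> S" for u using that by (simp add: G_def)
  have "continuous_on S T"
    by (rule has_derivative_continuous_on[of S T T'], rule has_derivative_at_withinI, rule T(1))
  then have [measurable]: "G \<in> borel_measurable borel"
    unfolding G_def[abs_def] by (intro borel_measurable_continuous_on_indicator) auto
  define \<nu> where "\<nu> = density lborel (\<lambda>u. ennreal (w u) * indicator S u)"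
  have "lborel = distr \<nu> borel G"
  proof (rule lborel_eqI)
    fix l r :: "real^'n::_" assume lr: "\<And>b. b \<in> Basis \<Longrightarrow> l \<bullet> b \<le> r \<bullet> b"
    define Q where "Q = S \<inter> box l r"
    have Q[measurable]: "Q \<in> sets borel" unfolding Q_def by measurable
    have eQ: "emeasure lborel Q = emeasure lborel (box l r)"
    proof (rule emeasure_eq_AE)
      show "AE x in lborel. (x \<in> Q) = (x \<in> box l r)"
        by (rule AE_I'[OF S(2)]) (auto simp: Q_def)
    qed (auto simp: Q_def)
    define E where "E = S \<inter> G -` box l r"
    have Gbox: "G -` box l r \<in> sets borel" using measurable_sets[of G borel borel "box l r"] by simp
    note [measurable] = Gbox
    have [measurable]: "E \<in> sets borel" unfolding E_def by measurable
    have TE: "T ` E = Q"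
    proof (intro equalityI subsetI)
      fix v assume v: "v \<in> Q"
      then have "T v \<in> E" "v = T (T v)" using T(2,3) by (auto simp: E_def Q_def G)
      then show "v \<in> T ` E" by blast
    qed (use T(2) in \<open>auto simp: E_def Q_def G\<close>)
    have m: "Q \<in> lmeasurable"
    proof (rule fmeasurableI)
      show "emeasure lebesgue Q < \<infinity>"
        using eQ emeasure_lborel_box_finite[of l r] by (simp add: emeasure_completion)
    qed auto
    have "((\<lambda>x. \<bar>det (matrix (T' x))\<bar>) has_integral measure lebesgue Q) E"
      using m
    proof (subst has_measure_differentiable_image[symmetric, where f = T])
      show "(T has_derivative T' x) (at x within E)" if "x \<in> E" for x
        using T(1) that by (auto simp: E_def intro: has_derivative_at_withinI)
      show "inj_on T E" using T(3) by (intro inj_on_inverseI[of E T T]) (auto simp: E_def)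
    qed (auto simp: TE)
    from nn_integral_has_integral_lebesgue'[OF _ this]
    have "(\<integral>\<^sup>+x. ennreal (w x) * indicator E x \<partial>lborel) = ennreal (measure lebesgue Q)"
      by (subst nn_integral_cong[of lborel _ "\<lambda>x. ennreal \<bar>det (matrix (T' x))\<bar> * indicator E x"])
        (auto simp: w(2) E_def split: split_indicator)
    also have "\<dots> = emeasure lborel (box l r)"
      using m eQ by (subst emeasure_eq_measure2[symmetric]) (auto simp: emeasure_completion)
    also have "\<dots> = ennreal (\<Prod>b\<in>Basis. (r - l) \<bullet> b)"
      using lr by (rule emeasure_lborel_box)
    also have "(\<integral>\<^sup>+x. ennreal (w x) * indicator E x \<partial>lborel) = emeasure (distr \<nu> borel G) (box l r)"
      unfolding \<nu>_def by (subst emeasure_distr)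
        (auto simp: emeasure_density[OF _ Gbox[folded sets_lborel]] Gbox E_def intro!: nn_integral_cong split: split_indicator)
    finally show "emeasure (distr \<nu> borel G) (box l r) = (\<Prod>b\<in>Basis. (r - l) \<bullet> b)" by simp
  qed simp
  then have "(\<integral>\<^sup>+u. h u \<partial>lborel) = (\<integral>\<^sup>+u. h u \<partial>distr \<nu> borel G)" by simp
  also have "\<dots> = (\<integral>\<^sup>+u. h (G u) \<partial>\<nu>)" by (intro nn_integral_distr) (auto simp: \<nu>_def)
  also have "\<dots> = (\<integral>\<^sup>+u\<in>S. ennreal (w u) * h (T u) \<partial>lborel)"
    unfolding \<nu>_def by (subst nn_integral_density) (auto simp: G intro!: nn_integral_cong split: split_indicator)
  finally show ?thesis ..
qed

text \<open>
  If $D = D' \circ A$ up to an isometry of \<open>B\<close>, the two Gram matrices satisfy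
  $G = A^{\mathsf T} G' A$.
\<close>

lemma gram_chain_rule:
  fixes A :: "real^3 \<Rightarrow> real^3" and D D' :: "real^3 \<Rightarrow> real^4"
  assumes B: "bounded_bilinear B" and A: "linear A" and D': "linear D'"
    and eq: "\<And>i j. B (D (axis i 1)) (D (axis j 1)) = B (D' (A (axis i 1))) (D' (A (axis j 1)))"
  shows "det (\<chi> i j. B (D (axis i 1)) (D (axis j 1)) :: real^3^3) =
    (det (matrix A))\<^sup>2 * det (\<chi> i j. B (D' (axis i 1)) (D' (axis j 1)) :: real^3^3)"
proof -
  interpret B: bounded_bilinear B by (rule B)
  let ?G = "(\<chi> i j. B (D' (axis i 1)) (D' (axis j 1))) :: real^3^3"
  have ex: "D' (A (axis i 1)) = (\<Sum>k\<in>UNIV. matrix A $ k $ i *\<^sub>R D' (axis k 1))" for i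
  proof -
    have "A (axis i 1) = (\<Sum>k\<in>UNIV. (A (axis i 1) $ k) *\<^sub>R axis k 1)"
      using basis_expansion[of "A (axis i 1)"] by (simp add: scalar_mult_eq_scaleR)
    then have "D' (A (axis i 1)) = D' (\<Sum>k\<in>UNIV. (A (axis i 1) $ k) *\<^sub>R axis k 1)" by simp
    also have "\<dots> = (\<Sum>k\<in>UNIV. (A (axis i 1) $ k) *\<^sub>R D' (axis k 1))"
      using D' by (simp add: linear_sum linear_cmul)
    finally show ?thesis by (simp add: matrix_def)
  qed
  have "(\<chi> i j. B (D (axis i 1)) (D (axis j 1))) = transpose (matrix A) ** ?G ** matrix A"
    unfolding vec_eq_iff
    by (simp add: eq ex B.sum_left B.sum_right B.scaleR_left B.scaleR_right matrix_matrix_mult_def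
        transpose_def sum_distrib_left sum_distrib_right mult_ac)
  then show ?thesis by (simp add: det_mul power2_eq_square)
qed

text \<open>
  The isometry \<open>L\<close> of the form is read in the chart as $T = \xi \circ L \circ \psi$, where $\xi$ inverts
  the chart on the open set \<open>W\<close>.  Differentiating $\psi \circ T = L \circ \psi$ and taking Gram
  determinants gives $J(u) = |\det DT(u)|\,J(Tu)$ for the volume density \<open>J\<close>.
\<close>

lemma riemannian_volume_invariant:
  fixes \<psi> :: "real^3 \<Rightarrow> real^4" and L :: "real^4 \<Rightarrow> real^4"
    and B :: "real^4 \<Rightarrow> real^4 \<Rightarrow> real"
  defines "J \<equiv> \<lambda>u. sqrt (det (gram B \<psi> u))"
  assumes B: "bounded_bilinear B"
    and \<psi>: "\<And>u. (\<psi> has_derivative \<psi>' u) (at u)" "\<And>u. \<psi> u \<in> P \<inter> W"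
    and \<xi>: "\<And>z. z \<in> W \<Longrightarrow> (\<xi> has_derivative \<xi>' z) (at z)" "\<And>u. \<xi> (\<psi> u) = u" "\<And>z. z \<in> P \<inter> W \<Longrightarrow> \<psi> (\<xi> z) = z"
    and W: "open W"
    and J: "J \<in> borel_measurable borel" "\<And>u. 0 < J u"
    and L: "linear L" "\<And>x y. B (L x) (L y) = B x y" "\<And>z. z \<in> P \<Longrightarrow> L z \<in> P" "\<And>z. L (L z) = z"
    and null: "{u. L (\<psi> u) \<notin> W} \<in> null_sets lborel"
    and h: "h \<in> borel_measurable borel"
  shows "(\<integral>\<^sup>+x. h (L x) \<partial>riemannian_volume B \<psi>) = (\<integral>\<^sup>+x. h x \<partial>riemannian_volume B \<psi>)"
proof -
  have L_lin: "bounded_linear L" using L(1) by (rule linear_conv_bounded_linear[THEN iffD1])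
  note [measurable] = J(1) h
  have cont: "continuous_on UNIV \<psi>"
    using \<psi>(1) by (intro has_derivative_continuous_on[of UNIV \<psi> \<psi>']) auto
  have contL: "continuous_on UNIV L" by (rule linear_continuous_on[OF L_lin])
  have [measurable]: "\<psi> \<in> borel_measurable borel" "L \<in> borel_measurable borel"
    using cont contL by (auto intro: borel_measurable_continuous_onI)
  have int: "(\<integral>\<^sup>+x. g x \<partial>riemannian_volume B \<psi>) = (\<integral>\<^sup>+u. ennreal (J u) * g (\<psi> u) \<partial>lborel)"
    if [measurable]: "g \<in> borel_measurable borel" for g
  proof -
    have J': "(\<lambda>u. ennreal (sqrt (det (gram B \<psi> u)))) = (\<lambda>u. ennreal (J u))" by (simp add: J_def)
    show ?thesis unfolding riemannian_volume_def J'
      by (subst nn_integral_distr) (auto simp: nn_integral_density)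
  qed
  define S where "S = {u. L (\<psi> u) \<in> W}"
  define T where "T u = \<xi> (L (\<psi> u))" for u
  define T' where "T' u = \<xi>' (L (\<psi> u)) \<circ> (L \<circ> \<psi>' u)" for u
  have S: "open S" unfolding S_def
    using open_vimage[OF W continuous_on_compose[OF cont continuous_on_subset[OF contL subset_UNIV]]]
    by (simp add: vimage_def)
  have S_null: "- S \<in> null_sets lborel" using null by (simp add: S_def Collect_neg_eq[symmetric])
  have \<psi>T: "\<psi> (T u) = L (\<psi> u)" if "u \<in> S" for u
    using that L(3) \<psi>(2) by (auto simp: T_def S_def intro!: \<xi>(3))
  have TS: "T u \<in> S" and TT: "T (T u) = u" if "u \<in> S" for u
    using \<psi>T[OF that] \<psi>(2) by (auto simp: S_def T_def L(4) \<xi>(2))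
  have dT: "(T has_derivative T' u) (at u)" if "u \<in> S" for u
  proof -
    have "((\<lambda>u. L (\<psi> u)) has_derivative (\<lambda>v. L (\<psi>' u v))) (at u)"
      by (rule has_derivative_compose[OF \<psi>(1) bounded_linear_imp_has_derivative[OF L_lin]])
    from has_derivative_compose[OF this \<xi>(1)] that show ?thesis
      by (simp add: T_def[abs_def] T'_def o_def S_def)
  qed
  have fr: "frechet_derivative \<psi> (at u) = \<psi>' u" for u
    using frechet_derivative_at[OF \<psi>(1)] by simp
  have Jeq: "J u = \<bar>det (matrix (T' u))\<bar> * J (T u)" if u: "u \<in> S" for u
  proof -
    have "((\<lambda>u. \<psi> (T u)) has_derivative \<psi>' (T u) \<circ> T' u) (at u)"
      using has_derivative_compose[OF dT[OF u] \<psi>(1)] by (simp add: o_def)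
    then have "((\<lambda>u. L (\<psi> u)) has_derivative \<psi>' (T u) \<circ> T' u) (at u)"
      by (rule has_derivative_transform_within_open[OF _ S u \<psi>T])
    moreover have "((\<lambda>u. L (\<psi> u)) has_derivative L \<circ> \<psi>' u) (at u)"
      using has_derivative_compose[OF \<psi>(1) bounded_linear_imp_has_derivative[OF L_lin]] by (simp add: o_def)
    ultimately have "\<psi>' (T u) \<circ> T' u = L \<circ> \<psi>' u" by (rule has_derivative_unique)
    then have eq: "\<psi>' (T u) (T' u v) = L (\<psi>' u v)" for v by (simp add: fun_eq_iff)
    have "det (gram B \<psi> u) = (det (matrix (T' u)))\<^sup>2 * det (gram B \<psi> (T u))"
      unfolding gram_def fr
      using dT[OF u] \<psi>(1)[of "T u"]
      by (intro gram_chain_rule B) (auto simp: eq L(2) dest: has_derivative_linear)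
    then show ?thesis by (simp add: J_def real_sqrt_mult)
  qed
  define G where "G u = indicator S u *\<^sub>R T u" for u
  have [measurable]: "S \<in> sets borel" using S by simp
  have "continuous_on S T"
    by (rule has_derivative_continuous_on[of S T T'], rule has_derivative_at_withinI, rule dT)
  then have [measurable]: "G \<in> borel_measurable borel"
    unfolding G_def[abs_def] by (intro borel_measurable_continuous_on_indicator) auto
  \<comment> \<open>The Jacobian written as a quotient of densities, which shows at once that it is measurable.\<close>
  define w where "w u = J u / J (G u)" for u
  have w: "w u = \<bar>det (matrix (T' u))\<bar>" if "u \<in> S" for u
    using Jeq[OF that] J(2)[of "T u"] that by (simp add: w_def G_def)
  have [measurable]: "w \<in> borel_measurable borel" unfolding w_def[abs_def] by measurable
  have "(\<integral>\<^sup>+x. h (L x) \<partial>riemannian_volume B \<psi>) = (\<integral>\<^sup>+u. ennreal (J u) * h (L (\<psi> u)) \<partial>lborel)"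
    by (rule int) measurable
  also have "\<dots> = (\<integral>\<^sup>+u\<in>S. ennreal (w u) * (ennreal (J (T u)) * h (\<psi> (T u))) \<partial>lborel)"
  proof (rule nn_integral_cong_AE)
    have "AE u in lborel. u \<in> S" by (rule AE_I'[OF S_null]) auto
    then show "AE u in lborel. ennreal (J u) * h (L (\<psi> u)) =
        ennreal (w u) * (ennreal (J (T u)) * h (\<psi> (T u))) * indicator S u"
    proof eventually_elim
      fix u assume u: "u \<in> S"
      have "ennreal (J u) = ennreal (w u) * ennreal (J (T u))"
        using J(2)[of "T u"] by (simp add: Jeq[OF u] w[OF u] ennreal_mult'')
      then show "ennreal (J u) * h (L (\<psi> u)) = ennreal (w u) * (ennreal (J (T u)) * h (\<psi> (T u))) * indicator S u"
        using u by (simp add: \<psi>T mult.assoc)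
    qed
  qed
  also have "\<dots> = (\<integral>\<^sup>+u. ennreal (J u) * h (\<psi> u) \<partial>lborel)"
    by (rule nn_integral_involution[OF S S_null dT TS TT]) (auto simp: w)
  also have "\<dots> = (\<integral>\<^sup>+x. h x \<partial>riemannian_volume B \<psi>)"
    by (rule int[symmetric]) measurable
  finally show ?thesis .
qed

section \<open>The volume form and the cross product in four-space\<close>

lemma det_4: "det (A::'a::comm_ring_1^4^4) =
    A$1$1 * (A$2$2 * (A$3$3 * A$4$4 - A$3$4 * A$4$3) - A$2$3 * (A$3$2 * A$4$4 - A$3$4 * A$4$2) + A$2$4 * (A$3$2 * A$4$3 - A$3$3 * A$4$2))
  - A$1$2 * (A$2$1 * (A$3$3 * A$4$4 - A$3$4 * A$4$3) - A$2$3 * (A$3$1 * A$4$4 - A$3$4 * A$4$1) + A$2$4 * (A$3$1 * A$4$3 - A$3$3 * A$4$1))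
  + A$1$3 * (A$2$1 * (A$3$2 * A$4$4 - A$3$4 * A$4$2) - A$2$2 * (A$3$1 * A$4$4 - A$3$4 * A$4$1) + A$2$4 * (A$3$1 * A$4$2 - A$3$2 * A$4$1))
  - A$1$4 * (A$2$1 * (A$3$2 * A$4$3 - A$3$3 * A$4$2) - A$2$2 * (A$3$1 * A$4$3 - A$3$3 * A$4$1) + A$2$3 * (A$3$1 * A$4$2 - A$3$2 * A$4$1))"
proof -
  have f: "finite {2::4, 3, 4}" "1 \<notin> {2::4, 3, 4}" "finite {3::4, 4}" "2 \<notin> {3::4, 4}" "finite {4::4}" "3 \<notin> {4::4}"
    by auto
  show ?thesis
    unfolding det_def UNIV_4
    unfolding sum_over_permutations_insert[OF f(1,2)]
    unfolding sum_over_permutations_insert[OF f(3,4)]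
    unfolding sum_over_permutations_insert[OF f(5,6)]
    unfolding permutes_sing
    by (simp add: sign_swap_id permutation_swap_id permutation_compose sign_compose sign_id swap_id_eq algebra_simps)
qed

lemma vector_4 [simp]:
  "(vector [a, b, c, d] :: 'a::zero^4) $ 1 = a"
  "(vector [a, b, c, d] :: 'a::zero^4) $ 2 = b"
  "(vector [a, b, c, d] :: 'a::zero^4) $ 3 = c"
  "(vector [a, b, c, d] :: 'a::zero^4) $ 4 = d"
  unfolding vector_def by simp_all


section \<open>Geometry of unit quadrics\<close>

lemma (in bounded_bilinear) has_vector_derivative_prod:
  assumes "(f has_vector_derivative f') (at t within S)" "(g has_vector_derivative g') (at t within S)"
  shows "((\<lambda>t. prod (f t) (g t)) has_vector_derivative prod (f t) g' + prod f' (g t)) (at t within S)"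
  using FDERIV[OF assms[unfolded has_vector_derivative_def]]
  by (simp add: has_vector_derivative_def scaleR_left scaleR_right scaleR_add_right)

text \<open>
  The unit quadric of the form with signature given by \<open>\<sigma>\<close>: the sphere for \<open>\<sigma> = 1\<close>, a sheet of the
  hyperboloid for \<open>\<sigma> = -1\<close>.  The functions \<open>cs\<close> and \<open>sn\<close> are cosine and sine, or their hyperbolic
  counterparts; \<open>ac\<close> is the inverse of \<open>cs\<close> on the set \<open>D\<close> of all distances, extended continuously to
  the real line.
\<close>

locale unit_quadric =
  fixes \<sigma> :: real and B :: "real^4 \<Rightarrow> real^4 \<Rightarrow> real" and P :: "(real^4) set"
    and cs sn ac :: "real \<Rightarrow> real" and D :: "real set"
  assumes sign: "\<sigma> = 1 \<or> \<sigma> = -1"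
    and form: "B x y = \<sigma> * (x$1 * y$1) + x$2 * y$2 + x$3 * y$3 + x$4 * y$4"
    and points_iff: "x \<in> P \<longleftrightarrow> B x x = \<sigma> \<and> (\<sigma> = -1 \<longrightarrow> 0 < x$1)"
    and pos: "x \<in> P \<Longrightarrow> B x v = 0 \<Longrightarrow> v \<noteq> 0 \<Longrightarrow> 0 < B v v"
    and cs_deriv: "(cs has_real_derivative - \<sigma> * sn t) (at t)"
    and sn_deriv: "(sn has_real_derivative cs t) (at t)"
    and cs_0: "cs 0 = 1" and sn_0: "sn 0 = 0"
    and pythagoras: "(cs t)\<^sup>2 + \<sigma> * (sn t)\<^sup>2 = 1"
    and great_circle: "x \<in> P \<Longrightarrow> B x e = 0 \<Longrightarrow> B e e = 1 \<Longrightarrow> cs t *\<^sub>R x + sn t *\<^sub>R e \<in> P"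
    and cs_ac: "x \<in> P \<Longrightarrow> y \<in> P \<Longrightarrow> cs (ac (\<sigma> * B x y)) = \<sigma> * B x y"
    and ac_in: "x \<in> P \<Longrightarrow> y \<in> P \<Longrightarrow> ac (\<sigma> * B x y) \<in> D"
    and D_nonneg: "t \<in> D \<Longrightarrow> 0 \<le> t"
    and ac_deriv: "t \<in> D \<Longrightarrow> sn t \<noteq> 0 \<Longrightarrow> (ac has_real_derivative - \<sigma> / sn t) (at (cs t))"
    and ac_continuous: "continuous_on UNIV ac"
    and cs_pos: "\<sigma> = -1 \<Longrightarrow> 0 < cs t"
begin

abbreviation dst where "dst x y \<equiv> ac (\<sigma> * B x y)"

lemma \<sigma>_sq [simp]: "\<sigma> * \<sigma> = 1" "\<sigma> * (\<sigma> * a) = a" "\<sigma> \<noteq> 0"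
  using sign by auto

lemma on_quadric: "x \<in> P \<Longrightarrow> B x x = \<sigma>"
  by (simp add: points_iff)

lemma bilinear: "bounded_bilinear B"
proof -
  have "bilinear B"
    by (simp add: bilinear_def linear_iff form algebra_simps)
  then show ?thesis by (simp add: bilinear_conv_bounded_bilinear)
qed

sublocale B: bounded_bilinear B by (rule bilinear)

lemma sym: "B x y = B y x" by (simp add: form mult_ac)

lemma nonneg: "x \<in> P \<Longrightarrow> B x v = 0 \<Longrightarrow> 0 \<le> B v v"
  using pos[of x v] by (cases "v = 0") (auto simp: B.zero_left)

lemma definite: "x \<in> P \<Longrightarrow> B x v = 0 \<Longrightarrow> B v v = 0 \<Longrightarrow> v = 0"
  using pos[of x v] by fastforce

text \<open>
  The tangential part of \<open>w\<close> is orthogonal to all tangent vectors, hence to itself, and the form is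
  definite on the tangent space.
\<close>

lemma normal_multiple:
  assumes x: "x \<in> P" and n: "\<And>z. B x z = 0 \<Longrightarrow> B w z = 0"
  shows "w = (\<sigma> * B x w) *\<^sub>R x"
proof -
  define z where "z = w - (\<sigma> * B x w) *\<^sub>R x"
  have xz: "B x z = 0"
    by (simp add: z_def B.diff_right B.scaleR_right on_quadric[OF x])
  then have "B w z = 0" by (rule n)
  then have "B z z = 0" using xz by (simp add: z_def B.diff_left B.scaleR_left)
  then show ?thesis using definite[OF x xz] by (simp add: z_def)
qed

subsection \<open>Geodesics and parallel transport\<close>

text \<open>
  The derivative of a parallel field is normal to the quadric, whereas both fields are tangent.
\<close>

lemma parallel_constant:
  assumes V: "parallel_along B \<gamma> V" and W: "parallel_along B \<gamma> W" and t: "t \<in> {0..1}"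
  shows "B (V t) (W t) = B (V 0) (W 0)"
proof -
  have "((\<lambda>t. B (V t) (W t)) has_vector_derivative 0) (at t within {0..1})" if t: "t \<in> {0..1}" for t
  proof -
    obtain V' W' where *: "(V has_vector_derivative V') (at t within {0..1})"
      "(W has_vector_derivative W') (at t within {0..1})"
      "\<forall>z\<in>quadric_tangent B (\<gamma> t). B V' z = 0" "\<forall>z\<in>quadric_tangent B (\<gamma> t). B W' z = 0"
      using V W t unfolding parallel_along_def by metis
    have "V t \<in> quadric_tangent B (\<gamma> t)" "W t \<in> quadric_tangent B (\<gamma> t)"
      using V W t by (auto simp: parallel_along_def)
    then have "B (V t) W' + B V' (W t) = 0" using * by (simp add: sym[of "V t"])
    then show ?thesis using B.has_vector_derivative_prod[OF *(1,2)] by simp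
  qed
  then obtain c where "\<And>t. t \<in> {0..1} \<Longrightarrow> B (V t) (W t) = c"
    using has_vector_derivative_zero_constant[of "{0..1::real}" "\<lambda>t. B (V t) (W t)"] by auto
  then show ?thesis using t by simp
qed

lemma parallel_diff:
  assumes V: "parallel_along B \<gamma> V" and W: "parallel_along B \<gamma> W"
  shows "parallel_along B \<gamma> (\<lambda>t. V t - W t)"
  unfolding parallel_along_def
proof (intro ballI conjI)
  fix t :: real assume t: "t \<in> {0..1}"
  show "V t - W t \<in> quadric_tangent B (\<gamma> t)"
    using V W t by (auto simp: parallel_along_def quadric_tangent_def B.diff_right)
  obtain V' W' where *: "(V has_vector_derivative V') (at t within {0..1})"
      "(W has_vector_derivative W') (at t within {0..1})"
      "\<forall>z\<in>quadric_tangent B (\<gamma> t). B V' z = 0" "\<forall>z\<in>quadric_tangent B (\<gamma> t). B W' z = 0"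
    using V W t unfolding parallel_along_def by metis
  show "\<exists>U. ((\<lambda>t. V t - W t) has_vector_derivative U) (at t within {0..1}) \<and> (\<forall>z\<in>quadric_tangent B (\<gamma> t). B U z = 0)"
    using * by (intro exI[of _ "V' - W'"]) (auto simp: B.diff_left intro: has_vector_derivative_diff)
qed

lemma parallel_unique:
  assumes V: "parallel_along B \<gamma> V" and W: "parallel_along B \<gamma> W" and eq: "V 0 = W 0" and \<gamma>: "\<gamma> 1 \<in> P"
  shows "V 1 = W 1"
proof -
  have "B (V 1 - W 1) (V 1 - W 1) = 0"
    using parallel_constant[OF parallel_diff[OF V W] parallel_diff[OF V W], of 1] eq by (simp add: B.zero_left)
  moreover have "B (\<gamma> 1) (V 1 - W 1) = 0"
    using parallel_diff[OF V W] by (auto simp: parallel_along_def quadric_tangent_def)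
  ultimately show ?thesis using definite[OF \<gamma>] by force
qed

lemma parallel_cong:
  assumes "\<And>t. t \<in> {0..1} \<Longrightarrow> \<gamma> t = \<eta> t"
  shows "parallel_along B \<gamma> W \<longleftrightarrow> parallel_along B \<eta> W"
  using assms by (simp add: parallel_along_def)

lemma cs_chain: "((\<lambda>t. cs (c * t)) has_real_derivative - \<sigma> * c * sn (c * t)) (at t within S)"
  and sn_chain: "((\<lambda>t. sn (c * t)) has_real_derivative c * cs (c * t)) (at t within S)"
proof -
  have c: "((\<lambda>t. c * t) has_real_derivative c) (at t within S)"
    by (auto intro!: derivative_eq_intros)
  show "((\<lambda>t. cs (c * t)) has_real_derivative - \<sigma> * c * sn (c * t)) (at t within S)"
    "((\<lambda>t. sn (c * t)) has_real_derivative c * cs (c * t)) (at t within S)"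
    using DERIV_chain'[OF c cs_deriv] DERIV_chain'[OF c sn_deriv] by (simp_all add: mult_ac)
qed

lemmas vderiv = has_vector_derivative_add has_vector_derivative_diff has_vector_derivative_scaleR
  has_vector_derivative_const DERIV_cmult cs_chain sn_chain

text \<open>
  The equation $\gamma'' = \lambda\gamma$ holds by the definition of a geodesic; differentiating
  $B(\gamma, \gamma') = 0$ gives $\lambda = -\sigma c^2$.  To solve it, the solution is rotated back: the
  two combinations \<open>X\<close> and \<open>Y\<close> of $\gamma$ and $\gamma'$ are constant along the curve.  The equation is
  multiplied by \<open>c\<close>, so that it also holds for constant curves.
\<close>

lemma geodesic_explicit:
  assumes \<gamma>: "\<gamma> ` {0..1} \<subseteq> P"
    and d: "\<And>t. t \<in> {0..1} \<Longrightarrow> (\<gamma> has_vector_derivative \<gamma>' t) (at t within {0..1})"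
    and par: "parallel_along B \<gamma> \<gamma>'" and c: "B (\<gamma>' 0) (\<gamma>' 0) = c\<^sup>2" and t: "t \<in> {0..1}"
  shows "c *\<^sub>R \<gamma> t = (c * cs (c * t)) *\<^sub>R \<gamma> 0 + sn (c * t) *\<^sub>R \<gamma>' 0"
proof -
  have d2: "(\<gamma>' has_vector_derivative (- \<sigma> * c\<^sup>2) *\<^sub>R \<gamma> t) (at t within {0..1})" if t: "t \<in> {0..1}" for t
  proof -
    obtain W' where W': "(\<gamma>' has_vector_derivative W') (at t within {0..1})"
      and n: "\<forall>z\<in>quadric_tangent B (\<gamma> t). B W' z = 0"
      using par t unfolding parallel_along_def by blast
    have gP: "\<gamma> t \<in> P" using \<gamma> t by auto
    have "((\<lambda>t. B (\<gamma> t) (\<gamma>' t)) has_vector_derivative B (\<gamma> t) W' + B (\<gamma>' t) (\<gamma>' t)) (at t within {0..1})"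
      by (rule B.has_vector_derivative_prod[OF d[OF t] W'])
    moreover have "((\<lambda>t. B (\<gamma> t) (\<gamma>' t)) has_vector_derivative 0) (at t within {0..1})"
      by (rule has_vector_derivative_transform[OF t _ has_vector_derivative_const[of 0]])
        (use par in \<open>auto simp: parallel_along_def quadric_tangent_def\<close>)
    ultimately have "B (\<gamma> t) W' + B (\<gamma>' t) (\<gamma>' t) = 0"
      using t by (intro vector_derivative_unique_within[of t "{0..1}"])
        (auto simp: trivial_limit_within islimpt_Icc)
    then have "B (\<gamma> t) W' = - c\<^sup>2" using parallel_constant[OF par par t] c by simp
    moreover have "W' = (\<sigma> * B (\<gamma> t) W') *\<^sub>R \<gamma> t"
      using n by (intro normal_multiple[OF gP]) (auto simp: quadric_tangent_def)
    ultimately show ?thesis using W' by simp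
  qed
  define X where "X t = (c * cs (c * t)) *\<^sub>R \<gamma> t - sn (c * t) *\<^sub>R \<gamma>' t" for t
  define Y where "Y t = (\<sigma> * c * sn (c * t)) *\<^sub>R \<gamma> t + cs (c * t) *\<^sub>R \<gamma>' t" for t
  have X': "(X has_vector_derivative 0) (at t within {0..1})" if t: "t \<in> {0..1}" for t
    unfolding X_def[abs_def]
    by (rule has_vector_derivative_eq_rhs, (rule vderiv d[OF t] d2[OF t])+)
      (simp add: algebra_simps power2_eq_square)
  have Y': "(Y has_vector_derivative 0) (at t within {0..1})" if t: "t \<in> {0..1}" for t
    unfolding Y_def[abs_def]
    by (rule has_vector_derivative_eq_rhs, (rule vderiv d[OF t] d2[OF t])+)
      (simp add: algebra_simps power2_eq_square)
  obtain p where p: "\<And>t. t \<in> {0..1} \<Longrightarrow> X t = p"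
    using has_vector_derivative_zero_constant[OF _ X'] by auto
  obtain q where q: "\<And>t. t \<in> {0..1} \<Longrightarrow> Y t = q"
    using has_vector_derivative_zero_constant[OF _ Y'] by auto
  have X: "X t = X 0" and Y: "Y t = Y 0" using p[OF t] p[of 0] q[OF t] q[of 0] by simp_all
  have "c *\<^sub>R \<gamma> t = (c * ((cs (c * t))\<^sup>2 + \<sigma> * (sn (c * t))\<^sup>2)) *\<^sub>R \<gamma> t" by (simp add: pythagoras)
  also have "\<dots> = cs (c * t) *\<^sub>R X t + sn (c * t) *\<^sub>R Y t"
    by (simp add: X_def Y_def algebra_simps power2_eq_square)
  also have "\<dots> = (c * cs (c * t)) *\<^sub>R \<gamma> 0 + sn (c * t) *\<^sub>R \<gamma>' 0"
    unfolding X Y by (simp add: X_def Y_def cs_0 sn_0 mult_ac)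
  finally show ?thesis .
qed

definition arc :: "real^4 \<Rightarrow> real^4 \<Rightarrow> real \<Rightarrow> real^4" where
  "arc x y t = (let d = dst x y in cs (d * t) *\<^sub>R x + (sn (d * t) / sn d) *\<^sub>R (y - cs d *\<^sub>R x))"

text \<open>
  The speed is the distance \<open>d\<close>, since it is constant and the length is \<open>d\<close>.  The explicit solution at
  time 1 then determines the initial velocity, because $\mathrm{sn}\,d$ is not zero.
\<close>

lemma minimizing_geodesic_eq_arc:
  assumes x: "x \<in> P" and y: "y \<in> P" and s: "sn (dst x y) \<noteq> 0"
    and g: "minimizing_geodesic P B dst x y \<gamma>" and t: "t \<in> {0..1}"
  shows "\<gamma> t = arc x y t"
proof -
  define d where "d = dst x y"
  have dpos: "0 < d" using D_nonneg[OF ac_in[OF x y]] s sn_0 by (cases "dst x y = 0") (auto simp: d_def)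
  obtain \<gamma>' where \<gamma>': "(\<forall>t\<in>{0..1}. (\<gamma> has_vector_derivative \<gamma>' t) (at t within {0..1})) \<and>
      parallel_along B \<gamma> \<gamma>' \<and> integral {0..1} (\<lambda>t. sqrt (B (\<gamma>' t) (\<gamma>' t))) = dst x y"
    using g unfolding minimizing_geodesic_def by blast
  have len: "integral {0..1} (\<lambda>t. sqrt (B (\<gamma>' t) (\<gamma>' t))) = d" using \<gamma>' by (simp add: d_def)
  have g: "\<gamma> ` {0..1} \<subseteq> P" "\<gamma> 0 = x" "\<gamma> 1 = y" "parallel_along B \<gamma> \<gamma>'"
      "\<And>t. t \<in> {0..1} \<Longrightarrow> (\<gamma> has_vector_derivative \<gamma>' t) (at t within {0..1})"
    using g \<gamma>' by (simp_all add: minimizing_geodesic_def)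
  define c where "c = sqrt (B (\<gamma>' 0) (\<gamma>' 0))"
  have "0 \<le> B (\<gamma>' 0) (\<gamma>' 0)"
    using g(1,4) by (intro nonneg[of "\<gamma> 0"]) (auto simp: parallel_along_def quadric_tangent_def)
  then have c: "B (\<gamma>' 0) (\<gamma>' 0) = c\<^sup>2" by (simp add: c_def)
  have "integral {0..1} (\<lambda>t. sqrt (B (\<gamma>' t) (\<gamma>' t))) = integral {0..1} (\<lambda>t::real. c)"
    unfolding c_def by (intro integral_cong arg_cong[of _ _ sqrt] parallel_constant[OF g(4) g(4)])
  then have cd: "c = d" using len by simp
  have ex: "d *\<^sub>R \<gamma> t = (d * cs (d * t)) *\<^sub>R x + sn (d * t) *\<^sub>R \<gamma>' 0" if "t \<in> {0..1}" for t
    using geodesic_explicit[OF g(1,5,4) c that] g(2) by (simp add: cd)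
  have "sn d *\<^sub>R \<gamma>' 0 = d *\<^sub>R (y - cs d *\<^sub>R x)"
    using ex[of 1] g(3) by (simp add: algebra_simps)
  then have "\<gamma>' 0 = (d / sn d) *\<^sub>R (y - cs d *\<^sub>R x)"
  proof -
    assume *: "sn d *\<^sub>R \<gamma>' 0 = d *\<^sub>R (y - cs d *\<^sub>R x)"
    have "\<gamma>' 0 = (1 / sn d) *\<^sub>R (sn d *\<^sub>R \<gamma>' 0)" using s by (simp add: d_def)
    then show ?thesis unfolding * by simp
  qed
  then have "d *\<^sub>R \<gamma> t = d *\<^sub>R arc x y t"
    unfolding ex[OF t] by (simp add: arc_def d_def[symmetric] Let_def scaleR_add_right mult_ac)
  then show ?thesis using dpos by simp
qed

lemma arc_parallel_frame:
  assumes x: "x \<in> P" and y: "y \<in> P" and s: "sn (dst x y) \<noteq> 0"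
  defines "d \<equiv> dst x y"
  defines "e \<equiv> (1 / sn d) *\<^sub>R (y - cs d *\<^sub>R x)"
  shows "B x e = 0" "B e e = 1" "arc x y t = cs (d * t) *\<^sub>R x + sn (d * t) *\<^sub>R e" "arc x y t \<in> P"
    "arc x y 0 = x" "arc x y 1 = y"
proof -
  have xy: "B x y = \<sigma> * cs d" using cs_ac[OF x y] by (simp add: d_def)
  have s': "sn d \<noteq> 0" using s by (simp add: d_def)
  show xe: "B x e = 0" using s' by (simp add: e_def B.scaleR_right B.diff_right xy on_quadric[OF x])
  have "B (y - cs d *\<^sub>R x) (y - cs d *\<^sub>R x) = \<sigma> * (1 - (cs d)\<^sup>2)"
    using xy sym[of y x] by (simp add: B.diff_right B.diff_left B.scaleR_right B.scaleR_left
        on_quadric[OF x] on_quadric[OF y] power2_eq_square algebra_simps)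
  also have "\<dots> = (sn d)\<^sup>2" using pythagoras[of d] sign by (auto simp: algebra_simps)
  finally show ee: "B e e = 1" using s' by (simp add: e_def B.scaleR_right B.scaleR_left power2_eq_square)
  show *: "arc x y t = cs (d * t) *\<^sub>R x + sn (d * t) *\<^sub>R e" for t
    by (simp add: arc_def e_def d_def Let_def)
  show "arc x y t \<in> P" unfolding * by (rule great_circle[OF x xe ee])
  show "arc x y 0 = x" by (simp add: * cs_0 sn_0)
  show "arc x y 1 = y" using s' by (simp add: * e_def)
qed

text \<open>
  The velocity of the arc is \<open>d\<close> times the parallel unit field \<open>f\<close>.  A tangent vector \<open>v\<close> at \<open>x\<close> is
  the sum of a multiple of $f(0)$ and a vector \<open>n\<close> orthogonal to \<open>x\<close> and $f(0)$.  The arc stays in the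
  plane of \<open>x\<close> and $f(0)$, so that the constant field \<open>n\<close> is tangent and parallel along it.
\<close>

lemma arc_minimizing:
  assumes x: "x \<in> P" and y: "y \<in> P" and s: "sn (dst x y) \<noteq> 0" and v: "B x v = 0"
  shows "minimizing_geodesic P B dst x y (arc x y)"
    and "\<exists>W. parallel_along B (arc x y) W \<and> W 0 = v"
proof -
  define d where "d = dst x y"
  define e where "e = (1 / sn d) *\<^sub>R (y - cs d *\<^sub>R x)"
  note arc = arc_parallel_frame[OF x y s, folded d_def, folded e_def]
  have d: "0 \<le> d" using D_nonneg[OF ac_in[OF x y]] by (simp add: d_def)
  define f where "f t = (- \<sigma> * sn (d * t)) *\<^sub>R x + cs (d * t) *\<^sub>R e" for t
  have arc': "(arc x y has_vector_derivative d *\<^sub>R f t) (at t within {0..1})" for t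
    unfolding arc(3)[abs_def] f_def[abs_def]
    by (rule has_vector_derivative_eq_rhs, (rule vderiv)+) (simp add: algebra_simps)
  have f': "(f has_vector_derivative (- \<sigma> * d) *\<^sub>R arc x y t) (at t within {0..1})" for t
    unfolding arc(3)[abs_def] f_def[abs_def]
    by (rule has_vector_derivative_eq_rhs, (rule vderiv)+) (simp add: algebra_simps)
  have ex: "B e x = 0" using arc(1) by (simp add: sym)
  have arcf: "B (arc x y t) (f t) = 0" for t
    by (simp add: arc(3) f_def B.add_left B.add_right B.diff_right B.scaleR_left B.scaleR_right B.minus_right arc(1,2) ex
        on_quadric[OF x] algebra_simps)
  have ff: "B (f t) (f t) = 1" for t
  proof -
    have "B (f t) (f t) = \<sigma> * (sn (d * t))\<^sup>2 + (cs (d * t))\<^sup>2"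
      by (simp add: f_def B.add_left B.add_right B.diff_left B.diff_right B.scaleR_left B.scaleR_right B.minus_right B.minus_left arc(1,2) ex
        on_quadric[OF x] power2_eq_square algebra_simps)
    then show ?thesis using pythagoras[of "d * t"] by simp
  qed
  have par: "parallel_along B (arc x y) (\<lambda>t. n + a *\<^sub>R f t)" if n: "B n x = 0" "B n e = 0" for n a
    unfolding parallel_along_def
  proof (intro ballI conjI exI)
    fix t :: real
    show "n + a *\<^sub>R f t \<in> quadric_tangent B (arc x y t)"
    proof -
      have "B (arc x y t) n = 0"
        using n by (simp add: arc(3) B.add_left B.scaleR_left sym[of x n] sym[of e n])
      then show ?thesis using arcf[of t] by (simp add: quadric_tangent_def B.add_right B.scaleR_right)
    qed
    show "((\<lambda>t. n + a *\<^sub>R f t) has_vector_derivative a *\<^sub>R ((- \<sigma> * d) *\<^sub>R arc x y t)) (at t within {0..1})"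
      using f'[of t] by (auto intro!: derivative_eq_intros)
    fix z assume "z \<in> quadric_tangent B (arc x y t)"
    then show "B (a *\<^sub>R ((- \<sigma> * d) *\<^sub>R arc x y t)) z = 0"
      by (simp add: quadric_tangent_def B.scaleR_left B.minus_left)
  qed
  show "minimizing_geodesic P B dst x y (arc x y)"
    unfolding minimizing_geodesic_def
  proof (intro conjI exI[of _ "\<lambda>t. d *\<^sub>R f t"])
    show "integral {0..1} (\<lambda>t. sqrt (B (d *\<^sub>R f t) (d *\<^sub>R f t))) = dst x y"
      using d by (simp add: B.scaleR_left B.scaleR_right ff d_def)
    show "parallel_along B (arc x y) (\<lambda>t. d *\<^sub>R f t)"
      using par[of 0 d] by (simp add: B.zero_left)
  qed (use arc arc' in auto)
  have "parallel_along B (arc x y) (\<lambda>t. (v - B v e *\<^sub>R e) + B v e *\<^sub>R f t)"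
    using v by (intro par) (simp_all add: B.diff_left B.scaleR_left ex arc(2) sym[of v x])
  moreover have "f 0 = e" by (simp add: f_def cs_0 sn_0)
  ultimately show "\<exists>W. parallel_along B (arc x y) W \<and> W 0 = v" by (intro exI) auto
qed

lemma transport_isometry:
  assumes x: "x \<in> P" and y: "y \<in> P" and s: "sn (dst x y) \<noteq> 0" and v: "B x v = 0"
  defines "w \<equiv> quadric_transport P B dst x y v"
  shows "B y w = 0" "B w w = B v v"
proof -
  obtain W where W: "parallel_along B (arc x y) W" "W 0 = v"
    using arc_minimizing(2)[OF assms(1-4)] by auto
  note arc = arc_parallel_frame[OF x y s]
  have "w = W 1"
    unfolding w_def quadric_transport_def
  proof (rule the_equality)
    show "\<exists>\<gamma> V. minimizing_geodesic P B dst x y \<gamma> \<and> parallel_along B \<gamma> V \<and> V 0 = v \<and> V 1 = W 1"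
      using arc_minimizing(1)[OF assms(1-4)] W by auto
  next
    fix u assume "\<exists>\<gamma> V. minimizing_geodesic P B dst x y \<gamma> \<and> parallel_along B \<gamma> V \<and> V 0 = v \<and> V 1 = u"
    then obtain \<gamma> V where *: "minimizing_geodesic P B dst x y \<gamma>" "parallel_along B \<gamma> V" "V 0 = v" "V 1 = u" by auto
    have "parallel_along B (arc x y) V"
      using *(2) parallel_cong[of \<gamma> "arc x y"] minimizing_geodesic_eq_arc[OF x y s *(1)] by blast
    from parallel_unique[OF this W(1)] show "u = W 1" using * W arc(4) by simp
  qed
  moreover have "W 1 \<in> quadric_tangent B (arc x y 1)"
    using W(1) unfolding parallel_along_def by force
  ultimately show "B y w = 0" "B w w = B v v"
    using W parallel_constant[OF W(1) W(1), of 1] arc(6) by (auto simp: quadric_tangent_def)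
qed

subsection \<open>The gradient of the kernel and the cross product\<close>

text \<open>
  These curves show that a gradient is determined by the derivatives along curves.
\<close>

lemma curve_through:
  assumes y: "y \<in> P" and v: "B y v = 0"
  obtains c where "range c \<subseteq> P" "c 0 = y" "(c has_vector_derivative v) (at 0)"
proof (cases "v = 0")
  case True
  have "range (\<lambda>t. y) \<subseteq> P" "((\<lambda>t::real. y) has_vector_derivative v) (at 0)" using y True by auto
  then show ?thesis by (intro that[of "\<lambda>t. y"]) auto
next
  case False
  define k where "k = sqrt (B v v)"
  have k: "0 < k" "B v v = k * k" using pos[OF y v False] by (auto simp: k_def)
  define e where "e = (1 / k) *\<^sub>R v"
  have "B y e = 0" "B e e = 1" using k v by (auto simp: e_def B.scaleR_left B.scaleR_right)
  then have r: "range (\<lambda>t. cs (k * t) *\<^sub>R y + sn (k * t) *\<^sub>R e) \<subseteq> P" using great_circle[OF y] by auto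
  have d: "((\<lambda>t. cs (k * t) *\<^sub>R y + sn (k * t) *\<^sub>R e) has_vector_derivative v) (at 0)"
    by (rule has_vector_derivative_eq_rhs, (rule vderiv)+) (use k in \<open>simp add: sn_0 cs_0 e_def\<close>)
  show ?thesis by (rule that[OF r _ d]) (simp add: cs_0 sn_0)
qed

text \<open>
  From $\mathrm{cs}\,\alpha(x,z) = \sigma B(x,z)$ the gradient is
  $-\frac{\varphi'(d)}{\mathrm{sn}\,d}\,(x - \mathrm{cs}(d)\,y)$.  The vector in parentheses is the
  tangential part of \<open>x\<close> at \<open>y\<close>, of length $|\mathrm{sn}\,d|$.
\<close>

lemma gradient_of_radial:
  fixes x y and \<phi>' :: real
  assumes x: "x \<in> P" and y: "y \<in> P" and s: "sn (dst x y) \<noteq> 0"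
    and \<phi>: "(\<phi> has_real_derivative \<phi>') (at (dst x y))"
  defines "w \<equiv> quadric_gradient P B (\<lambda>z. \<phi> (dst x z)) y"
  shows "B y w = 0" "B w w = \<phi>'\<^sup>2"
proof -
  define d where "d = dst x y"
  have xy: "\<sigma> * B x y = cs d" "B x y = \<sigma> * cs d" using cs_ac[OF x y] by (auto simp: d_def)
  have yx: "B y x = \<sigma> * cs d" using xy(2) sym by simp
  have s': "sn d \<noteq> 0" using s by (simp add: d_def)
  define g where "g = (- \<phi>' / sn d) *\<^sub>R (x - cs d *\<^sub>R y)"
  have yg: "B y g = 0"
    by (simp add: g_def B.minus_right B.scaleR_right B.diff_right yx on_quadric[OF y])
  have "B (x - cs d *\<^sub>R y) (x - cs d *\<^sub>R y) = \<sigma> * (1 - (cs d)\<^sup>2)"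
    by (simp add: xy(2) yx B.diff_right B.diff_left B.scaleR_right B.scaleR_left
        on_quadric[OF x] on_quadric[OF y] power2_eq_square algebra_simps)
  also have "\<dots> = (sn d)\<^sup>2" using pythagoras[of d] sign by (auto simp: algebra_simps)
  finally have gg: "B g g = \<phi>'\<^sup>2"
    using s' by (simp add: g_def B.minus_left B.minus_right B.scaleR_right B.scaleR_left power2_eq_square)
  have deriv: "((\<lambda>t. \<phi> (dst x (c t))) has_real_derivative B g v) (at 0)"
    if c: "range c \<subseteq> P" "c 0 = y" "(c has_vector_derivative v) (at 0)" for c v
  proof -
    have "((\<lambda>t. B (c t) (c t)) has_vector_derivative B y v + B v y) (at 0)"
      using B.has_vector_derivative_prod[OF c(3) c(3)] c(2) by simp
    moreover have "(\<lambda>t. B (c t) (c t)) = (\<lambda>t. \<sigma>)" using c(1) on_quadric by auto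
    ultimately have "B y v + B v y = 0"
      using vector_derivative_unique_at[OF _ has_vector_derivative_const[of \<sigma>]] by metis
    then have yv: "B y v = 0" by (simp add: sym[of v y])
    have "((\<lambda>t. B x (c t)) has_vector_derivative B x v) (at 0)"
      using B.has_vector_derivative_prod[OF has_vector_derivative_const c(3), of x] by (simp add: B.zero_left)
    then have 1: "((\<lambda>t. \<sigma> * B x (c t)) has_real_derivative \<sigma> * B x v) (at 0)"
      by (intro DERIV_cmult) (simp add: has_real_derivative_iff_has_vector_derivative)
    have 2: "(ac has_real_derivative - \<sigma> / sn d) (at (\<sigma> * B x (c 0)))"
      unfolding c(2) xy(1) using ac_deriv[OF ac_in[OF x y] s, folded d_def] .
    have 3: "((\<lambda>t. dst x (c t)) has_real_derivative (- \<sigma> / sn d) * (\<sigma> * B x v)) (at 0)"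
      using DERIV_chain2[OF 2 1] by simp
    have 4: "(\<phi> has_real_derivative \<phi>') (at (dst x (c 0)))" using \<phi> by (simp add: c(2))
    show ?thesis using DERIV_chain2[OF 4 3]
      by (simp add: g_def B.scaleR_left B.diff_left B.minus_left yv mult_ac)
  qed
  have "w = g"
    unfolding w_def quadric_gradient_def
  proof (rule the_equality, intro conjI allI impI)
    show "g \<in> quadric_tangent B y" using yg by (simp add: quadric_tangent_def)
  next
    fix c v assume "range c \<subseteq> P \<and> c 0 = y \<and> (c has_vector_derivative v) (at 0)"
    then show "((\<lambda>t. \<phi> (dst x (c t))) has_real_derivative B g v) (at 0)" using deriv by blast
  next
    fix h assume h: "h \<in> quadric_tangent B y \<and> (\<forall>c v. range c \<subseteq> P \<and> c 0 = y \<and> (c has_vector_derivative v) (at 0) \<longrightarrow>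
      ((\<lambda>t. \<phi> (dst x (c t))) has_real_derivative B h v) (at 0))"
    have T: "B y (h - g) = 0" using h yg by (simp add: quadric_tangent_def B.diff_right)
    then obtain c where c: "range c \<subseteq> P" "c 0 = y" "(c has_vector_derivative h - g) (at 0)"
      by (rule curve_through[OF y])
    then have "B h (h - g) = B g (h - g)" using DERIV_unique deriv[OF c] h by blast
    then have "B (h - g) (h - g) = 0" by (simp add: B.diff_left)
    then show "h = g" using definite[OF y T] by simp
  qed
  then show "B y w = 0" "B w w = \<phi>'\<^sup>2" using yg gg by simp_all
qed

text \<open>
  The components of the cross product are the cofactors of the determinant, with the sign of the first
  one given by the form.  Their square is the Gram determinant of \<open>y\<close>, \<open>u\<close>, \<open>v\<close> up to the sign
  \<open>\<sigma>\<close>: the Cauchy-Binet identity, checked here as a polynomial identity.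
\<close>

lemma cross_norm:
  assumes y: "y \<in> P" and u: "B y u = 0" and v: "B y v = 0"
  defines "w \<equiv> quadric_cross B y u v"
  shows "B y w = 0" "B w w \<le> B u u * B v v"
proof -
  define m where "m z = det (vector [y, u, v, z] :: real^4^4)" for z
  define c :: "real^4" where "c = vector [\<sigma> * m (axis 1 1), m (axis 2 1), m (axis 3 1), m (axis 4 1)]"
  have cm: "B c z = m z" for z
    using sign by (auto simp: form c_def m_def det_4 axis_def algebra_simps)
  have yc: "B y c = 0"
  proof -
    have "m y = 0" by (simp add: m_def det_4 algebra_simps)
    then show ?thesis using cm[of y] by (simp add: sym)
  qed
  have "B c c = \<sigma> * (B y y * (B u u * B v v - (B u v)\<^sup>2) - B y u * (B y u * B v v - B u v * B y v)
      + B y v * (B y u * B u v - B u u * B y v))"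
    using sign
  proof
    assume "\<sigma> = 1"
    then show ?thesis
      by (simp add: form c_def m_def det_4 axis_def power2_eq_square) (simp add: algebra_simps)
  next
    assume "\<sigma> = -1"
    then show ?thesis
      by (simp add: form c_def m_def det_4 axis_def power2_eq_square) (simp add: algebra_simps)
  qed
  then have "B c c = B u u * B v v - (B u v)\<^sup>2" by (simp add: u v on_quadric[OF y])
  then have cc: "B c c \<le> B u u * B v v" by simp
  have "w = c"
    unfolding w_def quadric_cross_def
  proof (rule the_equality)
    show "c \<in> quadric_tangent B y \<and> (\<forall>z\<in>quadric_tangent B y. B c z = det (vector [y, u, v, z] :: real^4^4))"
      using yc cm by (simp add: quadric_tangent_def m_def)
  next
    fix h assume h: "h \<in> quadric_tangent B y \<and> (\<forall>z\<in>quadric_tangent B y. B h z = det (vector [y, u, v, z] :: real^4^4))"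
    have T: "B y (h - c) = 0" using h yc by (simp add: quadric_tangent_def B.diff_right)
    then have "B (h - c) (h - c) = 0"
      using h cm by (simp add: quadric_tangent_def B.diff_left m_def)
    then show "h = c" using definite[OF y T] by simp
  qed
  then show "B y w = 0" "B w w \<le> B u u * B v v" using yc cc by simp_all
qed

lemma integrand_bound:
  assumes x: "x \<in> P" and y: "y \<in> P" and s: "sn (dst x y) \<noteq> 0" and v: "B x v = 0"
    and \<phi>: "(\<phi> has_real_derivative \<phi>') (at (dst x y))"
  defines "w \<equiv> quadric_cross B y (quadric_transport P B dst x y v) (quadric_gradient P B (\<lambda>z. \<phi> (dst x z)) y)"
  shows "B y w = 0" "B w w \<le> \<phi>'\<^sup>2 * B v v"
  using cross_norm[OF y transport_isometry(1)[OF x y s v] gradient_of_radial(1)[OF x y s \<phi>]]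
  unfolding w_def transport_isometry(2)[OF x y s v] gradient_of_radial(2)[OF x y s \<phi>]
  by (simp_all add: mult.commute)

subsection \<open>Reflections\<close>

lemma base_point: "axis 1 1 \<in> P"
  using sign by (auto simp: points_iff form axis_def)

text \<open>
  The reflection in the hyperplane orthogonal to \<open>n = p - q\<close>, where \<open>q\<close> is the base point.  It
  interchanges \<open>p\<close> and \<open>q\<close> since they have the same square.  It preserves the sheet of the hyperboloid
  because the first coordinate of a point is \<open>- B z q\<close>, and two points of one sheet have a negative
  product.
\<close>

lemma reflection:
  assumes p: "p \<in> P"
  obtains L where "linear L" "\<And>x y. B (L x) (L y) = B x y" "\<And>z. L (L z) = z" "\<And>z. z \<in> P \<Longrightarrow> L z \<in> P"
    "L (axis 1 1) = p"
proof (cases "p = axis 1 1")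
  case True
  show ?thesis by (rule that[of "\<lambda>z. z"]) (auto simp: True linear_iff)
next
  case False
  define q :: "real^4" where "q = axis 1 1"
  have q: "q \<in> P" by (simp add: q_def base_point)
  define n where "n = p - q"
  define b where "b = B n n"
  have b: "b = - 2 * (B q p - \<sigma>)"
    by (simp add: b_def n_def B.diff_left B.diff_right on_quadric p q sym[of p q])
  have b0: "b \<noteq> 0"
  proof
    assume "b = 0"
    then have "B q p = \<sigma>" using b by simp
    then have "B q n = 0" by (simp add: n_def B.diff_right on_quadric q)
    then show False using definite[OF q, of n] \<open>b = 0\<close> False by (simp add: b_def n_def q_def)
  qed
  define L where "L z = z - (2 * B z n / b) *\<^sub>R n" for z
  have Ln: "B (L z) n = - B z n" for z
    using b0 by (simp add: L_def B.diff_left B.scaleR_left b_def[symmetric])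
  have iso: "B (L x) (L y) = B x y" for x y
  proof -
    have "B (L x) (L y) = B x (L y) - (2 * B x n / b) * B n (L y)"
      by (simp add: L_def[of x] B.diff_left B.scaleR_left)
    also have "B n (L y) = - B y n" using Ln[of y] by (simp add: sym[of n])
    also have "B x (L y) = B x y - (2 * B y n / b) * B x n"
      by (simp add: L_def[of y] B.diff_right B.scaleR_right)
    finally show ?thesis by (simp add: mult_ac)
  qed
  have inv: "L (L z) = z" for z
  proof -
    have "L (L z) = L z + (2 * B z n / b) *\<^sub>R n" by (simp add: L_def[of "L z"] Ln)
    then show ?thesis by (simp add: L_def[of z])
  qed
  have Lq: "L q = p"
  proof -
    have "B q n = - b / 2" by (simp add: b n_def B.diff_right on_quadric q)
    then show ?thesis using b0 by (simp add: L_def n_def)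
  qed
  have LP: "L z \<in> P" if z: "z \<in> P" for z
  proof -
    have "0 < L z $ 1" if neg: "\<sigma> = -1"
    proof -
      have "- (L z $ 1) = B (L z) (L p)"
        using inv[of q] Lq by (simp add: form q_def axis_def neg)
      also have "\<dots> = B z p" by (rule iso)
      finally have "L z $ 1 = \<sigma> * B z p" by (simp add: neg)
      then show ?thesis using cs_ac[OF z p] cs_pos[OF neg] by metis
    qed
    then show ?thesis using iso[of z z] z by (simp add: points_iff)
  qed
  show ?thesis by (rule that[of L]) (auto simp: iso inv Lq[unfolded q_def] LP, auto simp: L_def linear_iff B.add_left B.scaleR_left add_divide_distrib algebra_simps)
qed
end

section \<open>Integrals over balls from the radial distribution of the volume\<close>

text \<open>
  Here \<open>r\<close> is a radial coordinate, \<open>\<rho> r\<close> the distance and \<open>w\<close> the density; \<open>G\<close> is an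
  antiderivative, as a function of the distance.  In the second alternative of \<open>sublevel\<close> the ball of
  radius \<open>R\<close> is the whole space, as for \<open>R = \<pi>\<close> on the sphere.  The derivative at 0 is a separate
  assumption because the slope of the kernel is singular there.
\<close>

lemma radial_ball_integral:
  fixes w \<rho> f G :: "real \<Rightarrow> real"
  assumes [measurable]: "w \<in> borel_measurable borel" "\<rho> \<in> borel_measurable borel" "f \<in> borel_measurable borel"
    and w: "\<And>r. 0 \<le> w r" and f: "\<And>r. 0 \<le> r \<Longrightarrow> 0 \<le> f (\<rho> r)"
    and deriv: "\<And>r. 0 < r \<Longrightarrow> ((\<lambda>r. G (\<rho> r)) has_real_derivative w r * f (\<rho> r)) (at r)"
    and deriv0: "((\<lambda>r. G (\<rho> r)) has_real_derivative c) (at 0)" "0 \<le> c"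
    and G0: "G (\<rho> 0) = 0"
    and sublevel: "(\<exists>a\<ge>0. \<rho> a = R \<and> (\<forall>r\<ge>0. \<rho> r \<le> R \<longleftrightarrow> r \<le> a)) \<or>
      (\<forall>r\<ge>0. \<rho> r \<le> R) \<and> ((\<lambda>r. G (\<rho> r)) \<longlongrightarrow> G R) at_top"
  shows "(\<integral>\<^sup>+r\<in>{0..}. ennreal (w r) * (ennreal (f (\<rho> r)) * indicator {..R} (\<rho> r)) \<partial>lborel) = ennreal (G R)"
proof -
  define g where "g r = (if r = 0 then c else w r * f (\<rho> r))" for r
  have [measurable]: "g \<in> borel_measurable borel" unfolding g_def by measurable
  have d: "((\<lambda>r. G (\<rho> r)) has_real_derivative g r) (at r)" if "0 \<le> r" for r
    using deriv[of r] deriv0 that by (cases "r = 0") (auto simp: g_def)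
  have g: "0 \<le> g r" if "0 \<le> r" for r using w f deriv0 that by (auto simp: g_def)
  have "AE r in lborel. r \<noteq> (0::real)" by (rule AE_lborel_singleton)
  then have eq: "(\<integral>\<^sup>+r\<in>{0..}. ennreal (w r) * (ennreal (f (\<rho> r)) * indicator {..R} (\<rho> r)) \<partial>lborel) =
      (\<integral>\<^sup>+r. ennreal (g r) * indicator {r. 0 \<le> r \<and> \<rho> r \<le> R} r \<partial>lborel)"
    by (intro nn_integral_cong_AE, eventually_elim) (auto simp: g_def w f ennreal_mult split: split_indicator)
  from sublevel show ?thesis
  proof
    assume "\<exists>a\<ge>0. \<rho> a = R \<and> (\<forall>r\<ge>0. \<rho> r \<le> R \<longleftrightarrow> r \<le> a)"
    then obtain a where a: "0 \<le> a" "\<rho> a = R" "\<And>r. 0 \<le> r \<Longrightarrow> \<rho> r \<le> R \<longleftrightarrow> r \<le> a" by blast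
    have set: "{r. 0 \<le> r \<and> \<rho> r \<le> R} = {0..a}" using a(3) by force
    have "(\<integral>\<^sup>+r. ennreal (g r) * indicator {r. 0 \<le> r \<and> \<rho> r \<le> R} r \<partial>lborel) = ennreal (G (\<rho> a) - G (\<rho> 0))"
      unfolding set by (rule nn_integral_FTC_Icc) (use d g a(1) in simp_all)
    then show ?thesis using eq G0 a(2) by simp
  next
    assume a: "(\<forall>r\<ge>0. \<rho> r \<le> R) \<and> ((\<lambda>r. G (\<rho> r)) \<longlongrightarrow> G R) at_top"
    then have set: "{r. 0 \<le> r \<and> \<rho> r \<le> R} = {0..}" by auto
    have "(\<integral>\<^sup>+r. ennreal (g r) * indicator {r. 0 \<le> r \<and> \<rho> r \<le> R} r \<partial>lborel) = ennreal (G R - G (\<rho> 0))"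
      unfolding set by (rule nn_integral_FTC_atLeast) (use d g a in simp_all)
    then show ?thesis using eq G0 by simp
  qed
qed

section \<open>Charts of unit quadrics\<close>

lemma vector_4_axis:
  "(vector [a, b, c, d] :: real^4) = a *\<^sub>R axis 1 1 + b *\<^sub>R axis 2 1 + c *\<^sub>R axis 3 1 + d *\<^sub>R axis 4 1"
  by (simp add: vec_eq_iff forall_4 axis_def)

lemma vector_3_axis:
  "(vector [a, b, c] :: real^3) = a *\<^sub>R axis 1 1 + b *\<^sub>R axis 2 1 + c *\<^sub>R axis 3 1"
  by (simp add: vec_eq_iff forall_3 axis_def)

lemma inner_3: "(u :: real^3) \<bullet> v = u$1 * v$1 + u$2 * v$2 + u$3 * v$3"
  by (simp add: inner_vec_def sum_3)

lemma inner_4: "(u :: real^4) \<bullet> v = u$1 * v$1 + u$2 * v$2 + u$3 * v$3 + u$4 * v$4"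
  by (simp add: inner_vec_def sum_4)

text \<open>
  The matrix determinant lemma for a scalar matrix minus a matrix of rank one.
\<close>

lemma det_axis_gram:
  "det (\<chi> i j. a * (axis i 1 \<bullet> (axis j 1 :: real^3)) - b * (u $ i * u $ j) :: real^3^3) = a ^ 3 - a\<^sup>2 * b * (u \<bullet> u)"
  by (simp add: det_3 inner_axis_axis inner_3[of u u] power2_eq_square power3_eq_cube algebra_simps)

text \<open>
  Transport and gradient depend on the distance function through its values on the space only, so that
  the distance may be replaced by its continuous extension to the ambient space.
\<close>

lemma quadric_transport_cong:
  assumes "d x y = d' x y"
  shows "quadric_transport P B d x y v = quadric_transport P B d' x y v"
  using assms by (simp add: quadric_transport_def minimizing_geodesic_def)

lemma quadric_gradient_cong:
  assumes "\<And>z. z \<in> P \<Longrightarrow> f z = g z"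
  shows "quadric_gradient P B f y = quadric_gradient P B g y"
proof -
  have "(\<lambda>t. f (c t)) = (\<lambda>t. g (c t))" if "range c \<subseteq> P" for c :: "real \<Rightarrow> real^4"
  proof -
    have "c t \<in> P" for t using that by auto
    then show ?thesis using assms by simp
  qed
  then have "(range c \<subseteq> P \<and> c 0 = y \<and> (c has_vector_derivative v) (at 0) \<longrightarrow> ((\<lambda>t. f (c t)) has_real_derivative B w v) (at 0)) \<longleftrightarrow>
      (range c \<subseteq> P \<and> c 0 = y \<and> (c has_vector_derivative v) (at 0) \<longrightarrow> ((\<lambda>t. g (c t)) has_real_derivative B w v) (at 0))"
    for c v w by metis
  then show ?thesis unfolding quadric_gradient_def by simp
qed

text \<open>
  A chart \<open>\<psi>\<close>, with inverse \<open>\<xi>\<close>, in which the volume density and the distance from the base point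
  depend only on the norm of the coordinates, through \<open>j\<close> and \<open>\<rho>\<close>.
\<close>

locale charted_quadric = unit_quadric +
  fixes \<psi> :: "real^3 \<Rightarrow> real^4" and \<psi>' :: "real^3 \<Rightarrow> real^3 \<Rightarrow> real^4"
    and \<xi> :: "real^4 \<Rightarrow> real^3" and \<xi>' :: "real^4 \<Rightarrow> real^4 \<Rightarrow> real^3" and W :: "(real^4) set"
    and j \<rho> :: "real \<Rightarrow> real"
  assumes \<psi>_deriv: "(\<psi> has_derivative \<psi>' u) (at u)" and \<psi>_in: "\<psi> u \<in> P \<inter> W"
    and \<xi>_deriv: "z \<in> W \<Longrightarrow> (\<xi> has_derivative \<xi>' z) (at z)"
    and \<xi>_\<psi>: "\<xi> (\<psi> u) = u" and \<psi>_\<xi>: "z \<in> P \<inter> W \<Longrightarrow> \<psi> (\<xi> z) = z"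
    and W_open: "open W" and W_cofinite: "finite (P - W)" and P_closed: "closed P"
    and volume_density: "sqrt (det (gram B \<psi> u)) = j (norm u)"
    and j_pos: "0 \<le> r \<Longrightarrow> 0 < j r" and j_measurable: "j \<in> borel_measurable borel"
    and radius: "dst (axis 1 1) (\<psi> u) = \<rho> (norm u)" and \<rho>_measurable: "\<rho> \<in> borel_measurable borel"
begin

abbreviation vol where "vol \<equiv> riemannian_volume B \<psi>"

lemma chart_measurable: "\<psi> \<in> borel_measurable borel"
  using has_derivative_continuous_on[of UNIV \<psi> \<psi>'] \<psi>_deriv
  by (auto intro: borel_measurable_continuous_onI)

lemma density_measurable: "(\<lambda>u. sqrt (det (gram B \<psi> u))) \<in> borel_measurable borel"
  unfolding volume_density using j_measurable by measurable

lemma vol_sets [simp]: "sets vol = sets borel" by (simp add: riemannian_volume_def)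

lemma nn_integral_vol:
  assumes [measurable]: "h \<in> borel_measurable borel"
  shows "(\<integral>\<^sup>+x. h x \<partial>vol) = (\<integral>\<^sup>+u. ennreal (j (norm u)) * h (\<psi> u) \<partial>lborel)"
proof -
  note [measurable] = chart_measurable j_measurable
  show ?thesis unfolding riemannian_volume_def volume_density
    by (subst nn_integral_distr) (auto simp: nn_integral_density)
qed

lemma AE_in_P: "AE x in vol. x \<in> P"
proof -
  note [measurable] = chart_measurable
  have "P \<in> sets borel" using P_closed by simp
  then show ?thesis unfolding riemannian_volume_def
    using \<psi>_in by (subst AE_distr_iff) auto
qed

lemma dst_continuous: "continuous_on UNIV (\<lambda>(x, y). dst x y)"
proof -
  have "continuous_on UNIV (\<lambda>p. \<sigma> * B (fst p) (snd p))"
    by (intro continuous_intros B.continuous_on)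
  from continuous_on_compose2[OF ac_continuous this] show ?thesis by (simp add: case_prod_beta)
qed

lemma dst_continuous1: "continuous_on UNIV (\<lambda>x. dst p x)"
proof -
  have "continuous_on UNIV (\<lambda>x. \<sigma> * B p x)"
    by (intro continuous_intros B.continuous_on)
  from continuous_on_compose2[OF ac_continuous this] show ?thesis by simp
qed

lemma dst_measurable: "(\<lambda>x. dst p x) \<in> borel_measurable borel"
  by (intro borel_measurable_continuous_onI dst_continuous1)

text \<open>
  A reflection moves \<open>p\<close> to the base point, where the distance and the density are radial.
\<close>

lemma radial_distribution:
  assumes p: "p \<in> P" and h: "h \<in> borel_measurable borel"
  shows "(\<integral>\<^sup>+x. h (dst p x) \<partial>vol) = (\<integral>\<^sup>+r\<in>{0..}. ennreal (4 * pi * r\<^sup>2 * j r) * h (\<rho> r) \<partial>lborel)"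
proof -
  note [measurable] = h j_measurable \<rho>_measurable chart_measurable
  let ?e = "axis 1 1 :: real^4"
  obtain L where L: "linear L" "\<And>x y. B (L x) (L y) = B x y" "\<And>z. L (L z) = z" "\<And>z. z \<in> P \<Longrightarrow> L z \<in> P"
    "L ?e = p" by (rule reflection[OF p]) blast
  have null: "{u. L (\<psi> u) \<notin> W} \<in> null_sets lborel"
  proof -
    have "{u. L (\<psi> u) \<notin> W} \<subseteq> \<xi> ` L ` (P - W)"
    proof
      fix u assume "u \<in> {u. L (\<psi> u) \<notin> W}"
      then have "L (\<psi> u) \<in> P - W" using L(4) \<psi>_in by auto
      moreover have "u = \<xi> (L (L (\<psi> u)))" by (simp add: L(3) \<xi>_\<psi>)
      ultimately show "u \<in> \<xi> ` L ` (P - W)" by blast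
    qed
    then have "finite {u. L (\<psi> u) \<notin> W}" using W_cofinite finite_subset by blast
    then show ?thesis by (intro finite_imp_null_set_lborel)
  qed
  have hd: "(\<lambda>x. h (dst p x)) \<in> borel_measurable borel" for p
    using dst_measurable h by (rule measurable_compose)
  have "(\<integral>\<^sup>+x. h (dst p x) \<partial>vol) = (\<integral>\<^sup>+x. h (dst p (L x)) \<partial>vol)"
    by (rule riemannian_volume_invariant[symmetric, OF bilinear \<psi>_deriv \<psi>_in \<xi>_deriv \<xi>_\<psi> \<psi>_\<xi> W_open density_measurable _ L(1,2,4,3) null hd])
      (auto simp: volume_density j_pos)
  also have "\<dots> = (\<integral>\<^sup>+x. h (dst ?e x) \<partial>vol)"
    using L(2)[of ?e] by (simp add: L(5))
  also have "\<dots> = (\<integral>\<^sup>+u. ennreal (j (norm u)) * h (dst ?e (\<psi> u)) \<partial>lborel)"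
    by (rule nn_integral_vol[OF hd])
  also have "\<dots> = (\<integral>\<^sup>+u. ennreal (j (norm (u :: real^3))) * h (\<rho> (norm u)) \<partial>lborel)"
    by (simp add: radius)
  also have "\<dots> = (\<integral>\<^sup>+r\<in>{0..}. ennreal (4 * pi * r\<^sup>2) * (ennreal (j r) * h (\<rho> r)) \<partial>lborel)"
    by (rule nn_integral_radial[of "\<lambda>r. ennreal (j r) * h (\<rho> r)"]) measurable
  also have "\<dots> = (\<integral>\<^sup>+r\<in>{0..}. ennreal (4 * pi * r\<^sup>2 * j r) * h (\<rho> r) \<partial>lborel)"
    using j_pos by (intro nn_integral_cong) (auto simp: ennreal_mult less_imp_le mult.assoc split: split_indicator)
  finally show ?thesis .
qed

lemma dst_sym: "dst x y = dst y x"
  by (simp add: sym)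

lemma ball_integral:
  assumes p: "p \<in> P" and [measurable]: "f \<in> borel_measurable borel" and f: "\<And>r. 0 \<le> r \<Longrightarrow> 0 \<le> f (\<rho> r)"
    and deriv: "\<And>r. 0 < r \<Longrightarrow> ((\<lambda>r. G (\<rho> r)) has_real_derivative 4 * pi * r\<^sup>2 * j r * f (\<rho> r)) (at r)"
    and deriv0: "((\<lambda>r. G (\<rho> r)) has_real_derivative c) (at 0)" "0 \<le> c"
    and G0: "G (\<rho> 0) = 0"
    and sublevel: "(\<exists>a\<ge>0. \<rho> a = R \<and> (\<forall>r\<ge>0. \<rho> r \<le> R \<longleftrightarrow> r \<le> a)) \<or>
      (\<forall>r\<ge>0. \<rho> r \<le> R) \<and> ((\<lambda>r. G (\<rho> r)) \<longlongrightarrow> G R) at_top"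
  shows "(\<integral>\<^sup>+x\<in>{x \<in> P. dst p x \<le> R}. ennreal (f (dst p x)) \<partial>vol) = ennreal (G R)"
proof -
  note [measurable] = j_measurable \<rho>_measurable
  define w where "w r = 4 * pi * r\<^sup>2 * j \<bar>r\<bar>" for r
  have w: "w r = 4 * pi * r\<^sup>2 * j r" if "0 \<le> r" for r using that by (simp add: w_def)
  have "(\<integral>\<^sup>+x\<in>{x \<in> P. dst p x \<le> R}. ennreal (f (dst p x)) \<partial>vol) =
      (\<integral>\<^sup>+x. ennreal (f (dst p x)) * indicator {..R} (dst p x) \<partial>vol)"
    using AE_in_P by (intro nn_integral_cong_AE, elim eventually_mono) (auto split: split_indicator)
  also have "\<dots> = (\<integral>\<^sup>+r\<in>{0..}. ennreal (4 * pi * r\<^sup>2 * j r) * (ennreal (f (\<rho> r)) * indicator {..R} (\<rho> r)) \<partial>lborel)"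
    by (rule radial_distribution[OF p, of "\<lambda>t. ennreal (f t) * indicator {..R} t"]) measurable
  also have "\<dots> = (\<integral>\<^sup>+r\<in>{0..}. ennreal (w r) * (ennreal (f (\<rho> r)) * indicator {..R} (\<rho> r)) \<partial>lborel)"
    by (intro nn_integral_cong) (auto simp: w split: split_indicator)
  also have "\<dots> = ennreal (G R)"
  proof (rule radial_ball_integral[where w = w and \<rho> = \<rho> and f = f and G = G and c = c])
    show "w \<in> borel_measurable borel" unfolding w_def by measurable
    show "0 \<le> w r" for r using j_pos[of "\<bar>r\<bar>"] by (simp add: w_def)
    show "((\<lambda>r. G (\<rho> r)) has_real_derivative w r * f (\<rho> r)) (at r)" if "0 < r" for r
      using deriv[OF that] that by (simp add: w)
  qed (fact f deriv0 G0 sublevel \<rho>_measurable assms(2))+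
  finally show ?thesis .
qed

text \<open>
  What remains to be checked for a space are properties of functions of one variable: the
  antiderivatives \<open>F\<close> and \<open>N\<close>, the monotonicity of the slope \<open>s\<close>, and the derivative of the kernel.
\<close>

lemma biot_savart:
  fixes M :: "(real^4) space3" and F N s \<phi> :: "real \<Rightarrow> real"
  assumes M: "points M = P" "tangent M = quadric_tangent B" "metric M = B" "volume M = vol"
      "cross M = quadric_cross B" "gradient M = quadric_gradient P B"
      "transport M = quadric_transport P B (distance M)" "kernel M = \<phi>"
    and dist: "\<And>x y. x \<in> P \<Longrightarrow> y \<in> P \<Longrightarrow> distance M x y = dst x y"
    and D_down: "\<And>r R. R \<in> D \<Longrightarrow> 0 \<le> r \<Longrightarrow> r \<le> R \<Longrightarrow> r \<in> D"
    and \<rho>: "\<rho> 0 = 0" "\<And>r. 0 \<le> r \<Longrightarrow> \<rho> r \<in> D" "\<And>r. 0 < r \<Longrightarrow> sn (\<rho> r) \<noteq> 0"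
    and F: "continuous_on D F" "strict_mono_on D F" "F 0 = 0"
      "\<And>r. 0 \<le> r \<Longrightarrow> ((\<lambda>r. F (\<rho> r)) has_real_derivative 4 * pi * r\<^sup>2 * j r) (at r)"
    and N: "N 0 = 0" "\<And>R. R \<in> D \<Longrightarrow> 0 \<le> N R"
      "\<And>r. 0 < r \<Longrightarrow> ((\<lambda>r. N (\<rho> r)) has_real_derivative 4 * pi * r\<^sup>2 * j r * s (\<rho> r)) (at r)"
      "((\<lambda>r. N (\<rho> r)) has_real_derivative c) (at 0)" "0 \<le> c"
    and sublevel: "\<And>R. R \<in> D \<Longrightarrow> (\<exists>a\<ge>0. \<rho> a = R \<and> (\<forall>r\<ge>0. \<rho> r \<le> R \<longleftrightarrow> r \<le> a)) \<or>
      (\<forall>r\<ge>0. \<rho> r \<le> R) \<and> ((\<lambda>r. F (\<rho> r)) \<longlongrightarrow> F R) at_top \<and> ((\<lambda>r. N (\<rho> r)) \<longlongrightarrow> N R) at_top"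
    and s: "s \<in> borel_measurable borel" "\<And>r. r \<in> D \<Longrightarrow> 0 \<le> s r"
      "\<And>r R. R \<in> D \<Longrightarrow> 0 < r \<Longrightarrow> r \<le> R \<Longrightarrow> s R \<le> s r"
    and \<phi>: "\<And>r. r \<in> D \<Longrightarrow> sn r \<noteq> 0 \<Longrightarrow> (\<phi> has_real_derivative s r) (at r)"
  shows "biot_savart_space M D F N s dst"
proof (rule biot_savart_space.intro)
  show "sets (volume M) = sets borel" by (simp add: M)
  show "points M \<in> sets borel" using P_closed by (simp add: M)
  show "bounded_bilinear (metric M)" using bilinear by (simp add: M)
  show "metric M v w = metric M w v" for v w using sym by (simp add: M)
  show "\<exists>l::real^4 \<Rightarrow> real. bounded_linear l \<and> tangent M x = {v. l v = 0}" for x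
    using B.bounded_linear_right[of x] by (intro exI[of _ "B x"]) (auto simp: M quadric_tangent_def)
  show "0 \<le> metric M v v" if "x \<in> points M" "v \<in> tangent M x" for x v
    using that nonneg by (simp add: M quadric_tangent_def)
  show "(\<lambda>(x, y). dst x y) \<in> borel_measurable (borel \<Otimes>\<^sub>M borel)"
    using borel_measurable_continuous_onI[OF dst_continuous] by (simp add: borel_prod)
  show "distance M x y = dst x y" if "x \<in> points M" "y \<in> points M" for x y
    using that dist by (simp add: M)
  show "dst x y = dst y x" for x y by (rule dst_sym)
  show "dst x y \<in> D" if "x \<in> points M" "y \<in> points M" for x y using that ac_in by (simp add: M)
  show "0 \<le> R" if "R \<in> D" for R using that by (rule D_nonneg)
  show "r \<in> D" if "R \<in> D" "0 \<le> r" "r \<le> R" for r R using that by (rule D_down)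
  show "\<exists>p\<in>points M. \<exists>R\<in>D. \<forall>x\<in>\<Omega>. dst p x \<le> R" if \<Omega>: "compact \<Omega>" "\<Omega> \<subseteq> points M" "\<Omega> \<noteq> {}" for \<Omega>
  proof -
    obtain m where "m \<in> \<Omega>" "\<forall>x\<in>\<Omega>. dst (axis 1 1) x \<le> dst (axis 1 1) m"
      using continuous_attains_sup[OF \<Omega>(1,3) continuous_on_subset[OF dst_continuous1]] by blast
    then show ?thesis using base_point ac_in[OF base_point] \<Omega>(2) M(1) by blast
  qed
  show "emeasure (volume M) {x \<in> points M. dst p x \<le> R} = ennreal (F R)" if p: "p \<in> points M" and R: "R \<in> D" for p R
  proof -
    have "{x \<in> P. dst p x \<le> R} \<in> sets borel"
    proof -
      have "closed {x. dst p x \<le> R}" by (intro closed_Collect_le dst_continuous1 continuous_on_const)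
      moreover have "{x \<in> P. dst p x \<le> R} = P \<inter> {x. dst p x \<le> R}" by auto
      ultimately show ?thesis using P_closed by (simp add: closed_Int)
    qed
    then have "emeasure vol {x \<in> P. dst p x \<le> R} = (\<integral>\<^sup>+x\<in>{x \<in> P. dst p x \<le> R}. ennreal 1 \<partial>vol)"
      by simp
    also have "\<dots> = ennreal (F R)"
      using p F \<rho>(1) sublevel[OF R] F(4)[of 0] by (intro ball_integral[where c = 0]) (auto simp: M)
    finally show ?thesis by (simp add: M)
  qed
  show "continuous_on D F" "strict_mono_on D F" "F 0 = 0" by fact+
  show "(\<integral>\<^sup>+x\<in>{x \<in> points M. dst p x \<le> R}. ennreal (s (dst p x)) \<partial>volume M) = ennreal (N R)"
    if p: "p \<in> points M" and R: "R \<in> D" for p R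
    unfolding M using p \<rho> N s sublevel[OF R] by (intro ball_integral[where c = c]) (auto simp: M)
  show "0 \<le> N R" if "R \<in> D" for R using that by fact
  show "s \<in> borel_measurable borel" by fact
  show "0 \<le> s r" if "r \<in> D" for r using that by fact
  show "s R \<le> s r" if "R \<in> D" "0 < r" "r \<le> R" for r R using that by fact
  show "AE x in volume M. x \<in> points M \<longrightarrow> (\<forall>v\<in>tangent M x.
      let w = cross M y (transport M x y v) (gradient M (\<lambda>z. kernel M (distance M x z)) y)
      in w \<in> tangent M y \<and> metric M w w \<le> (s (dst x y))\<^sup>2 * metric M v v)" if "y \<in> points M" for y
  proof -
    have y: "y \<in> P" using that by (simp add: M)
    have "continuous_on UNIV sn"
      using sn_deriv by (intro DERIV_continuous_on) auto
    then have sn_m: "sn \<in> borel_measurable borel" by (rule borel_measurable_continuous_onI)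
    have snd_m: "(\<lambda>x. sn (dst y x)) \<in> borel_measurable borel"
      using dst_measurable sn_m by (rule measurable_compose)
    note [measurable] = sn_m snd_m
    have "(\<integral>\<^sup>+x. indicator {t. sn t = 0} (dst y x) \<partial>vol) = (\<integral>\<^sup>+r\<in>{0..}. ennreal (4 * pi * r\<^sup>2 * j r) * indicator {t. sn t = 0} (\<rho> r) \<partial>lborel)"
      by (rule radial_distribution[OF y]) measurable
    also have "\<dots> = (\<integral>\<^sup>+(r::real). 0 \<partial>lborel)"
      using \<rho>(3) by (intro nn_integral_cong) (auto simp: le_less split: split_indicator)
    finally have "(\<integral>\<^sup>+x. indicator {t. sn t = 0} (dst y x) \<partial>vol) = 0" by simp
    then have "AE x in vol. indicator {t. sn t = 0} (dst y x) = (0 :: ennreal)"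
    proof (subst (asm) nn_integral_0_iff_AE)
      have "(indicator {t. sn t = 0} :: real \<Rightarrow> ennreal) \<in> borel_measurable borel" by measurable
      from measurable_compose[OF dst_measurable this]
      show "(\<lambda>x. indicator {t. sn t = 0} (dst y x) :: ennreal) \<in> borel_measurable vol"
        by (simp add: measurable_cong_sets[OF vol_sets refl])
    qed
    then have "AE x in vol. sn (dst x y) \<noteq> 0"
      by eventually_elim (simp add: dst_sym[of y] split: split_indicator_asm)
    then show ?thesis
      unfolding M(4)
    proof (rule eventually_mono, intro impI ballI)
      fix x v assume sn: "sn (dst x y) \<noteq> 0" and "x \<in> points M" and "v \<in> tangent M x"
      then have x: "x \<in> P" and v: "B x v = 0" by (auto simp: M quadric_tangent_def)
      have "quadric_gradient P B (\<lambda>z. \<phi> (distance M x z)) y = quadric_gradient P B (\<lambda>z. \<phi> (dst x z)) y"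
        by (intro quadric_gradient_cong) (simp add: dist x)
      moreover have "quadric_transport P B (distance M) x y v = quadric_transport P B dst x y v"
        by (intro quadric_transport_cong) (simp add: dist x y)
      ultimately show "let w = cross M y (transport M x y v) (gradient M (\<lambda>z. kernel M (distance M x z)) y)
          in w \<in> tangent M y \<and> metric M w w \<le> (s (dst x y))\<^sup>2 * metric M v v"
        using integrand_bound[OF x y sn v \<phi>[OF ac_in[OF x y] sn]]
        by (simp add: M Let_def quadric_tangent_def)
    qed
  qed
qed

end

section \<open>Euclidean space\<close>

lemma gradient_Newtonian:
  fixes x y :: "real^3"
  assumes "x \<noteq> y"
  shows "(THE D. GDERIV (\<lambda>z. - 1 / (4 * pi * dist x z)) y :> D) = (1 / (4 * pi * (dist x y) ^ 3)) *\<^sub>R (y - x)"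
proof (rule the_equality)
  have pos: "0 < dist x y" using assms by simp
  have d: "((\<lambda>z. dist x z) has_derivative (\<lambda>v. v \<bullet> ((1 / dist x y) *\<^sub>R (y - x)))) (at y)"
  proof -
    have "((\<lambda>z. norm (z - x)) has_derivative (\<lambda>v. v \<bullet> sgn (y - x))) (at y)"
    proof -
      have "((\<lambda>z. z - x) has_derivative (\<lambda>v. v)) (at y)" by (auto intro!: derivative_eq_intros)
      from has_derivative_compose[OF this, of norm] has_derivative_norm[of "y - x"] assms
      show ?thesis by (simp add: inner_commute)
    qed
    then show ?thesis by (simp add: dist_norm norm_minus_commute[of x] sgn_div_norm divide_inverse)
  qed
  have "((\<lambda>t. - 1 / (4 * pi * t)) has_real_derivative 1 / (4 * pi * (dist x y)\<^sup>2)) (at (dist x y))"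
    using pos by (auto intro!: derivative_eq_intros simp: field_simps power2_eq_square)
  from has_derivative_compose[OF d this[unfolded has_field_derivative_def]]
  show *: "GDERIV (\<lambda>z. - 1 / (4 * pi * dist x z)) y :> (1 / (4 * pi * (dist x y) ^ 3)) *\<^sub>R (y - x)"
    unfolding gderiv_def by (simp add: power2_eq_square power3_eq_cube mult_ac)
  fix D assume "GDERIV (\<lambda>z. - 1 / (4 * pi * dist x z)) y :> D"
  then have "(\<lambda>h. h \<bullet> D) = (\<lambda>h. h \<bullet> ((1 / (4 * pi * (dist x y) ^ 3)) *\<^sub>R (y - x)))"
    using * unfolding gderiv_def by (rule has_derivative_unique)
  then have "\<forall>h. h \<bullet> D = h \<bullet> ((1 / (4 * pi * (dist x y) ^ 3)) *\<^sub>R (y - x))"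
    by (intro allI) (rule fun_cong)
  then show "D = (1 / (4 * pi * (dist x y) ^ 3)) *\<^sub>R (y - x)"
    by (rule vector_eq_ldot[THEN iffD1])
qed

lemma E3_biot_savart:
  "biot_savart_space E3 {0..} (\<lambda>R. 4 / 3 * pi * R ^ 3) N_E3 (\<lambda>r. 1 / (4 * pi * r\<^sup>2)) dist"
proof (rule biot_savart_space.intro)
  let ?s = "\<lambda>r. 1 / (4 * pi * r\<^sup>2) :: real"
  show "bounded_bilinear (metric E3)" by (simp add: E3_def bounded_bilinear_inner)
  show "metric E3 v w = metric E3 w v" for v w by (simp add: E3_def inner_commute)
  show "\<exists>l::real^3 \<Rightarrow> real. bounded_linear l \<and> tangent E3 x = {v. l v = 0}" for x
    by (intro exI[of _ "\<lambda>_. 0"]) (auto simp: E3_def)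
  show "(\<lambda>(x::real^3, y). dist x y) \<in> borel_measurable (borel \<Otimes>\<^sub>M borel)" by measurable
  show "\<exists>p\<in>points E3. \<exists>R\<in>{0..}. \<forall>x\<in>\<Omega>. dist p x \<le> R" if c: "compact \<Omega>" for \<Omega> :: "(real^3) set"
  proof -
    obtain R where "0 < R" "\<Omega> \<subseteq> ball 0 R"
      using bounded_subset_ballD[OF compact_imp_bounded[OF c], of 0] by blast
    then show ?thesis
      by (intro bexI[of _ 0] bexI[of _ R] ballI) (auto simp: E3_def subset_iff less_imp_le)
  qed
  show "emeasure (volume E3) {x \<in> points E3. dist p x \<le> R} = ennreal (4 / 3 * pi * R ^ 3)" if "R \<in> {0..}" for p R
  proof -
    have "{x. dist p x \<le> R} = cball p R" by auto
    then show ?thesis using that emeasure_cball[of R p] by (simp add: E3_def unit_ball_vol_3)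
  qed
  show "strict_mono_on {0..} (\<lambda>R::real. 4 / 3 * pi * R ^ 3)"
    by (auto intro!: strict_mono_onI power_strict_mono)
  show "(\<integral>\<^sup>+x\<in>{x \<in> points E3. dist p x \<le> R}. ennreal (?s (dist p x)) \<partial>volume E3) = ennreal (N_E3 R)"
    if R: "R \<in> {0..}" for p R
  proof -
    define h where "h t = ennreal (?s t) * indicator {..R} t" for t
    have [measurable]: "h \<in> borel_measurable borel" unfolding h_def by measurable
    have "(\<integral>\<^sup>+x\<in>{x \<in> points E3. dist p x \<le> R}. ennreal (?s (dist p x)) \<partial>volume E3)
        = (\<integral>\<^sup>+x. h (dist p x) \<partial>distr lborel borel ((+) p))"
      unfolding lborel_distr_plus by (auto simp: E3_def h_def intro!: nn_integral_cong split: split_indicator)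
    also have "\<dots> = (\<integral>\<^sup>+u. h (norm (u :: real^3)) \<partial>lborel)"
      by (subst nn_integral_distr) (auto simp: dist_norm)
    also have "\<dots> = (\<integral>\<^sup>+r\<in>{0..}. ennreal (4 * pi * r\<^sup>2) * (ennreal (?s r) * indicator {..R} r) \<partial>lborel)"
      by (subst nn_integral_radial) (auto simp: h_def)
    also have "\<dots> = ennreal (N_E3 R)"
    proof (rule radial_ball_integral[where \<rho> = "\<lambda>r. r" and c = 1])
      show "((\<lambda>r. N_E3 r) has_real_derivative 4 * pi * r\<^sup>2 * ?s r) (at r)" if "0 < r" for r
        using that by (simp add: N_E3_def[abs_def])
      show "((\<lambda>r. N_E3 r) has_real_derivative 1) (at 0)" by (simp add: N_E3_def[abs_def])
      show "(\<exists>a\<ge>0. a = R \<and> (\<forall>r\<ge>0. r \<le> R \<longleftrightarrow> r \<le> a)) \<or>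
          (\<forall>r\<ge>0. r \<le> R) \<and> ((\<lambda>r. N_E3 r) \<longlongrightarrow> N_E3 R) at_top"
        using R by auto
    qed (simp_all add: N_E3_def)
    finally show ?thesis .
  qed
  show "AE x in volume E3. x \<in> points E3 \<longrightarrow> (\<forall>v\<in>tangent E3 x.
      let w = cross E3 y (transport E3 x y v) (gradient E3 (\<lambda>z. kernel E3 (distance E3 x z)) y)
      in w \<in> tangent E3 y \<and> metric E3 w w \<le> (?s (dist x y))\<^sup>2 * metric E3 v v)" for y
  proof -
    have "AE x in lborel. x \<noteq> y" by (rule AE_lborel_singleton)
    then have "AE x in lborel. \<forall>v. (cross3 v (THE D. GDERIV (\<lambda>z. - 1 / (4 * pi * dist x z)) y :> D)) \<bullet>
        (cross3 v (THE D. GDERIV (\<lambda>z. - 1 / (4 * pi * dist x z)) y :> D)) \<le> (?s (dist x y))\<^sup>2 * (v \<bullet> v)"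
    proof (eventually_elim, intro allI)
      fix x v assume x: "x \<noteq> y"
      define g where "g = (1 / (4 * pi * (dist x y) ^ 3)) *\<^sub>R (y - x)"
      have "norm g = ?s (dist x y)"
        using x by (simp add: g_def dist_norm norm_minus_commute[of y] power2_eq_square power3_eq_cube)
      moreover have "(norm (cross3 v g))\<^sup>2 \<le> (norm g)\<^sup>2 * (norm v)\<^sup>2" by (simp add: norm_cross)
      ultimately show "(cross3 v (THE D. GDERIV (\<lambda>z. - 1 / (4 * pi * dist x z)) y :> D)) \<bullet>
        (cross3 v (THE D. GDERIV (\<lambda>z. - 1 / (4 * pi * dist x z)) y :> D)) \<le> (?s (dist x y))\<^sup>2 * (v \<bullet> v)"
        unfolding gradient_Newtonian[OF x] g_def[symmetric] by (simp add: power2_norm_eq_inner)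
    qed
    moreover have vol: "volume E3 = lborel" by (simp add: E3_def)
    ultimately show ?thesis unfolding vol by (simp add: E3_def Let_def)
  qed
  show "?s R \<le> ?s r" if "0 < r" "r \<le> R" for r R
  proof (rule divide_left_mono)
    show "4 * pi * r\<^sup>2 \<le> 4 * pi * R\<^sup>2" using that by (simp add: power_mono)
    show "0 < 4 * pi * R\<^sup>2 * (4 * pi * r\<^sup>2)" using that by simp
  qed simp
  show "continuous_on {0..} (\<lambda>R::real. 4 / 3 * pi * R ^ 3)" by (intro continuous_intros)
  show "dist x y = dist y x" for x y :: "real^3" by (rule dist_commute)
  show "?s \<in> borel_measurable borel" by measurable
  show "0 \<le> N_E3 R" if "R \<in> {0..}" for R using that by (simp add: N_E3_def)
  show "distance E3 x y = dist x y" for x y by (simp add: E3_def)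
  show "0 \<le> metric E3 v v" for v by (simp add: E3_def)
  show "sets (volume E3) = sets borel" "points E3 \<in> sets borel" by (simp_all add: E3_def)
  show "dist x y \<in> {0..}" for x y :: "real^3" by simp
  show "0 \<le> R" if "R \<in> {0..}" for R :: real using that by simp
  show "r \<in> {0..}" if "0 \<le> r" for r :: real using that by simp
  show "4 / 3 * pi * 0 ^ 3 = (0::real)" by simp
  show "0 \<le> ?s r" for r by simp
qed

section \<open>The 3-sphere\<close>

definition S3_chart_deriv :: "real^3 \<Rightarrow> real^3 \<Rightarrow> real^4" where
  "S3_chart_deriv u v = (let a = 1 / (1 + u \<bullet> u); s = u \<bullet> v in
     vector [- 4 * a\<^sup>2 * s, 2 * a * v$1 - 4 * a\<^sup>2 * s * u$1, 2 * a * v$2 - 4 * a\<^sup>2 * s * u$2, 2 * a * v$3 - 4 * a\<^sup>2 * s * u$3])"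

lemma S3_chart_has_derivative: "(S3_chart has_derivative S3_chart_deriv u) (at u)"
proof -
  define a where "a = 1 / (1 + u \<bullet> u)"
  have pos: "1 + u \<bullet> u \<noteq> 0" using inner_ge_zero[of u] by linarith
  then have a: "a * (1 + u \<bullet> u) = 1" by (simp add: a_def)
  have "((\<lambda>u. 1 + u \<bullet> u) has_derivative (\<lambda>v. 2 * (u \<bullet> v))) (at u)"
    by (auto intro!: derivative_eq_intros simp: inner_commute)
  moreover have "((\<lambda>t. 1 / t) has_real_derivative - (a\<^sup>2)) (at (1 + u \<bullet> u))"
    using pos by (auto intro!: derivative_eq_intros simp: a_def power2_eq_square)
  ultimately have da: "((\<lambda>u. 1 / (1 + u \<bullet> u)) has_derivative (\<lambda>v. - (a\<^sup>2) * (2 * (u \<bullet> v)))) (at u)"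
    unfolding has_field_derivative_def by (rule has_derivative_compose)
  have comp: "((\<lambda>u. u $ i) has_derivative (\<lambda>v. v $ i)) (at u)" for i
    by (rule bounded_linear_imp_has_derivative[OF bounded_linear_vec_nth])
  have dg: "((\<lambda>u. vector [1 - u \<bullet> u, 2 * u$1, 2 * u$2, 2 * u$3] :: real^4) has_derivative
      (\<lambda>v. vector [- 2 * (u \<bullet> v), 2 * v$1, 2 * v$2, 2 * v$3])) (at u)"
    unfolding vector_4_axis by (auto intro!: derivative_eq_intros comp simp: inner_commute)
  have "S3_chart_deriv u v = (1 / (1 + u \<bullet> u)) *\<^sub>R vector [- 2 * (u \<bullet> v), 2 * v$1, 2 * v$2, 2 * v$3] +
      (- (a\<^sup>2) * (2 * (u \<bullet> v))) *\<^sub>R vector [1 - u \<bullet> u, 2 * u$1, 2 * u$2, 2 * u$3]" for v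
  proof -
    have "a * (- 2 * (u \<bullet> v)) + (- (a\<^sup>2) * (2 * (u \<bullet> v))) * (1 - u \<bullet> u)
        = - 4 * a\<^sup>2 * (u \<bullet> v) + 2 * a * (u \<bullet> v) * (a * (1 + u \<bullet> u) - 1)"
      by (simp add: power2_eq_square algebra_simps)
    then show ?thesis
      by (simp add: S3_chart_deriv_def Let_def a_def[symmetric] vec_eq_iff forall_4 a)
  qed
  then have "S3_chart_deriv u = (\<lambda>v. (1 / (1 + u \<bullet> u)) *\<^sub>R vector [- 2 * (u \<bullet> v), 2 * v$1, 2 * v$2, 2 * v$3] +
      (- (a\<^sup>2) * (2 * (u \<bullet> v))) *\<^sub>R vector [1 - u \<bullet> u, 2 * u$1, 2 * u$2, 2 * u$3])" by (rule ext)
  then show ?thesis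
    unfolding S3_chart_def[abs_def] using has_derivative_scaleR[OF da dg] by (simp only:)
qed

text \<open>
  Stereographic projection is conformal.
\<close>

lemma S3_chart_metric:
  "S3_chart_deriv u v \<bullet> S3_chart_deriv u w = 4 / (1 + u \<bullet> u)\<^sup>2 * (v \<bullet> w)"
proof -
  define a where "a = 1 / (1 + u \<bullet> u)"
  have "1 + u \<bullet> u \<noteq> 0" using inner_ge_zero[of u] by linarith
  then have a: "a * (1 + u \<bullet> u) = 1" by (simp add: a_def)
  have "S3_chart_deriv u v \<bullet> S3_chart_deriv u w =
      4 * a\<^sup>2 * (v \<bullet> w) + 16 * a ^ 3 * (u \<bullet> v) * (u \<bullet> w) * (a * (1 + u \<bullet> u) - 1)"
    unfolding S3_chart_deriv_def a_def[symmetric] Let_def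
    by (simp add: inner_4 inner_3 power2_eq_square power3_eq_cube algebra_simps)
  then show ?thesis unfolding a by (simp add: a_def power_one_over power_inverse divide_inverse)
qed

text \<open>
  A continuous function on the real line that is the arc cosine on its domain, so that the distance
  extends continuously to the ambient space.
\<close>

definition arccos_clamped :: "real \<Rightarrow> real" where
  "arccos_clamped s = arccos (max (-1) (min 1 s))"

lemma arccos_clamped: "-1 \<le> s \<Longrightarrow> s \<le> 1 \<Longrightarrow> arccos_clamped s = arccos s"
  by (simp add: arccos_clamped_def)

definition stereographic :: "real^4 \<Rightarrow> real^3" where
  "stereographic z = (1 / (1 + z$1)) *\<^sub>R vector [z$2, z$3, z$4]"

lemma sin_2_arctan: "sin (2 * arctan r) = 2 * r / (1 + r\<^sup>2)"
  and cos_2_arctan: "cos (2 * arctan r) = (1 - r\<^sup>2) / (1 + r\<^sup>2)"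
proof -
  have "1 + r\<^sup>2 > 0" by (simp add: add_pos_nonneg)
  then have s: "sqrt (1 + r\<^sup>2) * sqrt (1 + r\<^sup>2) = 1 + r\<^sup>2" by simp
  show "sin (2 * arctan r) = 2 * r / (1 + r\<^sup>2)" "cos (2 * arctan r) = (1 - r\<^sup>2) / (1 + r\<^sup>2)"
    using s by (simp_all add: sin_double cos_double sin_arctan cos_arctan power_divide diff_divide_distrib)
qed

lemma S3_inner_bounds: "x \<in> sphere 0 1 \<Longrightarrow> y \<in> sphere 0 1 \<Longrightarrow> -1 \<le> x \<bullet> y \<and> x \<bullet> y \<le> 1"
  for x y :: "real^4"
  using Cauchy_Schwarz_ineq2[of x y] by (auto simp: abs_le_iff)

interpretation S3: charted_quadric 1 "(\<bullet>)" "sphere 0 1" cos sin arccos_clamped "{0..pi}"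
  S3_chart S3_chart_deriv stereographic "\<lambda>z. frechet_derivative stereographic (at z)" "{z. z$1 \<noteq> -1}"
  "\<lambda>r. 8 / (1 + r\<^sup>2) ^ 3" "\<lambda>r. 2 * arctan r"
proof (intro charted_quadric.intro unit_quadric.intro charted_quadric_axioms.intro)
  fix x y u v z :: "real^4" and w :: "real^3" and t r :: real
  show "x \<bullet> y = 1 * (x$1 * y$1) + x$2 * y$2 + x$3 * y$3 + x$4 * y$4" by (simp add: inner_4)
  show "x \<in> sphere 0 1 \<longleftrightarrow> x \<bullet> x = 1 \<and> ((1::real) = -1 \<longrightarrow> 0 < x$1)" by (simp add: norm_eq_1)
  show "(cos has_real_derivative - 1 * sin t) (at t)" "(sin has_real_derivative cos t) (at t)"
    by (auto intro!: derivative_eq_intros)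
  show "cos t *\<^sub>R x + sin t *\<^sub>R v \<in> sphere 0 1" if "x \<in> sphere 0 1" "x \<bullet> v = 0" "v \<bullet> v = 1"
    using that by (simp add: norm_eq_1 inner_add_left inner_add_right inner_commute[of v x] power2_eq_square[symmetric] del: power2_eq_square)
  show "cos (arccos_clamped (1 * (x \<bullet> y))) = 1 * (x \<bullet> y)" if "x \<in> sphere 0 1" "y \<in> sphere 0 1"
    using S3_inner_bounds[OF that] by (simp add: arccos_clamped)
  show "arccos_clamped (1 * (x \<bullet> y)) \<in> {0..pi}"
    by (simp add: arccos_clamped_def arccos_lbound arccos_ubound)
  show "(arccos_clamped has_real_derivative - 1 / sin t) (at (cos t))" if t: "t \<in> {0..pi}" "sin t \<noteq> 0"
  proof -
    have s: "0 < sin t" using t sin_ge_zero[of t] by auto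
    have c: "-1 < cos t" "cos t < 1"
    proof -
      have "(cos t)\<^sup>2 < 1" using s sin_cos_squared_add[of t] zero_less_power[OF s, of 2] by linarith
      then have "\<bar>cos t\<bar> < 1" by (simp add: abs_square_less_1)
      then show "-1 < cos t" "cos t < 1" by auto
    qed
    have "(arccos has_real_derivative - 1 / sin t) (at (cos t))"
    proof -
      have "sqrt (1 - (cos t)\<^sup>2) = sin t" using s by (simp add: sin_squared_eq[symmetric])
      then show ?thesis using DERIV_arccos[OF c] by (simp add: divide_inverse)
    qed
    then show ?thesis
      by (rule has_field_derivative_transform_within_open[where S = "{-1<..<1}"]) (use c in \<open>auto simp: arccos_clamped\<close>)
  qed
  show "continuous_on UNIV arccos_clamped"
    unfolding arccos_clamped_def[abs_def] by (intro continuous_intros) auto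
  have w: "1 + w \<bullet> w > 0" using inner_ge_zero[of w] by linarith
  show "(S3_chart has_derivative S3_chart_deriv w) (at w)" by (rule S3_chart_has_derivative)
  have ww: "S3_chart w \<bullet> S3_chart w = 1"
  proof -
    define q where "q = w \<bullet> w"
    have "vector [1 - q, 2 * w$1, 2 * w$2, 2 * w$3] \<bullet> (vector [1 - q, 2 * w$1, 2 * w$2, 2 * w$3] :: real^4)
        = (1 - q) * (1 - q) + 4 * (w \<bullet> w)"
      by (simp add: inner_4 inner_3)
    also have "\<dots> = (1 + q) * (1 + q)" unfolding q_def[symmetric] by (simp add: algebra_simps)
    finally show ?thesis using w by (simp add: S3_chart_def q_def[symmetric])
  qed
  have w1: "S3_chart w $ 1 = (1 - w \<bullet> w) / (1 + w \<bullet> w)" by (simp add: S3_chart_def)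
  have w1': "1 + S3_chart w $ 1 = 2 / (1 + w \<bullet> w)" unfolding w1 using w by (simp add: field_simps)
  show "S3_chart w \<in> sphere 0 1 \<inter> {z. z$1 \<noteq> -1}"
    using ww w1' w by (auto simp: norm_eq_1)
  show "stereographic (S3_chart w) = w"
    unfolding stereographic_def w1' using w by (simp add: vec_eq_iff forall_3 S3_chart_def)
  show "(stereographic has_derivative frechet_derivative stereographic (at z)) (at z)" if "z \<in> {z. z$1 \<noteq> -1}"
  proof -
    have z: "1 + z$1 \<noteq> 0" using that by (auto simp: add_eq_0_iff)
    have "\<exists>f'. (stereographic has_derivative f') (at z)"
      unfolding stereographic_def[abs_def] vector_3_axis
      by (rule exI, (rule derivative_intros refl bounded_linear_imp_has_derivative[OF bounded_linear_vec_nth] | rule z)+)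
    then have "stereographic differentiable (at z)" by (simp add: differentiable_def)
    then show ?thesis by (rule frechet_derivative_works[THEN iffD1])
  qed
  show "S3_chart (stereographic z) = z" if "z \<in> sphere 0 1 \<inter> {z. z$1 \<noteq> -1}"
  proof -
    have z: "1 + z$1 \<noteq> 0" and zz: "z$1 * z$1 + z$2 * z$2 + z$3 * z$3 + z$4 * z$4 = 1"
      using that by (auto simp: add_eq_0_iff norm_eq_1 inner_4)
    have "stereographic z \<bullet> stereographic z = (1 - z$1 * z$1) / (1 + z$1)\<^sup>2"
      using zz by (simp add: stereographic_def inner_3 power2_eq_square add_divide_distrib[symmetric])
    also have "1 - z$1 * z$1 = (1 - z$1) * (1 + z$1)" by (simp add: algebra_simps)
    also have "\<dots> / (1 + z$1)\<^sup>2 = (1 - z$1) / (1 + z$1)"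
      using z by (simp add: power2_eq_square)
    finally have q: "stereographic z \<bullet> stereographic z = (1 - z$1) / (1 + z$1)" .
    have q1: "1 / (1 + (1 - z$1) / (1 + z$1)) = (1 + z$1) / 2" using z by (simp add: field_simps)
    have q2: "1 - (1 - z$1) / (1 + z$1) = 2 * z$1 / (1 + z$1)" using z by (simp add: field_simps)
    show ?thesis
      unfolding S3_chart_def q q1 q2 using z
      by (simp add: vec_eq_iff forall_4 stereographic_def)
  qed
  show "open {z::real^4. z$1 \<noteq> -1}" by (intro open_Collect_neq continuous_intros)
  show "finite (sphere 0 1 - {z::real^4. z$1 \<noteq> -1})"
  proof (rule finite_subset[of _ "{axis 1 (-1)}"], intro subsetI)
    fix z :: "real^4" assume "z \<in> sphere 0 1 - {z. z$1 \<noteq> -1}"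
    then have z1: "z$1 = -1" and zz: "z$2 * z$2 + z$3 * z$3 + z$4 * z$4 = 0" by (auto simp: norm_eq_1 inner_4)
    have "0 \<le> z$2 * z$2" "0 \<le> z$3 * z$3" "0 \<le> z$4 * z$4" by auto
    then have "z$2 * z$2 = 0" "z$3 * z$3 = 0" "z$4 * z$4 = 0" using zz by linarith+
    then show "z \<in> {axis 1 (-1)}" using z1 by (simp add: vec_eq_iff forall_4 axis_def)
  qed simp
  show "sqrt (det (gram (\<bullet>) S3_chart w)) = 8 / (1 + (norm w)\<^sup>2) ^ 3"
  proof -
    have gram: "gram (\<bullet>) S3_chart w = (\<chi> i j. 4 / (1 + w \<bullet> w)\<^sup>2 * (axis i 1 \<bullet> (axis j 1 :: real^3)) - 0 * (w $ i * w $ j))"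
      by (simp add: gram_def frechet_derivative_at[OF S3_chart_has_derivative, symmetric] S3_chart_metric)
    have "det (gram (\<bullet>) S3_chart w) = (4 / (1 + w \<bullet> w)\<^sup>2) ^ 3 - (4 / (1 + w \<bullet> w)\<^sup>2)\<^sup>2 * 0 * (w \<bullet> w)"
      unfolding gram by (rule det_axis_gram)
    also have "\<dots> = (4 / (1 + w \<bullet> w)\<^sup>2) ^ 3" by simp
    also have "\<dots> = (8 / (1 + w \<bullet> w) ^ 3)\<^sup>2" by (simp add: power_divide power_mult[symmetric])
    finally show ?thesis using w by (simp add: power2_norm_eq_inner)
  qed
  show "arccos_clamped (1 * (axis 1 1 \<bullet> S3_chart w)) = 2 * arctan (norm w)"
  proof -
    have "axis 1 1 \<bullet> S3_chart w = cos (2 * arctan (norm w))"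
      by (simp add: inner_axis' w1 cos_2_arctan power2_norm_eq_inner)
    moreover have "0 \<le> 2 * arctan (norm w)" "2 * arctan (norm w) \<le> pi"
      using arctan_ubound[of "norm w"] by auto
    ultimately show ?thesis by (simp add: arccos_clamped arccos_cos)
  qed
  show "0 < 8 / (1 + r\<^sup>2) ^ 3" by (simp add: add_pos_nonneg)
  show "0 < v \<bullet> v" if "v \<noteq> 0" using that by simp
  show "(\<lambda>r::real. 8 / (1 + r\<^sup>2) ^ 3) \<in> borel_measurable borel" by measurable
  show "(\<lambda>r. 2 * arctan r) \<in> borel_measurable borel" by measurable
  show "closed (sphere (0::real^4) 1)" by (rule closed_sphere)
qed simp_all

text \<open>
  The derivative of the kernel on the open interval from 0 to \<open>\<pi>\<close>.  At \<open>\<pi>\<close> the quotient has the value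
  0, which is its limit.
\<close>

definition S3_slope :: "real \<Rightarrow> real" where
  "S3_slope \<alpha> = (sin \<alpha> + (pi - \<alpha>) * cos \<alpha>) / (4 * pi\<^sup>2 * (sin \<alpha>)\<^sup>2)"

lemma S3_slope_pi_minus: "S3_slope (pi - \<beta>) = (sin \<beta> - \<beta> * cos \<beta>) / (4 * pi\<^sup>2 * (sin \<beta>)\<^sup>2)"
  by (simp add: S3_slope_def)

lemma sin_minus_mult_cos_nonneg:
  fixes \<beta> :: real
  assumes "0 \<le> \<beta>" "\<beta> \<le> pi"
  shows "0 \<le> sin \<beta> - \<beta> * cos \<beta>"
proof -
  have deriv: "((\<lambda>\<beta>. sin \<beta> - \<beta> * cos \<beta>) has_real_derivative x * sin x) (at x)" for x :: real
    by (auto intro!: derivative_eq_intros)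
  have "sin 0 - 0 * cos 0 \<le> sin \<beta> - \<beta> * cos \<beta>"
  proof (rule DERIV_nonneg_imp_nondecreasing[OF assms(1)])
    fix x assume "0 \<le> x" "x \<le> \<beta>"
    then have "0 \<le> x * sin x" using assms by (intro mult_nonneg_nonneg sin_ge_zero) auto
    then show "\<exists>y. ((\<lambda>\<beta>. sin \<beta> - \<beta> * cos \<beta>) has_real_derivative y) (at x) \<and> 0 \<le> y"
      using deriv by blast
  qed
  then show ?thesis by simp
qed

lemma S3_slope_nonneg: "0 \<le> \<alpha> \<Longrightarrow> \<alpha> \<le> pi \<Longrightarrow> 0 \<le> S3_slope \<alpha>"
  using S3_slope_pi_minus[of "pi - \<alpha>"] sin_minus_mult_cos_nonneg[of "pi - \<alpha>"] by simp

text \<open>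
  In the variable $\beta = \pi - \alpha$ the slope is a multiple of
  $(\sin\beta - \beta\cos\beta) / \sin^2\beta$.  Its derivative is a positive multiple of
  $\beta(1 + \cos^2\beta) - 2\sin\beta\cos\beta$.  This is nonnegative: clearly so if
  $\cos\beta \le 0$, and otherwise by $\sin\beta \le \beta$ and $2\cos\beta \le 1 + \cos^2\beta$.
\<close>

lemma S3_slope_antimono:
  assumes "0 < r" "r \<le> R" "R \<le> pi"
  shows "S3_slope R \<le> S3_slope r"
proof (cases "R = pi")
  case True
  then show ?thesis using S3_slope_nonneg[of r] assms by (simp add: S3_slope_def[of pi])
next
  case False
  define b c where "b = pi - R" and "c = pi - r"
  have bc: "0 < b" "b \<le> c" "c < pi" using assms False by (auto simp: b_def c_def)
  define f where "f x = (sin x - x * cos x) / (4 * pi\<^sup>2 * (sin x)\<^sup>2)" for x :: real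
  have "\<exists>y. (f has_real_derivative y) (at x) \<and> 0 \<le> y" if x: "b \<le> x" "x \<le> c" for x
  proof (intro exI conjI)
    have s: "0 < sin x" using bc x by (intro sin_gt_zero) auto
    have "((\<lambda>x. sin x - x * cos x) has_real_derivative x * sin x) (at x)"
      by (auto intro!: derivative_eq_intros)
    moreover have "((\<lambda>x. 4 * pi\<^sup>2 * (sin x)\<^sup>2) has_real_derivative 4 * pi\<^sup>2 * (2 * sin x * cos x)) (at x)"
      by (auto intro!: derivative_eq_intros)
    ultimately show "(f has_real_derivative
        (x * sin x * (4 * pi\<^sup>2 * (sin x)\<^sup>2) - (sin x - x * cos x) * (4 * pi\<^sup>2 * (2 * sin x * cos x))) /
        (4 * pi\<^sup>2 * (sin x)\<^sup>2 * (4 * pi\<^sup>2 * (sin x)\<^sup>2))) (at x)"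
      unfolding f_def[abs_def] by (rule DERIV_divide) (use s in simp)
    have "0 \<le> x * (1 + (cos x)\<^sup>2) - 2 * sin x * cos x"
    proof (cases "0 \<le> cos x")
      case True
      have "sin x \<le> x" using bc x by (intro sin_x_le_x) auto
      then have "2 * sin x * cos x \<le> x * (2 * cos x)"
        using mult_right_mono[OF _ True, of "sin x" x] by simp
      also have "\<dots> \<le> x * (1 + (cos x)\<^sup>2)"
        using bc x sum_squares_bound[of 1 "cos x"] by (intro mult_left_mono) auto
      finally show ?thesis by simp
    next
      case False
      then have "sin x * cos x \<le> 0" using s by (simp add: mult_le_0_iff)
      moreover have "0 \<le> x * (1 + (cos x)\<^sup>2)" using bc x by (intro mult_nonneg_nonneg) auto
      ultimately show ?thesis by linarith
    qed
    then have "0 \<le> 4 * pi\<^sup>2 * sin x * (x * (1 + (cos x)\<^sup>2) - 2 * sin x * cos x)"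
      using s by (intro mult_nonneg_nonneg) auto
    also have "\<dots> = x * sin x * (4 * pi\<^sup>2 * (sin x)\<^sup>2) - (sin x - x * cos x) * (4 * pi\<^sup>2 * (2 * sin x * cos x))"
      by (simp add: sin_squared_eq) (simp add: power2_eq_square algebra_simps)
    finally show "0 \<le> (x * sin x * (4 * pi\<^sup>2 * (sin x)\<^sup>2) - (sin x - x * cos x) * (4 * pi\<^sup>2 * (2 * sin x * cos x))) /
        (4 * pi\<^sup>2 * (sin x)\<^sup>2 * (4 * pi\<^sup>2 * (sin x)\<^sup>2))"
      by (intro divide_nonneg_nonneg) auto
  qed
  then have "f b \<le> f c" by (intro DERIV_nonneg_imp_nondecreasing[OF bc(2)]) auto
  then show ?thesis
    using S3_slope_pi_minus[of b] S3_slope_pi_minus[of c] by (simp add: f_def b_def c_def)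
qed

lemma S3_kernel_deriv:
  assumes "0 < r" "r < pi"
  shows "(S3_kernel has_real_derivative S3_slope r) (at r)"
proof (rule has_field_derivative_transform_within_open[where S = "{0<..<pi}"])
  have s: "0 < sin r" using assms by (intro sin_gt_zero) auto
  have "((\<lambda>\<alpha>. (pi - \<alpha>) / sin \<alpha>) has_real_derivative (- 1 * sin r - (pi - r) * cos r) / (sin r * sin r)) (at r)"
    using s by (intro DERIV_divide) (auto intro!: derivative_eq_intros)
  from DERIV_cmult[OF this, of "- 1 / (4 * pi\<^sup>2)"]
  show "((\<lambda>\<alpha>. - 1 / (4 * pi\<^sup>2) * ((pi - \<alpha>) / sin \<alpha>)) has_real_derivative S3_slope r) (at r)"
    by (rule DERIV_cong) (use s in \<open>simp add: S3_slope_def power2_eq_square field_simps\<close>)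
qed (use assms in \<open>auto simp: S3_kernel_def\<close>)

definition S3_ball_volume :: "real \<Rightarrow> real" where
  "S3_ball_volume R = pi * (2 * R - sin (2 * R))"

lemma S3_ball_volume_deriv: "(S3_ball_volume has_real_derivative 4 * pi * (sin R)\<^sup>2) (at R)"
proof -
  have "(S3_ball_volume has_real_derivative pi * (2 - 2 * cos (2 * R))) (at R)"
    unfolding S3_ball_volume_def[abs_def] by (auto intro!: derivative_eq_intros)
  then show ?thesis by (rule DERIV_cong) (simp add: cos_double_sin)
qed

lemma N_S3_deriv: "(N_S3 has_real_derivative (sin R + (pi - R) * cos R) / pi) (at R)"
  unfolding N_S3_def[abs_def] by (auto intro!: derivative_eq_intros simp: field_simps)

lemma double_arctan_deriv: "((\<lambda>r. 2 * arctan r) has_real_derivative 2 / (1 + r\<^sup>2)) (at r)"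
  by (auto intro!: derivative_eq_intros simp: divide_inverse)

lemma S3_biot_savart:
  "biot_savart_space S3 {0..pi} S3_ball_volume N_S3 S3_slope (\<lambda>x y. arccos_clamped (1 * (x \<bullet> y)))"
proof (rule S3.biot_savart[where M = S3 and F = S3_ball_volume and N = N_S3 and s = S3_slope and \<phi> = S3_kernel and c = 2])
  have p: "0 < 1 + r\<^sup>2" for r :: real by (simp add: add_pos_nonneg)
  have at: "0 \<le> 2 * arctan r" "2 * arctan r \<le> pi" if "0 \<le> r" for r
    using that arctan_ubound[of r] by auto
  show "distance S3 x y = arccos_clamped (1 * (x \<bullet> y))" if "x \<in> sphere 0 1" "y \<in> sphere 0 1" for x y
    using S3_inner_bounds[OF that] by (simp add: S3_def S3_distance_def arccos_clamped)
  show "2 * arctan r \<in> {0..pi}" if "0 \<le> r" for r using at[OF that] by simp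
  show "sin (2 * arctan r) \<noteq> 0" if "0 < r" for r
    unfolding sin_2_arctan using p[of r] that by simp
  show "continuous_on {0..pi} S3_ball_volume"
    by (rule DERIV_continuous_on[OF has_field_derivative_at_within[OF S3_ball_volume_deriv]])
  show "strict_mono_on {0..pi} S3_ball_volume"
  proof (rule strict_mono_onI)
    fix r R :: real assume r: "r \<in> {0..pi}" "R \<in> {0..pi}" "r < R"
    show "S3_ball_volume r < S3_ball_volume R"
    proof (rule DERIV_pos_imp_increasing_open[OF r(3)])
      fix x assume "r < x" "x < R"
      then have "0 < sin x" using r by (intro sin_gt_zero) auto
      then have "0 < 4 * pi * (sin x)\<^sup>2" by simp
      then show "\<exists>y. (S3_ball_volume has_real_derivative y) (at x) \<and> 0 < y"
        using S3_ball_volume_deriv by blast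
    qed (rule DERIV_continuous_on[OF has_field_derivative_at_within[OF S3_ball_volume_deriv]])
  qed
  show F: "((\<lambda>r. S3_ball_volume (2 * arctan r)) has_real_derivative 4 * pi * r\<^sup>2 * (8 / (1 + r\<^sup>2) ^ 3)) (at r)" for r
    using DERIV_chain2[OF S3_ball_volume_deriv double_arctan_deriv]
    by (rule DERIV_cong) (simp add: sin_2_arctan power_divide power2_eq_square power3_eq_cube)
  have N: "((\<lambda>r. N_S3 (2 * arctan r)) has_real_derivative
      (sin (2 * arctan r) + (pi - 2 * arctan r) * cos (2 * arctan r)) / pi * (2 / (1 + r\<^sup>2))) (at r)" for r
    by (rule DERIV_chain2[OF N_S3_deriv double_arctan_deriv])
  show "((\<lambda>r. N_S3 (2 * arctan r)) has_real_derivative 4 * pi * r\<^sup>2 * (8 / (1 + r\<^sup>2) ^ 3) * S3_slope (2 * arctan r)) (at r)"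
    if r: "0 < r" for r
  proof (rule DERIV_cong[OF N])
    define X where "X = sin (2 * arctan r) + (pi - 2 * arctan r) * cos (2 * arctan r)"
    have sq: "(sin (2 * arctan r))\<^sup>2 = 4 * r\<^sup>2 / (1 + r\<^sup>2)\<^sup>2"
      by (simp add: sin_2_arctan power_divide power_mult_distrib)
    have cancel: "X / pi * (2 / q) = 4 * pi * r\<^sup>2 * (8 / q ^ 3) * (X / (4 * pi\<^sup>2 * (4 * r\<^sup>2 / q\<^sup>2)))"
      if "0 < q" for q
      using r that by (simp add: power2_eq_square power3_eq_cube field_simps)
    show "(sin (2 * arctan r) + (pi - 2 * arctan r) * cos (2 * arctan r)) / pi * (2 / (1 + r\<^sup>2)) =
        4 * pi * r\<^sup>2 * (8 / (1 + r\<^sup>2) ^ 3) * S3_slope (2 * arctan r)"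
      unfolding S3_slope_def sq X_def[symmetric] by (rule cancel[OF p])
  qed
  show "((\<lambda>r. N_S3 (2 * arctan r)) has_real_derivative 2) (at 0)"
    using N[of 0] by simp
  show "0 \<le> N_S3 R" if "R \<in> {0..pi}" for R
    using that sin_ge_zero[of R] by (auto simp: N_S3_def intro!: divide_nonneg_nonneg add_nonneg_nonneg mult_nonneg_nonneg)
  \<comment> \<open>The ball of radius \<open>R\<close> is \<open>r \<le> tan (R / 2)\<close> in the stereographic chart; for \<open>R = \<pi>\<close> it is the whole chart, and the integral is a limit.\<close>
  show "(\<exists>a\<ge>0. 2 * arctan a = R \<and> (\<forall>r\<ge>0. 2 * arctan r \<le> R \<longleftrightarrow> r \<le> a)) \<or>
      (\<forall>r\<ge>0. 2 * arctan r \<le> R) \<and> ((\<lambda>r. S3_ball_volume (2 * arctan r)) \<longlongrightarrow> S3_ball_volume R) at_top \<and>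
      ((\<lambda>r. N_S3 (2 * arctan r)) \<longlongrightarrow> N_S3 R) at_top" if R: "R \<in> {0..pi}" for R
  proof (cases "R = pi")
    case True
    have lim: "((\<lambda>r. 2 * arctan r) \<longlongrightarrow> pi) at_top"
      using tendsto_mult[OF tendsto_const[of 2] tendsto_arctan_at_top] by simp
    have "((\<lambda>r. f (2 * arctan r)) \<longlongrightarrow> f pi) at_top" if "isCont f pi" for f :: "real \<Rightarrow> real"
      using isCont_tendsto_compose[OF that lim] .
    then show ?thesis
      using True at DERIV_isCont[OF S3_ball_volume_deriv] DERIV_isCont[OF N_S3_deriv] by auto
  next
    case False
    then have h: "0 \<le> R / 2" "R / 2 < pi / 2" using R by auto
    have a: "arctan (tan (R / 2)) = R / 2" using h by (intro arctan_tan) auto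
    have "0 \<le> tan (R / 2)" using h by (cases "R = 0") (auto intro!: less_imp_le tan_gt_zero)
    moreover have "2 * arctan r \<le> R \<longleftrightarrow> r \<le> tan (R / 2)" for r
      using a arctan_le_iff[of r "tan (R / 2)"] by auto
    ultimately show ?thesis using a by (intro disjI1 exI[of _ "tan (R / 2)"]) auto
  qed
  show "S3_slope \<in> borel_measurable borel" unfolding S3_slope_def[abs_def] by measurable
  show "(S3_kernel has_real_derivative S3_slope r) (at r)" if "r \<in> {0..pi}" "sin r \<noteq> 0" for r
    using that by (intro S3_kernel_deriv) (auto simp: le_less)
qed (auto simp: S3_def N_S3_def S3_ball_volume_def intro: S3_slope_nonneg S3_slope_antimono)

section \<open>Hyperbolic 3-space\<close>

definition H3_chart_deriv :: "real^3 \<Rightarrow> real^3 \<Rightarrow> real^4" where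
  "H3_chart_deriv u v = vector [(u \<bullet> v) / sqrt (1 + u \<bullet> u), v$1, v$2, v$3]"

lemma H3_chart_has_derivative: "(H3_chart has_derivative H3_chart_deriv u) (at u)"
proof -
  have pos: "0 < 1 + u \<bullet> u" using inner_ge_zero[of u] by linarith
  have comp: "((\<lambda>u. u $ i) has_derivative (\<lambda>v. v $ i)) (at u)" for i
    by (rule bounded_linear_imp_has_derivative[OF bounded_linear_vec_nth])
  have "((\<lambda>u. 1 + u \<bullet> u) has_derivative (\<lambda>v. 2 * (u \<bullet> v))) (at u)"
    by (auto intro!: derivative_eq_intros simp: inner_commute)
  from has_derivative_compose[OF this DERIV_real_sqrt[OF pos, unfolded has_field_derivative_def]]
  have sqrt: "((\<lambda>u. sqrt (1 + u \<bullet> u)) has_derivative (\<lambda>v. (u \<bullet> v) / sqrt (1 + u \<bullet> u))) (at u)"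
    by (simp add: field_simps)
  show ?thesis
    unfolding H3_chart_def[abs_def] H3_chart_deriv_def[abs_def] vector_4_axis
    by (intro has_derivative_add has_derivative_scaleR_left comp sqrt)
qed

lemma H3_chart_metric:
  "lorentz (H3_chart_deriv u v) (H3_chart_deriv u w) = v \<bullet> w - (u \<bullet> v) * (u \<bullet> w) / (1 + u \<bullet> u)"
proof -
  have "0 < 1 + u \<bullet> u" using inner_ge_zero[of u] by linarith
  then have "sqrt (1 + u \<bullet> u) * sqrt (1 + u \<bullet> u) = 1 + u \<bullet> u" by simp
  then show ?thesis by (simp add: lorentz_def H3_chart_deriv_def inner_3[of v w])
qed

text \<open>
  Clamped for the same reason as the arc cosine: continuity on the whole line.
\<close>

definition arcosh_clamped :: "real \<Rightarrow> real" where
  "arcosh_clamped s = arcosh (max 1 s)"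

definition space_part :: "real^4 \<Rightarrow> real^3" where
  "space_part z = vector [z$2, z$3, z$4]"

lemma lorentz_space_part: "lorentz x y = space_part x \<bullet> space_part y - x$1 * y$1"
  by (simp add: lorentz_def space_part_def inner_3)

lemma hyperboloid_norm: "x \<in> hyperboloid \<Longrightarrow> (x$1)\<^sup>2 = 1 + (norm (space_part x))\<^sup>2"
  unfolding power2_norm_eq_inner by (simp add: hyperboloid_def lorentz_space_part power2_eq_square)

text \<open>
  The reversed Cauchy-Schwarz inequality for timelike vectors.
\<close>

lemma hyperboloid_inner:
  assumes x: "x \<in> hyperboloid" and y: "y \<in> hyperboloid"
  shows "1 \<le> - lorentz x y"
proof -
  define a b where "a = norm (space_part x)" and "b = norm (space_part y)"
  have x1: "0 < x$1" "(x$1)\<^sup>2 = 1 + a\<^sup>2" and y1: "0 < y$1" "(y$1)\<^sup>2 = 1 + b\<^sup>2"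
    using x y hyperboloid_norm by (auto simp: hyperboloid_def a_def b_def)
  have "space_part x \<bullet> space_part y \<le> a * b"
    unfolding a_def b_def by (rule norm_cauchy_schwarz)
  moreover have "1 + a * b \<le> x$1 * y$1"
  proof (rule power2_le_imp_le)
    have "(1 + a * b)\<^sup>2 \<le> (1 + a\<^sup>2) * (1 + b\<^sup>2)"
      using zero_le_power2[of "a - b"] by (simp add: power2_eq_square algebra_simps)
    then show "(1 + a * b)\<^sup>2 \<le> (x$1 * y$1)\<^sup>2" by (simp add: power_mult_distrib x1 y1)
    show "0 \<le> x$1 * y$1" using x1 y1 by simp
  qed
  ultimately show ?thesis by (simp add: lorentz_space_part)
qed

text \<open>
  The Cauchy-Schwarz inequality for the space parts; it shows that tangent vectors are spacelike.
\<close>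

lemma hyperboloid_tangent:
  assumes x: "x \<in> hyperboloid" and v: "lorentz x v = 0"
  shows "(v$1)\<^sup>2 * (x$1)\<^sup>2 \<le> ((x$1)\<^sup>2 - 1) * (norm (space_part v))\<^sup>2"
proof -
  have "x$1 * v$1 = space_part x \<bullet> space_part v" using v by (simp add: lorentz_space_part)
  then have "(x$1 * v$1)\<^sup>2 \<le> (norm (space_part x) * norm (space_part v))\<^sup>2"
    using Cauchy_Schwarz_ineq2[of "space_part x" "space_part v"]
    by (metis abs_le_square_iff abs_mult abs_norm_cancel)
  then show ?thesis by (simp add: power_mult_distrib hyperboloid_norm[OF x] mult.commute)
qed

lemma arsinh_nonneg: "0 \<le> r \<Longrightarrow> 0 \<le> arsinh r" for r :: real
  by (cases "r = 0") (auto simp: le_less)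

interpretation H3: charted_quadric "-1" lorentz hyperboloid cosh sinh arcosh_clamped "{0..}"
  H3_chart H3_chart_deriv space_part "\<lambda>_. space_part" UNIV "\<lambda>r. 1 / sqrt (1 + r\<^sup>2)" arsinh
proof (intro charted_quadric.intro unit_quadric.intro charted_quadric_axioms.intro)
  fix x y v z :: "real^4" and w :: "real^3" and t r :: real
  show "lorentz x y = - 1 * (x$1 * y$1) + x$2 * y$2 + x$3 * y$3 + x$4 * y$4" by (simp add: lorentz_def)
  show "x \<in> hyperboloid \<longleftrightarrow> lorentz x x = -1 \<and> ((-1::real) = -1 \<longrightarrow> 0 < x$1)" by (simp add: hyperboloid_def)
  show "0 < lorentz v v" if x: "x \<in> hyperboloid" and v: "lorentz x v = 0" "v \<noteq> 0"
  proof -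
    define n where "n = (norm (space_part v))\<^sup>2"
    have x1: "1 \<le> (x$1)\<^sup>2" using hyperboloid_norm[OF x] by simp
    have le: "(v$1)\<^sup>2 * (x$1)\<^sup>2 \<le> ((x$1)\<^sup>2 - 1) * n"
      using hyperboloid_tangent[OF x v(1)] by (simp add: n_def)
    have n: "0 < n"
    proof (rule ccontr)
      assume "\<not> 0 < n"
      then have n0: "n = 0" by (simp add: n_def)
      then have "(v$1)\<^sup>2 * (x$1)\<^sup>2 \<le> 0" using le by simp
      then have "v$1 = 0" using x1 by (auto simp: mult_le_0_iff)
      moreover have "space_part v = 0" using n0 by (simp add: n_def)
      ultimately have "v = 0" by (simp add: space_part_def vec_eq_iff forall_3 forall_4)
      then show False using v by simp
    qed
    have "(v$1)\<^sup>2 * (x$1)\<^sup>2 < n * (x$1)\<^sup>2" using le n by (simp add: algebra_simps)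
    then have "(v$1)\<^sup>2 < n" using x1 by (simp add: mult_less_cancel_right)
    then show ?thesis
      unfolding n_def power2_norm_eq_inner by (simp add: lorentz_space_part power2_eq_square)
  qed
  show "(cosh has_real_derivative - (-1) * sinh t) (at t)" "(sinh has_real_derivative cosh t) (at t)"
    by (auto intro!: derivative_eq_intros)
  show "(cosh t)\<^sup>2 + - 1 * (sinh t)\<^sup>2 = 1" by (simp add: cosh_square_eq)
  show "cosh t *\<^sub>R x + sinh t *\<^sub>R v \<in> hyperboloid"
    if x: "x \<in> hyperboloid" and v: "lorentz x v = 0" "lorentz v v = 1"
  proof -
    have xx: "lorentz x x = -1" "0 < x$1" using x by (auto simp: hyperboloid_def)
    have "lorentz (cosh t *\<^sub>R x + sinh t *\<^sub>R v) (cosh t *\<^sub>R x + sinh t *\<^sub>R v)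
        = (cosh t)\<^sup>2 * lorentz x x + 2 * (cosh t * sinh t) * lorentz x v + (sinh t)\<^sup>2 * lorentz v v"
      by (simp add: lorentz_def power2_eq_square algebra_simps)
    also have "\<dots> = -1" by (simp add: xx v cosh_square_eq)
    finally have q: "lorentz (cosh t *\<^sub>R x + sinh t *\<^sub>R v) (cosh t *\<^sub>R x + sinh t *\<^sub>R v) = -1" .
    have n: "(norm (space_part v))\<^sup>2 = 1 + (v$1)\<^sup>2"
      unfolding power2_norm_eq_inner using v(2) by (simp add: lorentz_space_part power2_eq_square)
    have "(v$1)\<^sup>2 * (x$1)\<^sup>2 \<le> ((x$1)\<^sup>2 - 1) * (1 + (v$1)\<^sup>2)"
      using hyperboloid_tangent[OF x v(1)] by (simp add: n)
    then have "\<bar>v$1\<bar>\<^sup>2 < (x$1)\<^sup>2" by (simp add: algebra_simps)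
    then have v1: "\<bar>v$1\<bar> < x$1" by (rule power2_less_imp_less) (use xx(2) in simp)
    have "\<bar>sinh t\<bar> < cosh t"
    proof (rule power2_less_imp_less)
      show "\<bar>sinh t\<bar>\<^sup>2 < (cosh t)\<^sup>2" by (simp add: cosh_square_eq)
    qed simp
    from mult_strict_mono'[OF this v1] have "\<bar>sinh t * v$1\<bar> < cosh t * x$1" by (simp add: abs_mult)
    then have "0 < cosh t * x$1 + sinh t * v$1" by linarith
    then show ?thesis using q by (simp add: hyperboloid_def)
  qed
  show "cosh (arcosh_clamped (- 1 * lorentz x y)) = - 1 * lorentz x y" if "x \<in> hyperboloid" "y \<in> hyperboloid"
    using hyperboloid_inner[OF that] by (simp add: arcosh_clamped_def)
  show "arcosh_clamped (- 1 * lorentz x y) \<in> {0..}" by (simp add: arcosh_clamped_def)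
  show "(arcosh_clamped has_real_derivative - (-1) / sinh t) (at (cosh t))" if t: "t \<in> {0..}" "sinh t \<noteq> 0"
  proof (rule has_field_derivative_transform_within_open[where S = "{1<..}"])
    have t0: "0 < t" using t by (cases "t = 0") auto
    then have s: "0 < sinh t" by simp
    show c: "cosh t \<in> {1<..}" using t0 cosh_real_strict_mono[of 0 t] by simp
    have "sqrt ((cosh t)\<^sup>2 - 1) = sinh t" using s by (simp add: cosh_square_eq)
    then show "(arcosh has_real_derivative - (-1) / sinh t) (at (cosh t))"
      using arcosh_real_has_field_derivative[of "cosh t" UNIV] c by simp
  qed (auto simp: arcosh_clamped_def)
  show "continuous_on UNIV arcosh_clamped"
    unfolding arcosh_clamped_def[abs_def] by (intro continuous_intros) auto
  have w: "0 < 1 + w \<bullet> w" using inner_ge_zero[of w] by linarith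
  show "(H3_chart has_derivative H3_chart_deriv w) (at w)" by (rule H3_chart_has_derivative)
  show "H3_chart w \<in> hyperboloid \<inter> UNIV"
    using w by (simp add: hyperboloid_def lorentz_def H3_chart_def inner_3)
  show "(space_part has_derivative space_part) (at z)"
    by (intro bounded_linear_imp_has_derivative linear_conv_bounded_linear[THEN iffD1])
      (simp add: linear_iff space_part_def vec_eq_iff forall_3)
  show "space_part (H3_chart w) = w" by (simp add: space_part_def H3_chart_def vec_eq_iff forall_3)
  show "H3_chart (space_part z) = z" if "z \<in> hyperboloid \<inter> UNIV"
  proof -
    have z: "z \<in> hyperboloid" "0 < z$1" using that by (auto simp: hyperboloid_def)
    have "1 + space_part z \<bullet> space_part z = (z$1)\<^sup>2"
      using hyperboloid_norm[OF z(1)] by (simp add: power2_norm_eq_inner)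
    then have "sqrt (1 + space_part z \<bullet> space_part z) = z$1" using z(2) by simp
    then show ?thesis by (simp add: H3_chart_def vec_eq_iff forall_4) (simp add: space_part_def)
  qed
  show "closed hyperboloid"
  proof -
    have eq: "hyperboloid = {x. lorentz x x = -1} \<inter> {x. 0 \<le> x$1}"
    proof (intro equalityI subsetI)
      fix x assume x: "x \<in> {x. lorentz x x = -1} \<inter> {x. 0 \<le> x$1}"
      have "x$1 \<noteq> 0"
      proof
        assume "x$1 = 0"
        then have "space_part x \<bullet> space_part x = -1" using x by (simp add: lorentz_space_part)
        then show False using inner_ge_zero[of "space_part x"] by linarith
      qed
      then show "x \<in> hyperboloid" using x by (simp add: hyperboloid_def)
    qed (auto simp: hyperboloid_def)
    have "closed {x::real^4. lorentz x x = -1}"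
      unfolding lorentz_def by (intro closed_Collect_eq continuous_intros)
    moreover have "closed {x::real^4. 0 \<le> x$1}" by (intro closed_Collect_le continuous_intros)
    ultimately show ?thesis unfolding eq by (rule closed_Int)
  qed
  show "sqrt (det (gram lorentz H3_chart w)) = 1 / sqrt (1 + (norm w)\<^sup>2)"
  proof -
    have gram: "gram lorentz H3_chart w = (\<chi> i j. 1 * (axis i 1 \<bullet> (axis j 1 :: real^3)) - 1 / (1 + w \<bullet> w) * (w $ i * w $ j))"
      by (simp add: gram_def frechet_derivative_at[OF H3_chart_has_derivative, symmetric] H3_chart_metric inner_axis)
    have "det (gram lorentz H3_chart w) = 1 ^ 3 - 1\<^sup>2 * (1 / (1 + w \<bullet> w)) * (w \<bullet> w)"
      unfolding gram by (rule det_axis_gram)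
    also have "\<dots> = 1 / (1 + w \<bullet> w)" using w by (simp add: field_simps)
    finally show ?thesis by (simp add: real_sqrt_divide power2_norm_eq_inner)
  qed
  show "arcosh_clamped (- 1 * lorentz (axis 1 1) (H3_chart w)) = arsinh (norm w)"
  proof -
    have "- 1 * lorentz (axis 1 1) (H3_chart w) = cosh (arsinh (norm w))"
      by (simp add: lorentz_def axis_def H3_chart_def cosh_arsinh_real power2_norm_eq_inner add.commute)
    then show ?thesis
      by (simp add: arcosh_clamped_def arcosh_cosh_real arsinh_nonneg max_absorb2 cosh_real_ge_1)
  qed
  show "0 < 1 / sqrt (1 + r\<^sup>2)" by (simp add: add_pos_nonneg)
  show "(\<lambda>r::real. 1 / sqrt (1 + r\<^sup>2)) \<in> borel_measurable borel" by measurable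
  show "(arsinh :: real \<Rightarrow> real) \<in> borel_measurable borel"
    by (rule borel_measurable_continuous_onI[OF continuous_on_arsinh])
qed simp_all

definition H3_ball_volume :: "real \<Rightarrow> real" where
  "H3_ball_volume R = pi * (sinh (2 * R) - 2 * R)"

definition H3_slope :: "real \<Rightarrow> real" where
  "H3_slope \<alpha> = cosh \<alpha> / (4 * pi * (sinh \<alpha>)\<^sup>2)"

lemma H3_ball_volume_deriv: "(H3_ball_volume has_real_derivative 4 * pi * (sinh R)\<^sup>2) (at R)"
proof -
  have "(H3_ball_volume has_real_derivative pi * (2 * cosh (2 * R) - 2)) (at R)"
    unfolding H3_ball_volume_def[abs_def] by (auto intro!: derivative_eq_intros)
  then show ?thesis proof (rule DERIV_cong)
    have c: "cosh (2 * R) = 1 + 2 * (sinh R)\<^sup>2" using cosh_double[of R] cosh_square_eq[of R] by simp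
    show "pi * (2 * cosh (2 * R) - 2) = 4 * pi * (sinh R)\<^sup>2" unfolding c by (simp add: algebra_simps)
  qed
qed

text \<open>
  With $c = \cosh r \le C = \cosh R$ the claim is $C(c^2 - 1) \le c(C^2 - 1)$, and the difference of the
  two sides is $(C - c)(cC + 1)$.
\<close>

lemma H3_slope_antimono:
  assumes "0 < r" "r \<le> R"
  shows "H3_slope R \<le> H3_slope r"
proof -
  define c C where "c = cosh r" and "C = cosh R"
  have c: "1 < c" "c \<le> C"
    using assms cosh_real_strict_mono[of 0 r] cosh_real_strict_mono[of r R] by (auto simp: c_def C_def le_less)
  have s: "(sinh r)\<^sup>2 = c\<^sup>2 - 1" "(sinh R)\<^sup>2 = C\<^sup>2 - 1" by (simp_all add: c_def C_def cosh_square_eq)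
  have pos: "0 < c\<^sup>2 - 1" "0 < C\<^sup>2 - 1" using c by (simp_all add: one_less_power)
  have "0 \<le> (C - c) * (c * C + 1)" using c by (intro mult_nonneg_nonneg) auto
  then have "C * (c\<^sup>2 - 1) \<le> c * (C\<^sup>2 - 1)" by (simp add: power2_eq_square algebra_simps)
  then have "C / (C\<^sup>2 - 1) \<le> c / (c\<^sup>2 - 1)" using pos by (simp add: divide_simps mult.commute)
  then have "C / (C\<^sup>2 - 1) / (4 * pi) \<le> c / (c\<^sup>2 - 1) / (4 * pi)" by (intro divide_right_mono) auto
  then show ?thesis by (simp add: H3_slope_def s c_def[symmetric] C_def[symmetric] mult_ac)
qed

lemma H3_kernel_deriv:
  assumes "0 < r"
  shows "((\<lambda>\<alpha>. - 1 / (4 * pi * sinh \<alpha>)) has_real_derivative H3_slope r) (at r)"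
proof -
  have "0 < sinh r" using assms by simp
  then show ?thesis
    by (auto intro!: derivative_eq_intros simp: H3_slope_def power2_eq_square field_simps)
qed

lemma arsinh_deriv: "(arsinh has_real_derivative 1 / sqrt (1 + r\<^sup>2)) (at r)"
  using arsinh_real_has_field_derivative[of r UNIV] by (simp add: add.commute)

lemma H3_biot_savart:
  "biot_savart_space H3 {0..} H3_ball_volume N_H3 H3_slope (\<lambda>x y. arcosh_clamped (- 1 * lorentz x y))"
proof (rule H3.biot_savart[where M = H3 and F = H3_ball_volume and N = N_H3 and s = H3_slope
      and \<phi> = "\<lambda>\<alpha>. - 1 / (4 * pi * sinh \<alpha>)" and c = 1])
  show "distance H3 x y = arcosh_clamped (- 1 * lorentz x y)" if "x \<in> hyperboloid" "y \<in> hyperboloid" for x y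
    using hyperboloid_inner[OF that] by (simp add: H3_def H3_distance_def arcosh_clamped_def)
  show "continuous_on {0..} H3_ball_volume"
    by (rule DERIV_continuous_on[OF has_field_derivative_at_within[OF H3_ball_volume_deriv]])
  show "strict_mono_on {0..} H3_ball_volume"
  proof (rule strict_mono_onI)
    fix r R :: real assume r: "r \<in> {0..}" "R \<in> {0..}" "r < R"
    show "H3_ball_volume r < H3_ball_volume R"
    proof (rule DERIV_pos_imp_increasing_open[OF r(3)])
      fix x assume "r < x" "x < R"
      then have "0 < sinh x" using r by simp
      then have "0 < 4 * pi * (sinh x)\<^sup>2" by simp
      then show "\<exists>y. (H3_ball_volume has_real_derivative y) (at x) \<and> 0 < y"
        using H3_ball_volume_deriv by blast
    qed (rule DERIV_continuous_on[OF has_field_derivative_at_within[OF H3_ball_volume_deriv]])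
  qed
  show "((\<lambda>r. H3_ball_volume (arsinh r)) has_real_derivative 4 * pi * r\<^sup>2 * (1 / sqrt (1 + r\<^sup>2))) (at r)" for r
    using DERIV_chain2[OF H3_ball_volume_deriv arsinh_deriv] by simp
  have N: "((\<lambda>r. N_H3 (arsinh r)) has_real_derivative 1) (at r)" for r
    by (simp add: N_H3_def)
  show "((\<lambda>r. N_H3 (arsinh r)) has_real_derivative 4 * pi * r\<^sup>2 * (1 / sqrt (1 + r\<^sup>2)) * H3_slope (arsinh r)) (at r)"
    if r: "0 < r" for r
  proof (rule DERIV_cong[OF N])
    have "0 < 1 + r\<^sup>2" by (simp add: add_pos_nonneg)
    then show "1 = 4 * pi * r\<^sup>2 * (1 / sqrt (1 + r\<^sup>2)) * H3_slope (arsinh r)"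
      using r by (simp add: H3_slope_def cosh_arsinh_real add.commute)
  qed
  show "((\<lambda>r. N_H3 (arsinh r)) has_real_derivative 1) (at 0)" by (rule N)
  show "(\<exists>a\<ge>0. arsinh a = R \<and> (\<forall>r\<ge>0. arsinh r \<le> R \<longleftrightarrow> r \<le> a)) \<or>
      (\<forall>r\<ge>0. arsinh r \<le> R) \<and> ((\<lambda>r. H3_ball_volume (arsinh r)) \<longlongrightarrow> H3_ball_volume R) at_top \<and>
      ((\<lambda>r. N_H3 (arsinh r)) \<longlongrightarrow> N_H3 R) at_top" if R: "R \<in> {0..}" for R
  proof (intro disjI1 exI[of _ "sinh R"] conjI allI impI)
    show "arsinh r \<le> R \<longleftrightarrow> r \<le> sinh R" for r
      using arsinh_less_iff_real[of "sinh R" r] by (simp add: arsinh_sinh_real not_less[symmetric])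
  qed (use R in \<open>simp_all add: arsinh_sinh_real\<close>)
  show "H3_slope \<in> borel_measurable borel"
    unfolding H3_slope_def[abs_def]
    by (intro borel_measurable_divide borel_measurable_times borel_measurable_power borel_measurable_const
        borel_measurable_continuous_onI continuous_intros)
  show "((\<lambda>\<alpha>. - 1 / (4 * pi * sinh \<alpha>)) has_real_derivative H3_slope r) (at r)" if "r \<in> {0..}" "sinh r \<noteq> 0" for r
    using that by (intro H3_kernel_deriv) (auto simp: le_less)
  show "arsinh r \<in> {0..}" if "0 \<le> r" for r :: real using that by (simp add: arsinh_nonneg)
qed (auto simp: H3_def N_H3_def H3_ball_volume_def H3_slope_def intro: H3_slope_antimono[unfolded H3_slope_def])

section \<open>The three bounds\<close>

theorem theorem7:
  shows
    "(\<forall>\<Omega> V. smooth_domain E3 \<Omega> \<and> smooth_vector_field E3 \<Omega> V \<longrightarrow>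
        L2_norm E3 \<Omega> (BS E3 \<Omega> V) \<le> N_E3 (volume_radius E3 \<Omega>) * L2_norm E3 \<Omega> V \<and>
        \<bar>helicity E3 \<Omega> V\<bar> \<le> N_E3 (volume_radius E3 \<Omega>) * (L2_norm E3 \<Omega> V)\<^sup>2) \<and>
     (\<forall>\<Omega> V. smooth_domain S3 \<Omega> \<and> smooth_vector_field S3 \<Omega> V \<longrightarrow>
        L2_norm S3 \<Omega> (BS S3 \<Omega> V) \<le> N_S3 (volume_radius S3 \<Omega>) * L2_norm S3 \<Omega> V \<and>
        \<bar>helicity S3 \<Omega> V\<bar> \<le> N_S3 (volume_radius S3 \<Omega>) * (L2_norm S3 \<Omega> V)\<^sup>2) \<and>
     (\<forall>\<Omega> V. smooth_domain H3 \<Omega> \<and> smooth_vector_field H3 \<Omega> V \<longrightarrow>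
        L2_norm H3 \<Omega> (BS H3 \<Omega> V) \<le> N_H3 (volume_radius H3 \<Omega>) * L2_norm H3 \<Omega> V \<and>
        \<bar>helicity H3 \<Omega> V\<bar> \<le> N_H3 (volume_radius H3 \<Omega>) * (L2_norm H3 \<Omega> V)\<^sup>2)"
proof (intro conjI allI impI; elim conjE)
  fix \<Omega> V
  assume "smooth_domain E3 \<Omega>" "smooth_vector_field E3 \<Omega> V"
  then show "L2_norm E3 \<Omega> (BS E3 \<Omega> V) \<le> N_E3 (volume_radius E3 \<Omega>) * L2_norm E3 \<Omega> V"
    "\<bar>helicity E3 \<Omega> V\<bar> \<le> N_E3 (volume_radius E3 \<Omega>) * (L2_norm E3 \<Omega> V)\<^sup>2"
    by (rule biot_savart_space.BS_bounds[OF E3_biot_savart])+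
next
  fix \<Omega> V
  assume "smooth_domain S3 \<Omega>" "smooth_vector_field S3 \<Omega> V"
  then show "L2_norm S3 \<Omega> (BS S3 \<Omega> V) \<le> N_S3 (volume_radius S3 \<Omega>) * L2_norm S3 \<Omega> V"
    "\<bar>helicity S3 \<Omega> V\<bar> \<le> N_S3 (volume_radius S3 \<Omega>) * (L2_norm S3 \<Omega> V)\<^sup>2"
    by (rule biot_savart_space.BS_bounds[OF S3_biot_savart])+
next
  fix \<Omega> V
  assume "smooth_domain H3 \<Omega>" "smooth_vector_field H3 \<Omega> V"
  then show "L2_norm H3 \<Omega> (BS H3 \<Omega> V) \<le> N_H3 (volume_radius H3 \<Omega>) * L2_norm H3 \<Omega> V"
    "\<bar>helicity H3 \<Omega> V\<bar> \<le> N_H3 (volume_radius H3 \<Omega>) * (L2_norm H3 \<Omega> V)\<^sup>2"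
    by (rule biot_savart_space.BS_bounds[OF H3_biot_savart])+
qed

end
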